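(* Let $T>0$ and $H^1,\dots,H^m\in C(\mathbb R^d)$. The solution operator of the initial value problem $$du=\sum_{i=1}^mH^i(Du)\cdot dB_i\quad\text{in }\mathbb R^d\times(0,T],\qquad u(\cdot,0)=u_0,$$ with smooth paths has a unique extension to continuous paths if and only if, for each $i=1,\dots,m$, $H^i$ is the difference of two convex functions on $\mathbb R^d$.
   Context: $BUC$ denotes bounded uniformly continuous functions. For a path $B\in C^1([0,T];\mathbb R^m)$ with $B(0)=0$ and $u_0\in BUC(\mathbb R^d)$, the equation is understood as $u_t=\sum_iH^i(Du)\dot B_i$ and has a unique viscosity solution $u\in BUC(\mathbb R^d\times[0,T])$; the solution operator maps $(B,u_0)$ to $u$. "The solution operator with smooth paths has a unique extension to continuous paths" means: for every $B\in C([0,T];\mathbb R^m)$ with $B(0)=0$ and every $u_0\in BUC(\mathbb R^d)$ there exists a (necessarily unique) $u\in BUC(\mathbb R^d\times[0,T])$ such that, for all $B^n\in C^1([0,T];\mathbb R^m)$ with $B^n(0)=0$, $B^n\to B$ uniformly on $[0,T]$, and all $u_0^n\in BUC(\mathbb R^d)$ with $u_0^n\to u_0$ uniformly, the viscosity solutions $u^n$ with data $(B^n,u_0^n)$ converge to $u$ uniformly on $\mathbb R^d\times[0,T]$. *)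

theory Defs
  imports "HOL-Analysis.Analysis" "HOL-Library.FuncSet"
begin

text \<open>
  Bounded uniformly continuous functions on \<open>S\<close>. Elements are fixed to be \<open>undefined\<close> off \<open>S\<close>,
  so that equality of elements of \<open>BUC S\<close> means equality on \<open>S\<close>; for \<open>S = UNIV\<close> this is no
  restriction.
\<close>

definition BUC :: "'a::metric_space set \<Rightarrow> ('a \<Rightarrow> real) set" where
  "BUC S = {u \<in> extensional S. bounded (u ` S) \<and> uniformly_continuous_on S u}"

definition continuous_paths :: "real \<Rightarrow> (real \<Rightarrow> real^'m) set" where
  "continuous_paths T = {B. continuous_on {0..T} B \<and> B 0 = 0}"

text \<open>
  The derivative is one-sided at the endpoints, which is why \<^const>\<open>C1_differentiable_on\<close>
  (two-sided derivatives on the whole set) is not used here.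
\<close>

definition C1_paths :: "real \<Rightarrow> (real \<Rightarrow> real^'m) set" where
  "C1_paths T = {B. B 0 = 0 \<and>
     (\<exists>B'. (\<forall>t\<in>{0..T}. (B has_vector_derivative B' t) (at t within {0..T})) \<and>
           continuous_on {0..T} B')}"

text \<open>
  \<open>\<phi>\<close> is of class $C^1$ on the open set \<open>Q\<close> of space-time with gradient \<open>D\<close>: the first component
  of \<open>D z\<close> is the spatial gradient of \<open>\<phi>\<close> at \<open>z\<close>, the second one its time derivative.
\<close>

definition C1_test_function ::
  "((real^'d) \<times> real) set \<Rightarrow> ((real^'d) \<times> real \<Rightarrow> real) \<Rightarrow> ((real^'d) \<times> real \<Rightarrow> (real^'d) \<times> real) \<Rightarrow> bool"
where
  "C1_test_function Q \<phi> D \<longleftrightarrow> (\<forall>z\<in>Q. GDERIV \<phi> z :> D z) \<and> continuous_on Q D"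

text \<open>The right-hand side $\sum_i H^i(p) \dot B_i(t)$, for \<open>t\<close> in the open time interval.\<close>

definition hamiltonian ::
  "('m::finite \<Rightarrow> real^'d \<Rightarrow> real) \<Rightarrow> (real \<Rightarrow> real^'m) \<Rightarrow> real^'d \<Rightarrow> real \<Rightarrow> real"
where
  "hamiltonian H B p t = (\<Sum>i\<in>UNIV. H i p * (vector_derivative B (at t) $ i))"

definition viscosity_subsolution ::
  "real \<Rightarrow> ('m::finite \<Rightarrow> real^'d \<Rightarrow> real) \<Rightarrow> (real \<Rightarrow> real^'m) \<Rightarrow> ((real^'d) \<times> real \<Rightarrow> real) \<Rightarrow> bool"
where
  "viscosity_subsolution T H B u \<longleftrightarrow>
     (\<forall>\<phi> D x t. C1_test_function (UNIV \<times> {0<..<T}) \<phi> D \<and> 0 < t \<and> t < T \<and>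
        (\<forall>\<^sub>F z in nhds (x, t). u z - \<phi> z \<le> u (x, t) - \<phi> (x, t)) \<longrightarrow>
        snd (D (x, t)) \<le> hamiltonian H B (fst (D (x, t))) t)"

definition viscosity_supersolution ::
  "real \<Rightarrow> ('m::finite \<Rightarrow> real^'d \<Rightarrow> real) \<Rightarrow> (real \<Rightarrow> real^'m) \<Rightarrow> ((real^'d) \<times> real \<Rightarrow> real) \<Rightarrow> bool"
where
  "viscosity_supersolution T H B u \<longleftrightarrow>
     (\<forall>\<phi> D x t. C1_test_function (UNIV \<times> {0<..<T}) \<phi> D \<and> 0 < t \<and> t < T \<and>
        (\<forall>\<^sub>F z in nhds (x, t). u z - \<phi> z \<ge> u (x, t) - \<phi> (x, t)) \<longrightarrow>
        snd (D (x, t)) \<ge> hamiltonian H B (fst (D (x, t))) t)"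

definition viscosity_solution ::
  "real \<Rightarrow> ('m::finite \<Rightarrow> real^'d \<Rightarrow> real) \<Rightarrow> (real \<Rightarrow> real^'m) \<Rightarrow> (real^'d \<Rightarrow> real) \<Rightarrow>
     ((real^'d) \<times> real \<Rightarrow> real) \<Rightarrow> bool"
where
  "viscosity_solution T H B u0 u \<longleftrightarrow>
     u \<in> BUC (UNIV \<times> {0..T}) \<and> viscosity_subsolution T H B u \<and> viscosity_supersolution T H B u \<and>
     (\<forall>x. u (x, 0) = u0 x)"

text \<open>
  Meaningful for \<open>B \<in> C1_paths T\<close> and \<open>u0 \<in> BUC UNIV\<close>, where by the classical theory the initial
  value problem has exactly one viscosity solution.
\<close>

definition solution_operator ::
  "real \<Rightarrow> ('m::finite \<Rightarrow> real^'d \<Rightarrow> real) \<Rightarrow> (real \<Rightarrow> real^'m) \<Rightarrow> (real^'d \<Rightarrow> real) \<Rightarrow>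
     ((real^'d) \<times> real \<Rightarrow> real)"
where
  "solution_operator T H B u0 = (THE u. viscosity_solution T H B u0 u)"

definition has_unique_extension :: "real \<Rightarrow> ('m::finite \<Rightarrow> real^'d \<Rightarrow> real) \<Rightarrow> bool" where
  "has_unique_extension T H \<longleftrightarrow>
     (\<forall>B \<in> continuous_paths T. \<forall>u0 \<in> BUC UNIV. \<exists>!u. u \<in> BUC (UNIV \<times> {0..T}) \<and>
        (\<forall>Bn u0n. (\<forall>n. Bn n \<in> C1_paths T) \<and> uniform_limit {0..T} Bn B sequentially \<and>
                  (\<forall>n. u0n n \<in> BUC UNIV) \<and> uniform_limit UNIV u0n u0 sequentially \<longrightarrow>
           uniform_limit (UNIV \<times> {0..T}) (\<lambda>n. solution_operator T H (Bn n) (u0n n)) u sequentially))"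

definition difference_of_convex :: "('a::real_vector \<Rightarrow> real) \<Rightarrow> bool" where
  "difference_of_convex f \<longleftrightarrow>
     (\<exists>g h. convex_on UNIV g \<and> convex_on UNIV h \<and> (\<forall>p. f p = g p - h p))"

end

theory Submission imports Defs begin

text \<open>
  For paths \<open>B\<close>, \<open>D\<close> and \<open>H i = G i - K i\<close> with \<open>G i\<close>, \<open>K i\<close> convex, variables are doubled with the
  test function \<open>sup p. p \<bullet> z + (\<Sum>i. (B t - D t) i * H i p) - l * ((\<Sum>i. G i p + K i p) + \<bar>p\<bar>\<^sup>2 / 2)\<close>.
  If \<open>\<bar>B - D\<bar> < l\<close>, the expression in \<open>p\<close> is strongly concave, so this function is \<open>C\<^sup>1\<close> and solves
  the doubled equation exactly. As \<open>l\<close> tends to \<open>0\<close> this bounds the difference of the solutions by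
  the uniform distance of the paths only, not of their derivatives. For \<open>B = D\<close> the quadratic test
  function works for every continuous \<open>H\<close>, which gives uniqueness; existence is by Perron's method.

  Conversely, an extension keeps the solutions for all small paths uniformly close to the initial
  datum. Take an initial datum with a steep cone and a path with the single component \<open>b\<close>. The
  Legendre transform \<open>m p t = inf x. u (x, t) - p \<bullet> x\<close> near the vertex is concave in \<open>p\<close>, bounded,
  and \<open>m p t - b t * H i p\<close> is nondecreasing in \<open>t\<close>. Averaging over a path \<open>b\<close> with many oscillations
  exhibits \<open>H i\<close> as a limit of differences of bounded concave functions on a ball, hence as such a
  difference; these local decompositions are then glued.
\<close>

section \<open>Viscosity subsolutions and test functions\<close>

text \<open>Derivatives of paths are not controlled by uniform convergence, so no estimate may
  contain them. In the doubling they disappear through the chain rule: the gradient of the supremum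
  in \<open>(z, c)\<close> is \<open>(p, Hv p)\<close> at the maximiser \<open>p\<close>, so along
  \<open>c = B - D\<close> its time derivative is exactly the difference of the two right-hand
  sides. The quadratic term makes the maximiser unique and continuous, hence the supremum
  \<open>C1\<close>.

  Perron's method is run among Lipschitz functions, where suprema stay continuous and no
  semicontinuous envelopes occur; general data follow by density and contraction.

  In the converse, closeness to the initial datum comes from the zero path, whose solution does not
  move. One rise and fall of \<open>b\<close> yields only one-sided inequalities between values of
  \<open>m\<close>. Their defects are nonnegative and telescope to a bound independent of the number
  of oscillations, so the average defect vanishes. The slope of the cone has to exceed the norm of
  \<open>p\<close>, and the admissible height of the path may depend on that slope; this confines
  the argument to balls and makes the gluing necessary.\<close>

abbreviation slab :: "real \<Rightarrow> ('a \<times> real) set" where "slab T \<equiv> UNIV \<times> {0..T}"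

abbreviation open_slab :: "real \<Rightarrow> ('a \<times> real) set" where "open_slab T \<equiv> UNIV \<times> {0<..<T}"

text \<open>A general right-hand side \<open>F p t\<close> covers the reflected equation with
  \<open>- F (- p) t\<close>, which turns supersolutions into subsolutions, and Hamiltonians that
  are continuous up to the endpoints of the time interval.\<close>

definition subsol :: "real \<Rightarrow> (real^'d \<Rightarrow> real \<Rightarrow> real) \<Rightarrow> ((real^'d) \<times> real \<Rightarrow> real) \<Rightarrow> bool" where
  "subsol T F u \<longleftrightarrow>
     (\<forall>\<phi> D x t. C1_test_function (open_slab T) \<phi> D \<and> 0 < t \<and> t < T \<and>
        (\<forall>\<^sub>F z in nhds (x, t). u z - \<phi> z \<le> u (x, t) - \<phi> (x, t)) \<longrightarrow>
        snd (D (x, t)) \<le> F (fst (D (x, t))) t)"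

definition supersol :: "real \<Rightarrow> (real^'d \<Rightarrow> real \<Rightarrow> real) \<Rightarrow> ((real^'d) \<times> real \<Rightarrow> real) \<Rightarrow> bool" where
  "supersol T F u \<longleftrightarrow>
     (\<forall>\<phi> D x t. C1_test_function (open_slab T) \<phi> D \<and> 0 < t \<and> t < T \<and>
        (\<forall>\<^sub>F z in nhds (x, t). u z - \<phi> z \<ge> u (x, t) - \<phi> (x, t)) \<longrightarrow>
        snd (D (x, t)) \<ge> F (fst (D (x, t))) t)"

lemma subsolD:
  assumes "subsol T F u" "C1_test_function (open_slab T) \<phi> D" "0 < t" "t < T"
    "\<forall>\<^sub>F z in nhds (x, t). u z - \<phi> z \<le> u (x, t) - \<phi> (x, t)"
  shows "snd (D (x, t)) \<le> F (fst (D (x, t))) t"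
  using assms unfolding subsol_def by blast

lemma supersolD:
  assumes "supersol T F u" "C1_test_function (open_slab T) \<phi> D" "0 < t" "t < T"
    "\<forall>\<^sub>F z in nhds (x, t). u z - \<phi> z \<ge> u (x, t) - \<phi> (x, t)"
  shows "snd (D (x, t)) \<ge> F (fst (D (x, t))) t"
  using assms unfolding supersol_def by blast

lemma open_space_time: "open ((UNIV :: 'a::topological_space set) \<times> {0<..<T::real})"
  by (intro open_Times) auto

lemma eventually_space_time:
  assumes "0 < t" "t < (T::real)"
  shows "\<forall>\<^sub>F z in nhds (x, t). z \<in> open_slab T"
  using assms by (intro eventually_nhds_in_open open_space_time) auto

lemma subsol_cong:
  assumes "subsol T F u"
    and F: "\<And>p t. 0 < t \<Longrightarrow> t < T \<Longrightarrow> F p t = G p t"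
    and u: "\<And>x t. 0 < t \<Longrightarrow> t < T \<Longrightarrow> u (x, t) = v (x, t)"
  shows "subsol T G v"
  unfolding subsol_def
proof (intro allI impI, elim conjE)
  fix \<phi> D x t
  assume a: "C1_test_function (open_slab T) \<phi> D" "0 < t" "t < T"
    "\<forall>\<^sub>F z in nhds (x, t). v z - \<phi> z \<le> v (x, t) - \<phi> (x, t)"
  have "\<forall>\<^sub>F z in nhds (x, t). u z - \<phi> z \<le> u (x, t) - \<phi> (x, t)"
    using a(4) eventually_space_time[OF a(2,3)]
    by eventually_elim (use u a in auto)
  then show "snd (D (x, t)) \<le> G (fst (D (x, t))) t"
    using subsolD[OF assms(1) a(1-3)] F[OF a(2,3)] by simp
qed

lemma C1_test_function_add:
  assumes "C1_test_function Q \<phi> D" "C1_test_function Q \<psi> E"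
  shows "C1_test_function Q (\<lambda>z. \<phi> z + \<psi> z) (\<lambda>z. D z + E z)"
  using assms unfolding C1_test_function_def
  by (auto intro!: continuous_intros GDERIV_add)

lemma C1_test_function_minus:
  assumes "C1_test_function Q \<phi> D"
  shows "C1_test_function Q (\<lambda>z. - \<phi> z) (\<lambda>z. - D z)"
  using assms unfolding C1_test_function_def
  by (auto intro!: continuous_intros GDERIV_minus)

lemma C1_test_function_const: "C1_test_function Q (\<lambda>z. c) (\<lambda>z. 0)"
  unfolding C1_test_function_def by (auto intro!: GDERIV_const)

lemma C1_test_function_norm_square:
  "C1_test_function Q (\<lambda>z. (norm (z - a))\<^sup>2) (\<lambda>z. 2 *\<^sub>R (z - a))"
proof -
  have "GDERIV (\<lambda>z. (norm (z - a))\<^sup>2) z :> 2 *\<^sub>R (z - a)" for z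
    unfolding gderiv_def power2_norm_eq_inner
    by (auto intro!: derivative_eq_intros simp: inner_commute algebra_simps)
  then show ?thesis unfolding C1_test_function_def by (auto intro!: continuous_intros)
qed

lemma C1_test_function_time:
  assumes "\<And>t. t \<in> {0<..<T} \<Longrightarrow> (f has_real_derivative f' t) (at t)" "continuous_on {0<..<T} f'"
  shows "C1_test_function (open_slab T) (\<lambda>z. f (snd z)) (\<lambda>z. (0, f' (snd z)))"
  unfolding C1_test_function_def
proof (intro conjI ballI)
  fix z :: "(real^'a) \<times> real" assume "z \<in> open_slab T"
  then have "(f has_derivative (\<lambda>h. f' (snd z) * h)) (at (snd z))"
    using assms(1)[of "snd z"] by (auto simp: has_field_derivative_def)
  from has_derivative_compose[OF has_derivative_snd[OF has_derivative_ident] this]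
  show "GDERIV (\<lambda>z. f (snd z)) z :> (0, f' (snd z))"
    unfolding gderiv_def by (simp add: inner_prod_def mult.commute)
next
  show "continuous_on (open_slab T) (\<lambda>z. (0, f' (snd z)))"
    by (intro continuous_intros continuous_on_compose2[OF assms(2)]) auto
qed

lemma C1_test_function_space:
  assumes "\<And>x. GDERIV f x :> f' x" "continuous_on UNIV f'"
  shows "C1_test_function Q (\<lambda>z. f (fst z)) (\<lambda>z. (f' (fst z), 0))"
  unfolding C1_test_function_def
proof (intro conjI ballI)
  fix z :: "(real^'a) \<times> real"
  have "(f has_derivative (\<lambda>h. inner h (f' (fst z)))) (at (fst z))"
    using assms(1) by (auto simp: gderiv_def)
  from has_derivative_compose[OF has_derivative_fst[OF has_derivative_ident] this]
  show "GDERIV (\<lambda>z. f (fst z)) z :> (f' (fst z), 0)"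
    unfolding gderiv_def by (simp add: inner_prod_def mult.commute)
next
  show "continuous_on Q (\<lambda>z. (f' (fst z), 0))"
    by (intro continuous_intros continuous_on_compose2[OF assms(2)]) auto
qed

lemma GDERIV_compose_translate:
  assumes "GDERIV \<phi> (z + a) :> D"
  shows "GDERIV (\<lambda>z. \<phi> (z + a)) z :> D"
proof -
  have "((\<lambda>z. z + a) has_derivative (\<lambda>h. h)) (at z)"
    by (auto intro!: derivative_eq_intros)
  from has_derivative_compose[OF this, of \<phi>] assms show ?thesis
    unfolding gderiv_def by simp
qed

lemma C1_test_function_translate:
  assumes "C1_test_function (open_slab T) \<phi> D"
  shows "C1_test_function (open_slab T) (\<lambda>z. \<phi> (z + (h, 0))) (\<lambda>z. D (z + (h, 0)))"
proof -
  have m: "z + (h, 0) \<in> open_slab T" if "z \<in> open_slab T" for z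
    using that by (cases z) auto
  show ?thesis
    using assms m unfolding C1_test_function_def
    by (auto intro!: continuous_on_compose2[of "open_slab T" D] continuous_intros
        GDERIV_compose_translate)
qed

lemma supersol_iff_subsol_uminus:
  "supersol T F u \<longleftrightarrow> subsol T (\<lambda>p t. - F (- p) t) (\<lambda>z. - u z)"
proof
  assume s: "supersol T F u"
  show "subsol T (\<lambda>p t. - F (- p) t) (\<lambda>z. - u z)"
    unfolding subsol_def
  proof (intro allI impI, elim conjE)
    fix \<phi> D x t
    assume a: "C1_test_function (open_slab T) \<phi> D" "0 < t" "t < T"
      "\<forall>\<^sub>F z in nhds (x, t). - u z - \<phi> z \<le> - u (x, t) - \<phi> (x, t)"
    have "\<forall>\<^sub>F z in nhds (x, t). u z - - \<phi> z \<ge> u (x, t) - - \<phi> (x, t)"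
      using a(4) by eventually_elim simp
    from supersolD[OF s C1_test_function_minus[OF a(1)] a(2,3) this]
    show "snd (D (x, t)) \<le> - F (- fst (D (x, t))) t" by simp
  qed
next
  assume s: "subsol T (\<lambda>p t. - F (- p) t) (\<lambda>z. - u z)"
  show "supersol T F u"
    unfolding supersol_def
  proof (intro allI impI, elim conjE)
    fix \<phi> D x t
    assume a: "C1_test_function (open_slab T) \<phi> D" "0 < t" "t < T"
      "\<forall>\<^sub>F z in nhds (x, t). u z - \<phi> z \<ge> u (x, t) - \<phi> (x, t)"
    have "\<forall>\<^sub>F z in nhds (x, t). - u z - - \<phi> z \<le> - u (x, t) - - \<phi> (x, t)"
      using a(4) by eventually_elim simp
    from subsolD[OF s C1_test_function_minus[OF a(1)] a(2,3) this]
    show "F (fst (D (x, t))) t \<le> snd (D (x, t))" by simp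
  qed
qed

section \<open>One-sided growth and the gradients of touching test functions\<close>

lemma GDERIV_directional_ge:
  fixes \<phi> :: "'a::real_inner \<Rightarrow> real"
  assumes "GDERIV \<phi> z :> D" and "\<forall>\<^sub>F h in at_right 0. \<phi> z + a * h \<le> \<phi> (z + h *\<^sub>R e)"
  shows "a \<le> D \<bullet> e"
proof -
  have "((\<lambda>h. z + h *\<^sub>R e) has_derivative (\<lambda>h. h *\<^sub>R e)) (at 0)"
    by (auto intro!: derivative_eq_intros)
  moreover have "(\<phi> has_derivative (\<lambda>h. h \<bullet> D)) (at (z + 0 *\<^sub>R e))"
    using assms(1) by (simp add: gderiv_def)
  ultimately have "((\<lambda>h. \<phi> (z + h *\<^sub>R e)) has_derivative (\<lambda>h. (h *\<^sub>R e) \<bullet> D)) (at 0)"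
    by (rule has_derivative_compose)
  then have "((\<lambda>h. \<phi> (z + h *\<^sub>R e)) has_real_derivative (D \<bullet> e)) (at 0)"
    unfolding has_field_derivative_def
    by (rule has_derivative_eq_rhs) (simp add: fun_eq_iff inner_commute mult.commute)
  then have "((\<lambda>h. (\<phi> (z + h *\<^sub>R e) - \<phi> z) / h) \<longlongrightarrow> D \<bullet> e) (at 0)"
    by (simp add: DERIV_def)
  then have "((\<lambda>h. (\<phi> (z + h *\<^sub>R e) - \<phi> z) / h) \<longlongrightarrow> D \<bullet> e) (at_right 0)"
    by (rule filterlim_mono) (auto intro: at_le)
  moreover have "\<forall>\<^sub>F h in at_right 0. a \<le> (\<phi> (z + h *\<^sub>R e) - \<phi> z) / h"
    using assms(2) eventually_at_right_less[of 0]
    by eventually_elim (simp add: field_simps)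
  ultimately show ?thesis
    by (rule tendsto_lowerbound) simp
qed

text \<open>Up to a constant \<open>\<phi>\<close> lies above \<open>u\<close> near \<open>z\<close>
  with equality at \<open>z\<close>, so it inherits every lower bound on the growth of
  \<open>u\<close> along \<open>e\<close>.\<close>

lemma touching_directional_ge:
  fixes \<phi> :: "'a::real_inner \<Rightarrow> real"
  assumes "GDERIV \<phi> z :> D" and t: "\<forall>\<^sub>F w in nhds z. u w - \<phi> w \<le> u z - \<phi> z"
    and "\<forall>\<^sub>F h in at_right 0. u z + a * h \<le> u (z + h *\<^sub>R e)"
  shows "a \<le> D \<bullet> e"
proof (rule GDERIV_directional_ge[OF assms(1)])
  have "((\<lambda>h. z + h *\<^sub>R e) \<longlongrightarrow> z + 0 *\<^sub>R e) (at_right 0)"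
    by (intro tendsto_intros)
  then have "filterlim (\<lambda>h. z + h *\<^sub>R e) (nhds z) (at_right 0)" by simp
  from eventually_compose_filterlim[OF t this]
  show "\<forall>\<^sub>F h in at_right 0. \<phi> z + a * h \<le> \<phi> (z + h *\<^sub>R e)"
    using assms(3) by eventually_elim linarith
qed

lemma touching_gradient_bound:
  fixes x :: "real^'d"
  assumes "GDERIV \<phi> (x, t) :> D" and t: "\<forall>\<^sub>F w in nhds (x, t). u w - \<phi> w \<le> u (x, t) - \<phi> (x, t)"
    and "K \<ge> 0" and "\<And>h. u (x, t) - K * norm h \<le> u (x + h, t)"
  shows "norm (fst D) \<le> K"
proof -
  \<comment> \<open>The direction of steepest descent in space turns the growth bound into a bound
    for the norm of the gradient.\<close>
  have "- (K * norm (fst D)) \<le> D \<bullet> (- fst D, 0)"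
  proof (rule touching_directional_ge[OF assms(1,2)])
    show "\<forall>\<^sub>F h in at_right 0. u (x, t) + - (K * norm (fst D)) * h \<le> u ((x, t) + h *\<^sub>R (- fst D, 0))"
      using eventually_at_right_less[of 0]
    proof eventually_elim
      case (elim h)
      then show ?case using assms(4)[of "h *\<^sub>R (- fst D)"] by (simp add: algebra_simps)
    qed
  qed
  then have "norm (fst D) * norm (fst D) \<le> K * norm (fst D)"
    by (simp add: inner_prod_def dot_square_norm power2_eq_square)
  then show ?thesis using \<open>K \<ge> 0\<close>
    by (metis mult_right_le_imp_le norm_ge_zero less_eq_real_def)
qed

text \<open>Holds because \<open>F\<close> does not depend on the space variable.\<close>

lemma subsol_translate:
  assumes "subsol T F w"
  shows "subsol T F (\<lambda>z. w (z + (h, 0)) - c)"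
  unfolding subsol_def
proof (intro allI impI, elim conjE)
  fix \<phi> D x t
  assume a: "C1_test_function (open_slab T) \<phi> D" "0 < t" "t < T"
    and e: "\<forall>\<^sub>F z in nhds (x, t). w (z + (h, 0)) - c - \<phi> z \<le> w ((x, t) + (h, 0)) - c - \<phi> (x, t)"
  have "((\<lambda>z. z + (-h, 0)) \<longlongrightarrow> (x + h, t) + (-h, 0)) (nhds (x + h, t))"
    by (intro tendsto_intros filterlim_ident)
  then have f: "filterlim (\<lambda>z. z + (-h, 0)) (nhds (x, t)) (nhds (x + h, t))" by simp
  have "\<forall>\<^sub>F z in nhds (x + h, t). w z - \<phi> (z + (-h, 0)) \<le> w (x + h, t) - \<phi> ((x + h, t) + (-h, 0))"
    using eventually_compose_filterlim[OF e f]
    by eventually_elim (auto simp: algebra_simps zero_prod_def[symmetric])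
  from subsolD[OF assms C1_test_function_translate[OF a(1)] a(2,3) this]
  show "snd (D (x, t)) \<le> F (fst (D (x, t))) t" by simp
qed

text \<open>Covers both suprema and uniform limits of subsolutions.\<close>

lemma subsol_approx:
  fixes u :: "(real^'d) \<times> real \<Rightarrow> real"
  assumes F: "continuous_on (open_slab T) (\<lambda>(p, t). F p t)"
    and approx: "\<And>z \<delta>. z \<in> open_slab T \<Longrightarrow> \<delta> > 0 \<Longrightarrow> \<exists>w. subsol T F w \<and> continuous_on (open_slab T) w \<and>
          (\<forall>z'\<in>open_slab T. w z' \<le> u z' + \<delta>) \<and> w z \<ge> u z - \<delta>"
  shows "subsol T F u"
  unfolding subsol_def
proof (intro allI impI, elim conjE)
  let ?Q = "open_slab T :: ((real^'d) \<times> real) set"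
  fix \<phi> D x t
  assume a: "C1_test_function ?Q \<phi> D" "0 < t" "t < T"
    and e: "\<forall>\<^sub>F z in nhds (x, t). u z - \<phi> z \<le> u (x, t) - \<phi> (x, t)"
  define z0 where "z0 = (x, t)"
  have z0: "z0 \<in> ?Q" using a by (simp add: z0_def)
  \<comment> \<open>The quadratic term makes the touching at \<open>z0\<close> strict, so that
    maximum points for the approximating subsolutions are forced towards \<open>z0\<close>. Its
    gradient vanishes at \<open>z0\<close>, hence the limit inequality is the one for
    \<open>\<phi>\<close>.\<close>
  define \<psi> where "\<psi> = (\<lambda>z. \<phi> z + (norm (z - z0))\<^sup>2)"
  define E where "E = (\<lambda>z. D z + 2 *\<^sub>R (z - z0))"
  have psi: "C1_test_function ?Q \<psi> E"
    unfolding \<psi>_def E_def by (intro C1_test_function_add a C1_test_function_norm_square)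
  have contpsi: "continuous_on ?Q \<psi>"
    using psi unfolding C1_test_function_def gderiv_def
    by (meson continuous_at_imp_continuous_on has_derivative_continuous)
  have contE: "continuous_on ?Q E" using psi unfolding C1_test_function_def by auto
  have "\<forall>\<^sub>F z in nhds z0. z \<in> ?Q \<and> u z - \<phi> z \<le> u z0 - \<phi> z0"
    using e eventually_space_time[OF a(2,3)] unfolding z0_def by eventually_elim auto
  then obtain r0 where r0: "r0 > 0" "\<And>z. dist z z0 < r0 \<Longrightarrow> z \<in> ?Q \<and> u z - \<phi> z \<le> u z0 - \<phi> z0"
    unfolding eventually_nhds_metric by auto
  define r where "r = r0 / 2"
  have "r > 0" using r0(1) by (simp add: r_def)
  have in_r0: "dist z z0 < r0" if "z \<in> cball z0 r" for z
    using that r0(1) by (simp add: r_def dist_commute)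
  have r: "r > 0" "cball z0 r \<subseteq> ?Q" "\<And>z. z \<in> cball z0 r \<Longrightarrow> u z - \<phi> z \<le> u z0 - \<phi> z0"
    using \<open>r > 0\<close> r0(2)[OF in_r0] by auto
  \<comment> \<open>The condition \<open>2 * \<delta> < r\<^sup>2\<close> keeps the maximum point
    over the closed ball in its interior, where the definition of a subsolution applies.\<close>
  have near: "\<exists>z\<in>?Q. (dist z z0)\<^sup>2 \<le> 2 * \<delta> \<and> snd (E z) \<le> F (fst (E z)) (snd z)"
    if d: "\<delta> > 0" "2 * \<delta> < r\<^sup>2" for \<delta>
  proof -
    obtain w where w: "subsol T F w" "continuous_on ?Q w" "\<And>z'. z' \<in> ?Q \<Longrightarrow> w z' \<le> u z' + \<delta>" "w z0 \<ge> u z0 - \<delta>"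
      using approx[OF z0 d(1)] by blast
    have "continuous_on (cball z0 r) (\<lambda>z. w z - \<psi> z)"
      using w(2) contpsi r(2) by (intro continuous_intros) (auto intro: continuous_on_subset)
    then obtain z1 where z1: "z1 \<in> cball z0 r" "\<And>z. z \<in> cball z0 r \<Longrightarrow> w z - \<psi> z \<le> w z1 - \<psi> z1"
      using continuous_attains_sup[of "cball z0 r" "\<lambda>z. w z - \<psi> z"] r(1) by auto
    have "u z0 - \<delta> - \<phi> z0 \<le> w z1 - \<psi> z1"
      using z1(2)[of z0] w(4) r(1) by (simp add: \<psi>_def)
    also have "\<dots> \<le> u z1 + \<delta> - \<phi> z1 - (norm (z1 - z0))\<^sup>2"
      using w(3)[of z1] z1(1) r(2) by (auto simp: \<psi>_def)
    also have "\<dots> \<le> u z0 - \<phi> z0 + \<delta> - (norm (z1 - z0))\<^sup>2"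
      using r(3)[OF z1(1)] by simp
    finally have sq: "(dist z1 z0)\<^sup>2 \<le> 2 * \<delta>" by (simp add: dist_norm)
    then have "dist z1 z0 < r" using d(2) r(1)
      by (meson le_less_trans less_imp_le power_less_imp_less_base)
    then have "z1 \<in> ball z0 r" by (simp add: dist_commute)
    then have "\<forall>\<^sub>F z in nhds z1. z \<in> ball z0 r" by (intro eventually_nhds_in_open) auto
    then have ev: "\<forall>\<^sub>F z in nhds (fst z1, snd z1). w z - \<psi> z \<le> w (fst z1, snd z1) - \<psi> (fst z1, snd z1)"
      by (simp, eventually_elim) (use z1(2) in auto)
    have "z1 \<in> ?Q" using z1(1) r(2) by auto
    moreover from this have "snd (E z1) \<le> F (fst (E z1)) (snd z1)"
      using subsolD[OF w(1) psi _ _ ev] by auto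
    ultimately show ?thesis using sq by (intro bexI[of _ z1] conjI)
  qed
  define \<delta> where "\<delta> = (\<lambda>n. r\<^sup>2 / 4 * inverse (real (Suc n)))"
  have dpos: "\<delta> n > 0" "2 * \<delta> n < r\<^sup>2" for n
  proof -
    show "\<delta> n > 0" unfolding \<delta>_def using r(1) by (intro mult_pos_pos) auto
    have "\<delta> n \<le> r\<^sup>2 / 4 * 1" unfolding \<delta>_def
      by (intro mult_left_mono) (auto simp: inverse_eq_divide divide_simps)
    moreover have "r\<^sup>2 > 0" using r(1) by simp
    ultimately show "2 * \<delta> n < r\<^sup>2" by linarith
  qed
  have "\<forall>n. \<exists>z\<in>?Q. (dist z z0)\<^sup>2 \<le> 2 * \<delta> n \<and> snd (E z) \<le> F (fst (E z)) (snd z)"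
    using near[OF dpos] by blast
  then obtain zn where zn: "\<And>n. zn n \<in> ?Q" "\<And>n. (dist (zn n) z0)\<^sup>2 \<le> 2 * \<delta> n"
     "\<And>n. snd (E (zn n)) \<le> F (fst (E (zn n))) (snd (zn n))"
    by metis
  have "(\<lambda>n. 2 * \<delta> n) \<longlonglongrightarrow> 2 * (r\<^sup>2 / 4 * 0)"
    unfolding \<delta>_def by (intro tendsto_mult tendsto_const LIMSEQ_inverse_real_of_nat)
  then have "(\<lambda>n. 2 * \<delta> n) \<longlonglongrightarrow> 0" by simp
  then have "(\<lambda>n. (dist (zn n) z0)\<^sup>2) \<longlonglongrightarrow> 0"
    by (rule tendsto_sandwich[rotated 2, OF tendsto_const]) (use zn(2) in auto)
  then have "(\<lambda>n. sqrt ((dist (zn n) z0)\<^sup>2)) \<longlonglongrightarrow> sqrt 0" by (rule tendsto_real_sqrt)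
  then have "(\<lambda>n. dist (zn n) z0) \<longlonglongrightarrow> 0" by simp
  then have lim: "zn \<longlonglongrightarrow> z0" by (rule tendsto_dist_iff[THEN iffD2])
  have Ez: "(\<lambda>n. E (zn n)) \<longlonglongrightarrow> E z0"
    using continuous_on_tendsto_compose[OF contE lim z0] zn(1) by simp
  have "(\<lambda>n. (fst (E (zn n)), snd (zn n))) \<longlonglongrightarrow> (fst (E z0), snd z0)"
    by (intro tendsto_intros Ez lim)
  then have "(\<lambda>n. (\<lambda>(p, t). F p t) (fst (E (zn n)), snd (zn n))) \<longlonglongrightarrow> (\<lambda>(p, t). F p t) (fst (E z0), snd z0)"
    by (rule continuous_on_tendsto_compose[OF F]) (use z0 zn(1) in \<open>auto simp: mem_Times_iff\<close>)
  then have "snd (E z0) \<le> F (fst (E z0)) (snd z0)"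
    by (intro LIMSEQ_le[OF tendsto_snd[OF Ez]]) (use zn(3) in auto)
  then show "snd (D (x, t)) \<le> F (fst (D (x, t))) t" by (simp add: E_def z0_def)
qed

section \<open>Doubling of variables and comparison\<close>

text \<open>A smooth substitute for the norm: it penalises large \<open>x\<close> and its gradient
  stays bounded by 1, so a small multiple perturbs gradients only slightly.\<close>

lemma GDERIV_sqrt_one_plus_norm_square:
  "GDERIV (\<lambda>x. sqrt (1 + (norm x)\<^sup>2)) x :> (1 / sqrt (1 + (norm x)\<^sup>2)) *\<^sub>R x"
proof -
  have pos: "1 + (norm x)\<^sup>2 > 0" by (simp add: add_pos_nonneg)
  have "((\<lambda>x. 1 + x \<bullet> x) has_derivative (\<lambda>h. 2 * (h \<bullet> x))) (at x)"
    by (auto intro!: derivative_eq_intros simp: inner_commute)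
  moreover have "(sqrt has_derivative (\<lambda>h. inverse (sqrt (1 + x \<bullet> x)) / 2 * h)) (at (1 + x \<bullet> x))"
    using DERIV_real_sqrt[of "1 + x \<bullet> x"] pos
    unfolding has_field_derivative_def power2_norm_eq_inner by fast
  ultimately have "((\<lambda>x. sqrt (1 + x \<bullet> x)) has_derivative
      (\<lambda>h. inverse (sqrt (1 + x \<bullet> x)) / 2 * (2 * (h \<bullet> x)))) (at x)"
    by (rule has_derivative_compose)
  then show ?thesis
    unfolding gderiv_def power2_norm_eq_inner
    by (rule has_derivative_eq_rhs) (simp add: fun_eq_iff inverse_eq_divide)
qed

lemma norm_gradient_sqrt_le:
  "norm ((1 / sqrt (1 + (norm x)\<^sup>2)) *\<^sub>R x) \<le> 1"
proof -
  have "norm x \<le> sqrt (1 + (norm x)\<^sup>2)" by (rule real_le_rsqrt) simp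
  moreover have "sqrt (1 + (norm x)\<^sup>2) > 0" by (simp add: add_pos_nonneg)
  ultimately show ?thesis by simp
qed

text \<open>
  The variables are doubled in time as well as in space; the barriers \<open>\<eta> / (T - t)\<close> keep the maximum
  point away from the terminal time and supply the strict inequality.
\<close>

lemma doubling_before_terminal_time:
  fixes u v :: "(real^'d) \<times> real \<Rightarrow> real"
  assumes T: "T > 0"
    and u: "subsol T F u" and v: "supersol T G v"
    and bu: "\<And>z. z \<in> slab T \<Longrightarrow> \<bar>u z\<bar> \<le> M" and bv: "\<And>z. z \<in> slab T \<Longrightarrow> \<bar>v z\<bar> \<le> M"
    and uu: "uniformly_continuous_on (slab T) u" and uv: "uniformly_continuous_on (slab T) v"
    and F: "continuous_on (slab T) (\<lambda>(p, t). F p t)"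
    and G: "continuous_on (slab T) (\<lambda>(p, t). G p t)"
    and gphi: "\<And>z t. 0 < t \<Longrightarrow> t < T \<Longrightarrow> GDERIV (\<lambda>(z, t). \<phi> z t) (z, t) :> (p z t, F (p z t) t - G (p z t) t)"
    and cphi: "continuous_on (slab T) (\<lambda>(z, t). \<phi> z t)"
    and cp: "continuous_on (slab T) (\<lambda>(z, t). p z t)"
    and low: "\<And>z t. t \<in> {0..T} \<Longrightarrow> norm z - m \<le> \<phi> z t"
    and init: "\<And>x y. u (x, 0) - v (y, 0) - \<phi> (x - y) 0 \<le> A"
    and t1: "0 \<le> t1" "t1 < T"
  shows "u (x1, t1) - v (y1, t1) - \<phi> (x1 - y1) t1 \<le> A"
proof (rule ccontr)
  \<comment> \<open>A quarter of the excess. At the reference point the two time barriers together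
    cost \<open>\<sigma>\<close> and the penalty at infinity costs at most \<open>\<sigma>\<close>,
    so \<open>\<Theta>\<close> still exceeds \<open>A\<close> by \<open>2 * \<sigma>\<close>
    there.\<close>
  define \<sigma> where "\<sigma> = (u (x1, t1) - v (y1, t1) - \<phi> (x1 - y1) t1 - A) / 4"
  assume "\<not> ?thesis"
  then have \<sigma>: "\<sigma> > 0" by (simp add: \<sigma>_def)
  define \<eta> where "\<eta> = \<sigma> * (T - t1) / 2"
  have \<eta>: "\<eta> > 0" using \<sigma> t1 by (simp add: \<eta>_def)
  \<comment> \<open>Where \<open>\<Theta> \<ge> A\<close>, both \<open>norm (x - y)\<close> and each
    of the nonnegative penalties are at most \<open>Z\<close>.\<close>
  define Z where "Z = 2 * M - A + m"
  \<comment> \<open>A lower bound for the slope of either time barrier. The errors from shifting the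
    arguments of \<open>F\<close> and \<open>G\<close> will each be kept below it.\<close>
  define \<kappa> where "\<kappa> = \<eta> / T\<^sup>2"
  have \<kappa>: "\<kappa> > 0" using \<eta> T by (simp add: \<kappa>_def)
  define KZ where "KZ = (cball 0 Z :: (real^'d) set) \<times> {0..T}"
  have compact_KZ: "compact KZ" unfolding KZ_def by (intro compact_Times) auto
  have "compact ((\<lambda>(z, t). p z t) ` KZ)"
    by (rule compact_continuous_image[OF continuous_on_subset[OF cp] compact_KZ]) (auto simp: KZ_def)
  then obtain P where P: "\<And>z t. (z, t) \<in> KZ \<Longrightarrow> norm (p z t) \<le> P"
    unfolding bounded_iff[of "(\<lambda>(z, t). p z t) ` KZ"] using compact_imp_bounded
    by (metis (mono_tags, lifting) bounded_iff case_prod_conv image_eqI)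
  define KP where "KP = (cball 0 (P + 1) :: (real^'d) set) \<times> {0..T}"
  have KP_mem: "(p, t) \<in> KP \<longleftrightarrow> norm p \<le> P + 1 \<and> t \<in> {0..T}" for p t
    by (simp add: KP_def)
  have compact_KP: "compact KP" unfolding KP_def by (intro compact_Times) auto
  have "uniformly_continuous_on KP (\<lambda>(p, t). F p t)"
    by (rule compact_uniformly_continuous[OF continuous_on_subset[OF F] compact_KP]) (auto simp: KP_def)
  then obtain d1 where d1: "d1 > 0" "\<And>a b. a \<in> KP \<Longrightarrow> b \<in> KP \<Longrightarrow> dist b a < d1 \<Longrightarrow>
      dist (case b of (p, t) \<Rightarrow> F p t) (case a of (p, t) \<Rightarrow> F p t) < \<kappa>"
    using \<kappa> unfolding uniformly_continuous_on_def by metis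
  have "uniformly_continuous_on KP (\<lambda>(p, t). G p t)"
    by (rule compact_uniformly_continuous[OF continuous_on_subset[OF G] compact_KP]) (auto simp: KP_def)
  then obtain d2 where d2: "d2 > 0" "\<And>a b. a \<in> KP \<Longrightarrow> b \<in> KP \<Longrightarrow> dist b a < d2 \<Longrightarrow>
      dist (case b of (p, t) \<Rightarrow> G p t) (case a of (p, t) \<Rightarrow> G p t) < \<kappa>"
    using \<kappa> unfolding uniformly_continuous_on_def by metis
  have "uniformly_continuous_on KZ (\<lambda>(z, t). \<phi> z t)"
    by (rule compact_uniformly_continuous[OF continuous_on_subset[OF cphi] compact_KZ]) (auto simp: KZ_def)
  moreover have s2: "\<sigma> / 2 > 0" using \<sigma> by simp
  ultimately obtain d3 where d3: "d3 > 0" "\<And>a b. a \<in> KZ \<Longrightarrow> b \<in> KZ \<Longrightarrow> dist b a < d3 \<Longrightarrow>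
      dist (case b of (p, t) \<Rightarrow> \<phi> p t) (case a of (p, t) \<Rightarrow> \<phi> p t) < \<sigma> / 2"
    unfolding uniformly_continuous_on_def by metis
  obtain d4 where d4: "d4 > 0" "\<And>a b. a \<in> slab T \<Longrightarrow> b \<in> slab T \<Longrightarrow> dist b a < d4 \<Longrightarrow>
      dist (u b) (u a) < \<sigma> / 2"
    using uu s2 unfolding uniformly_continuous_on_def by metis
  obtain d5 where d5: "d5 > 0" "\<And>a b. a \<in> slab T \<Longrightarrow> b \<in> slab T \<Longrightarrow> dist b a < d5 \<Longrightarrow>
      dist (v b) (v a) < \<sigma> / 2"
    using uv s2 unfolding uniformly_continuous_on_def by metis
  define d where "d = Min {d1, d2, d3, d4, d5}"
  have d: "d > 0" "d \<le> d1" "d \<le> d2" "d \<le> d3" "d \<le> d4" "d \<le> d5"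
    using d1(1) d2(1) d3(1) d4(1) d5(1) by (auto simp: d_def)

  have phi_low: "\<phi> z t \<ge> - m" if "t \<in> {0..T}" for z t
    using low[OF that, of z] norm_ge_zero[of z] by linarith
  have "u (x1, t1) - v (y1, t1) - \<phi> (x1 - y1) t1 \<ge> A"
    using \<sigma> by (simp add: \<sigma>_def)
  then have Z0: "Z \<ge> 0"
    using bu[of "(x1, t1)"] bv[of "(y1, t1)"] phi_low[of t1 "x1 - y1"] t1 by (auto simp: Z_def)
  \<comment> \<open>Makes \<open>(t - s)\<^sup>2 / (2 * \<alpha>) \<le> Z\<close> imply
    \<open>\<bar>t - s\<bar> < d\<close>.\<close>
  define \<alpha> where "\<alpha> = d\<^sup>2 / (4 * (Z + 1))"
  have \<alpha>: "\<alpha> > 0" using d Z0 by (simp add: \<alpha>_def)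
  define e where "e = (\<lambda>x :: real^'d. sqrt (1 + (norm x)\<^sup>2))"
  define e' where "e' = (\<lambda>x :: real^'d. (1 / sqrt (1 + (norm x)\<^sup>2)) *\<^sub>R x)"
  have epos: "e x > 0" for x by (simp add: e_def add_pos_nonneg)
  have enorm: "norm x \<le> e x" for x unfolding e_def by (rule real_le_rsqrt) simp
  \<comment> \<open>The three entries bound the cost of the penalty at \<open>x1\<close>, keep the
    perturbed gradient in \<open>KP\<close>, and keep the perturbation below
    \<open>d1\<close>.\<close>
  define \<gamma> where "\<gamma> = Min {\<sigma> / e x1, 1, d1 / 2}"
  have \<gamma>: "\<gamma> > 0" "\<gamma> \<le> \<sigma> / e x1" "\<gamma> \<le> 1" "\<gamma> \<le> d1 / 2"
  proof -
    have "finite {\<sigma> / e x1, 1, d1 / 2}" by simp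
    from Min_le[OF this] show "\<gamma> \<le> \<sigma> / e x1" "\<gamma> \<le> 1" "\<gamma> \<le> d1 / 2"
      unfolding \<gamma>_def by blast+
    show "\<gamma> > 0" using \<sigma> epos d1(1) by (simp add: \<gamma>_def)
  qed
  have \<gamma>1: "\<gamma> * e x1 \<le> \<sigma>" using \<gamma>(2) epos[of x1] by (simp add: field_simps)
  have e'1: "norm (e' x) \<le> 1" for x unfolding e'_def by (rule norm_gradient_sqrt_le)
  define \<Theta> where "\<Theta> = (\<lambda>x y t s. u (x, t) - v (y, s) - \<phi> (x - y) t - (t - s)\<^sup>2 / (2 * \<alpha>)
      - \<eta> / (T - t) - \<eta> / (T - s) - \<gamma> * e x)"
  have bounds: "norm (x - y) \<le> Z" "\<bar>t - s\<bar> < d" "\<gamma> * norm x \<le> Z" "\<eta> \<le> Z * (T - t)" "\<eta> \<le> Z * (T - s)"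
    if ge: "\<Theta> x y t s \<ge> A" and ts: "0 \<le> t" "t < T" "0 \<le> s" "s < T" for x y t s
  proof -
    have 1: "u (x, t) \<le> M" "- v (y, s) \<le> M" using bu[of "(x, t)"] bv[of "(y, s)"] ts by auto
    have 2: "(t - s)\<^sup>2 / (2 * \<alpha>) \<ge> 0" "\<eta> / (T - t) \<ge> 0" "\<eta> / (T - s) \<ge> 0" "\<gamma> * e x \<ge> 0"
      using \<alpha> \<eta> ts \<gamma>(1) epos[of x] by auto
    have 3: "\<phi> (x - y) t \<ge> norm (x - y) - m" "\<phi> (x - y) t \<ge> -m"
      using low[of t "x - y"] phi_low[of t "x - y"] ts by auto
    show "norm (x - y) \<le> Z" using ge 1 2 3 unfolding \<Theta>_def Z_def by linarith
    have "\<eta> / (T - t) \<le> Z" using ge 1 2 3 unfolding \<Theta>_def Z_def by linarith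
    then show "\<eta> \<le> Z * (T - t)" using ts by (simp add: field_simps)
    have "\<eta> / (T - s) \<le> Z" using ge 1 2 3 unfolding \<Theta>_def Z_def by linarith
    then show "\<eta> \<le> Z * (T - s)" using ts by (simp add: field_simps)
    have "\<gamma> * e x \<le> Z" using ge 1 2 3 unfolding \<Theta>_def Z_def by linarith
    then show "\<gamma> * norm x \<le> Z" using mult_left_mono[OF enorm[of x], of \<gamma>] \<gamma>(1) by linarith
    have "(t - s)\<^sup>2 / (2 * \<alpha>) \<le> Z" using ge 1 2 3 unfolding \<Theta>_def Z_def by linarith
    then have "(t - s)\<^sup>2 \<le> 2 * \<alpha> * Z" using \<alpha> by (simp add: field_simps)
    also have "\<dots> = d\<^sup>2 * (Z / (2 * (Z + 1)))" using Z0 by (simp add: \<alpha>_def field_simps)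
    also have "\<dots> < d\<^sup>2 * 1"
      using Z0 d(1) by (intro mult_strict_left_mono) (auto simp: field_simps)
    finally have "\<bar>t - s\<bar>\<^sup>2 < d\<^sup>2" by simp
    then show "\<bar>t - s\<bar> < d" using d(1) by (meson less_imp_le power_less_imp_less_base)
  qed

  \<comment> \<open>The blow-up of the barriers excludes the times after
    \<open>T - \<delta>\<close>, so the maximum can be sought on a compact set.\<close>
  define \<delta> where "\<delta> = \<eta> / (Z + 1)"
  have \<delta>: "\<delta> > 0" using \<eta> Z0 by (simp add: \<delta>_def)
  have tdelta: "t < T - \<delta>" if "\<eta> \<le> Z * (T - t)" for t
  proof -
    have "(Z + 1) * (T - t) > \<eta>"
    proof (cases "T - t > 0")
      case True then show ?thesis using that by (simp add: algebra_simps)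
    next
      case False
      then have "Z * (T - t) \<le> 0" using Z0 by (simp add: mult_nonneg_nonpos)
      then show ?thesis using that \<eta> by linarith
    qed
    then show ?thesis using Z0 by (simp add: \<delta>_def field_simps)
  qed
  define R where "R = Z / \<gamma> + 1"
  define K where "K = (cball 0 R :: (real^'d) set) \<times> (cball 0 (R + Z) :: (real^'d) set) \<times> {0..T - \<delta>} \<times> {0..T - \<delta>}"
  have compact_K: "compact K" unfolding K_def by (intro compact_Times) auto
  have bounds2: "norm x < R" "norm y < R + Z" "t < T - \<delta>" "s < T - \<delta>"
    if "\<Theta> x y t s \<ge> A" "0 \<le> t" "t < T" "0 \<le> s" "s < T" for x y t s
  proof -
    note b = bounds[OF that]
    show x: "norm x < R" using b(3) \<gamma>(1) by (simp add: R_def field_simps)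
    have "norm y \<le> norm x + norm (x - y)" by (metis norm_minus_commute norm_triangle_sub)
    then show "norm y < R + Z" using x b(1) by linarith
    show "t < T - \<delta>" "s < T - \<delta>" using tdelta b by auto
  qed
  have "continuous_on K (\<lambda>(x, y, t, s). \<Theta> x y t s)"
  proof -
    have cu: "continuous_on (slab T) u" "continuous_on (slab T) v"
      using uu uv by (auto intro: uniformly_continuous_imp_continuous)
    have 1: "continuous_on K (\<lambda>w. u (fst w, fst (snd (snd w))))"
      by (rule continuous_on_compose2[OF cu(1)]) (use \<delta> in \<open>auto intro!: continuous_intros simp: K_def\<close>)
    have 2: "continuous_on K (\<lambda>w. v (fst (snd w), snd (snd (snd w))))"
      by (rule continuous_on_compose2[OF cu(2)]) (use \<delta> in \<open>auto intro!: continuous_intros simp: K_def\<close>)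
    have 3: "continuous_on K (\<lambda>w. (\<lambda>(z, t). \<phi> z t) (fst w - fst (snd w), fst (snd (snd w))))"
      by (rule continuous_on_compose2[OF cphi]) (use \<delta> in \<open>auto intro!: continuous_intros simp: K_def\<close>)
    have "continuous_on K (\<lambda>w. \<Theta> (fst w) (fst (snd w)) (fst (snd (snd w))) (snd (snd (snd w))))"
      unfolding \<Theta>_def e_def
      by (intro continuous_intros 1 2 3[simplified]) (use \<delta> \<alpha> in \<open>auto simp: K_def\<close>)
    then show ?thesis by (simp add: case_prod_beta)
  qed
  moreover have ref: "\<Theta> x1 y1 t1 t1 \<ge> A + 2 * \<sigma>"
  proof -
    have "T - t1 \<noteq> 0" using t1 by simp
    then have "\<eta> / (T - t1) = \<sigma> / 2" unfolding \<eta>_def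
      by (metis nonzero_mult_div_cancel_right times_divide_eq_left)
    moreover have "u (x1, t1) - v (y1, t1) - \<phi> (x1 - y1) t1 = A + 4 * \<sigma>"
      by (simp add: \<sigma>_def field_simps)
    moreover have "(t1 - t1)\<^sup>2 / (2 * \<alpha>) = 0" by simp
    ultimately show ?thesis using \<gamma>1 unfolding \<Theta>_def by linarith
  qed
  moreover have refK: "(x1, y1, t1, t1) \<in> K"
    using bounds2[of x1 y1 t1 t1] ref \<sigma> t1 by (auto simp: K_def)
  ultimately obtain w where "w \<in> K" "\<And>w'. w' \<in> K \<Longrightarrow> (\<lambda>(x, y, t, s). \<Theta> x y t s) w' \<le> (\<lambda>(x, y, t, s). \<Theta> x y t s) w"
    using continuous_attains_sup[OF compact_K, of "\<lambda>(x, y, t, s). \<Theta> x y t s"] by blast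
  then obtain x y t s where max: "(x, y, t, s) \<in> K" "\<And>x' y' t' s'. (x', y', t', s') \<in> K \<Longrightarrow> \<Theta> x' y' t' s' \<le> \<Theta> x y t s"
    by (cases w) force
  have big: "\<Theta> x y t s \<ge> A + 2 * \<sigma>" using max(2)[OF refK] ref by linarith
  then have big': "\<Theta> x y t s \<ge> A" using \<sigma> by linarith
  have ts: "0 \<le> t" "t < T" "0 \<le> s" "s < T" using max(1) \<delta> by (auto simp: K_def)
  note b = bounds[OF big' ts] bounds2[OF big' ts]
  \<comment> \<open>If one time were 0, both would be below \<open>d\<close>. Moving to time 0 then
    changes each of \<open>u\<close>, \<open>v\<close> and \<open>\<phi>\<close> by less than
    \<open>\<sigma> / 2\<close>, too little to use up the margin \<open>2 * \<sigma>\<close> over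
    the initial bound.\<close>
  have pos: "t > 0 \<and> s > 0"
  proof (rule ccontr)
    assume "\<not> ?thesis"
    then have td: "t < d" "s < d" using ts b(2) by auto
    have "dist (u (x, t)) (u (x, 0)) < \<sigma> / 2" using td d ts T by (intro d4(2)) (auto simp: dist_Pair_Pair)
    moreover have "dist (v (y, s)) (v (y, 0)) < \<sigma> / 2" using td d ts T by (intro d5(2)) (auto simp: dist_Pair_Pair)
    moreover have "dist (\<phi> (x - y) t) (\<phi> (x - y) 0) < \<sigma> / 2"
      using d3(2)[of "(x - y, 0)" "(x - y, t)"] td d ts T b(1) by (auto simp: dist_Pair_Pair KZ_def)
    ultimately have "u (x, t) - v (y, s) - \<phi> (x - y) t \<le> A + 3 * \<sigma> / 2"
      using init[of x y] by (simp add: dist_real_def abs_if split: if_splits)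
    moreover have "(t - s)\<^sup>2 / (2 * \<alpha>) \<ge> 0" "\<eta> / (T - t) \<ge> 0" "\<eta> / (T - s) \<ge> 0" "\<gamma> * e x \<ge> 0"
      using \<alpha> \<eta> ts \<gamma>(1) epos[of x] by auto
    ultimately show False using big \<sigma> unfolding \<Theta>_def by linarith
  qed

  let ?Q = "open_slab T :: ((real^'d) \<times> real) set"
  have bar: "C1_test_function ?Q (\<lambda>z. (snd z - a)\<^sup>2 / (2 * \<alpha>) + \<eta> / (T - snd z))
      (\<lambda>z. (0, (snd z - a) / \<alpha> + \<eta> / (T - snd z)\<^sup>2))" for a
  proof (rule C1_test_function_time)
    fix r assume r: "r \<in> {0<..<T}"
    show "((\<lambda>r. (r - a)\<^sup>2 / (2 * \<alpha>) + \<eta> / (T - r)) has_real_derivative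
        (r - a) / \<alpha> + \<eta> / (T - r)\<^sup>2) (at r)"
      using r \<alpha> by (auto intro!: derivative_eq_intros simp: power2_eq_square) (simp add: field_simps)
  next
    show "continuous_on {0<..<T} (\<lambda>r. (r - a) / \<alpha> + \<eta> / (T - r)\<^sup>2)"
      using \<alpha> by (auto intro!: continuous_intros)
  qed
  have tf1: "C1_test_function ?Q (\<lambda>z. \<phi> (fst z - y) (snd z))
     (\<lambda>z. (p (fst z - y) (snd z), F (p (fst z - y) (snd z)) (snd z) - G (p (fst z - y) (snd z)) (snd z)))"
    unfolding C1_test_function_def
  proof (intro conjI ballI)
    fix z assume z: "z \<in> ?Q"
    have "GDERIV (\<lambda>(z, t). \<phi> z t) (z + (- y, 0)) :> (p (fst z - y) (snd z), F (p (fst z - y) (snd z)) (snd z) - G (p (fst z - y) (snd z)) (snd z))"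
      using gphi[of "snd z" "fst z - y"] z by (cases z) auto
    from GDERIV_compose_translate[OF this]
    show "GDERIV (\<lambda>z. \<phi> (fst z - y) (snd z)) z :> (p (fst z - y) (snd z), F (p (fst z - y) (snd z)) (snd z) - G (p (fst z - y) (snd z)) (snd z))"
      by (simp add: case_prod_beta)
  next
    have "continuous_on ?Q (\<lambda>z. (\<lambda>(z, t). p z t) (fst z - y, snd z))"
      by (rule continuous_on_compose2[OF cp]) (auto intro!: continuous_intros)
    then have pc: "continuous_on ?Q (\<lambda>z. p (fst z - y) (snd z))" by simp
    have "continuous_on ?Q (\<lambda>z. (\<lambda>(p, t). F p t) (p (fst z - y) (snd z), snd z))"
      by (rule continuous_on_compose2[OF F]) (auto intro!: continuous_intros pc)
    then have Fc: "continuous_on ?Q (\<lambda>z. F (p (fst z - y) (snd z)) (snd z))" by simp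
    have "continuous_on ?Q (\<lambda>z. (\<lambda>(p, t). G p t) (p (fst z - y) (snd z), snd z))"
      by (rule continuous_on_compose2[OF G]) (auto intro!: continuous_intros pc)
    then have Gc: "continuous_on ?Q (\<lambda>z. G (p (fst z - y) (snd z)) (snd z))" by simp
    show "continuous_on ?Q (\<lambda>z. (p (fst z - y) (snd z), F (p (fst z - y) (snd z)) (snd z) - G (p (fst z - y) (snd z)) (snd z)))"
      by (intro continuous_intros pc Fc Gc)
  qed
  have tf2: "C1_test_function ?Q (\<lambda>z. \<gamma> * e (fst z)) (\<lambda>z. (\<gamma> *\<^sub>R e' (fst z), 0))"
  proof (rule C1_test_function_space)
    show "GDERIV (\<lambda>x. \<gamma> * e x) x :> \<gamma> *\<^sub>R e' x" for x
      using GDERIV_mult[OF GDERIV_const GDERIV_sqrt_one_plus_norm_square, of \<gamma> x] by (simp add: e_def e'_def)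
    show "continuous_on UNIV (\<lambda>x. \<gamma> *\<^sub>R e' x)"
      unfolding e'_def by (intro continuous_intros) (metis add_pos_nonneg less_irrefl real_sqrt_gt_0_iff zero_le_power2 zero_less_one)
  qed
  \<comment> \<open>The time dependence of \<open>\<phi>\<close> is assigned entirely to the first
    copy of the variables; here its time is frozen at \<open>t\<close>. Hence \<open>F - G\<close>
    appears only in \<open>i1\<close>, and the mismatch is \<open>G\<close> at time \<open>t\<close>
    against \<open>G\<close> at time \<open>s\<close>.\<close>
  have tf3: "C1_test_function ?Q (\<lambda>z. - \<phi> (x - fst z) t) (\<lambda>z. (p (x - fst z) t, 0))"
  proof (rule C1_test_function_space)
    fix y'
    have g: "((\<lambda>(z, t). \<phi> z t) has_derivative (\<lambda>h. h \<bullet> (p (x - y') t, F (p (x - y') t) t - G (p (x - y') t) t))) (at (x - y', t))"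
      using gphi[of t "x - y'"] pos ts by (simp add: gderiv_def)
    have "((\<lambda>y. (x - y, t)) has_derivative (\<lambda>h. (- h, 0))) (at y')"
      by (auto intro!: derivative_eq_intros)
    from has_derivative_minus[OF has_derivative_compose[OF this g]]
    show "GDERIV (\<lambda>y. - \<phi> (x - y) t) y' :> p (x - y') t"
      by (simp add: gderiv_def)
  next
    have "continuous_on UNIV (\<lambda>y'. (\<lambda>(z, t). p z t) (x - y', t))"
      by (rule continuous_on_compose2[OF cp]) (use ts in \<open>auto intro!: continuous_intros\<close>)
    then show "continuous_on UNIV (\<lambda>y'. p (x - y') t)" by simp
  qed

  have "\<forall>\<^sub>F z in nhds (x, t). z \<in> ball 0 R \<times> {0<..<T - \<delta>}"
    using b pos by (intro eventually_nhds_in_open open_Times) auto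
  then have ev1: "\<forall>\<^sub>F z in nhds (x, t). u z - (\<phi> (fst z - y) (snd z) + ((snd z - s)\<^sup>2 / (2 * \<alpha>) + \<eta> / (T - snd z)) + \<gamma> * e (fst z))
     \<le> u (x, t) - (\<phi> (fst (x, t) - y) (snd (x, t)) + ((snd (x, t) - s)\<^sup>2 / (2 * \<alpha>) + \<eta> / (T - snd (x, t))) + \<gamma> * e (fst (x, t)))"
  proof eventually_elim
    case (elim z)
    obtain x' t' where z: "z = (x', t')" by (cases z)
    have "\<Theta> x' y t' s \<le> \<Theta> x y t s" using max(1) elim by (intro max(2)) (auto simp: K_def z)
    then show ?case by (simp add: \<Theta>_def z)
  qed
  from subsolD[OF u C1_test_function_add[OF C1_test_function_add[OF tf1 bar[of s]] tf2] _ _ ev1]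
  have i1: "F (p (x - y) t) t - G (p (x - y) t) t + ((t - s) / \<alpha> + \<eta> / (T - t)\<^sup>2) \<le> F (p (x - y) t + \<gamma> *\<^sub>R e' x) t"
    using pos ts by simp

  have "\<forall>\<^sub>F z in nhds (y, s). z \<in> ball 0 (R + Z) \<times> {0<..<T - \<delta>}"
    using b pos by (intro eventually_nhds_in_open open_Times) auto
  then have ev2: "\<forall>\<^sub>F z in nhds (y, s). v z - (- \<phi> (x - fst z) t + - ((snd z - t)\<^sup>2 / (2 * \<alpha>) + \<eta> / (T - snd z)))
     \<ge> v (y, s) - (- \<phi> (x - fst (y, s)) t + - ((snd (y, s) - t)\<^sup>2 / (2 * \<alpha>) + \<eta> / (T - snd (y, s))))"
  proof eventually_elim
    case (elim z)
    obtain y' s' where z: "z = (y', s')" by (cases z)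
    have "\<Theta> x y' t s' \<le> \<Theta> x y t s" using max(1) elim by (intro max(2)) (auto simp: K_def z)
    then show ?case by (simp add: \<Theta>_def z power2_commute)
  qed
  from supersolD[OF v C1_test_function_add[OF tf3 C1_test_function_minus[OF bar[of t]]] _ _ ev2]
  have i2: "G (p (x - y) t) s \<le> - ((s - t) / \<alpha> + \<eta> / (T - s)\<^sup>2)"
    using pos ts by simp

  have kap: "\<kappa> \<le> \<eta> / (T - r)\<^sup>2" if "0 \<le> r" "r < T" for r
    unfolding \<kappa>_def using that \<eta> by (intro divide_left_mono power_mono) auto
  have zK: "norm (p (x - y) t) \<le> P" using b(1) ts by (intro P) (auto simp: KZ_def)
  have nge: "norm (\<gamma> *\<^sub>R e' x) \<le> \<gamma>"
    using mult_left_mono[OF e'1[of x], of \<gamma>] \<gamma>(1) by simp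
  have "dist (F (p (x - y) t + \<gamma> *\<^sub>R e' x) t) (F (p (x - y) t) t) < \<kappa>"
  proof -
    have "norm (p (x - y) t + \<gamma> *\<^sub>R e' x) \<le> P + 1"
      using norm_triangle_ineq[of "p (x - y) t" "\<gamma> *\<^sub>R e' x"] zK nge \<gamma>(3) by linarith
    then have "(p (x - y) t + \<gamma> *\<^sub>R e' x, t) \<in> KP" "(p (x - y) t, t) \<in> KP"
      using zK ts by (auto simp: KP_mem)
    moreover have "dist (p (x - y) t + \<gamma> *\<^sub>R e' x, t) (p (x - y) t, t) < d1"
      using nge \<gamma>(4) d1(1) by (simp add: dist_Pair_Pair dist_norm)
    ultimately show ?thesis using d1(2) by fastforce
  qed
  moreover have "dist (G (p (x - y) t) t) (G (p (x - y) t) s) < \<kappa>"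
  proof -
    have "(p (x - y) t, t) \<in> KP" "(p (x - y) t, s) \<in> KP"
      using zK ts by (auto simp: KP_mem)
    moreover have "dist (p (x - y) t, t) (p (x - y) t, s) < d2"
      using b(2) d by (simp add: dist_Pair_Pair dist_real_def)
    ultimately show ?thesis using d2(2) by fastforce
  qed
  ultimately have "F (p (x - y) t + \<gamma> *\<^sub>R e' x) t - F (p (x - y) t) t < \<kappa>" "G (p (x - y) t) t - G (p (x - y) t) s < \<kappa>"
    by (auto simp: dist_real_def)
  moreover have "(t - s) / \<alpha> = - ((s - t) / \<alpha>)" using \<alpha> by (simp add: field_simps)
  \<comment> \<open>Adding \<open>i1\<close> and \<open>i2\<close> cancels the derivatives of the
    time penalty as well as \<open>F\<close> and \<open>G\<close> up to the two small errors. What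
    is left says that \<open>2 * \<kappa>\<close> is smaller than itself.\<close>
  ultimately show False using i1 i2 kap[OF ts(1,2)] kap[OF ts(3,4)] by linarith
qed

text \<open>The viscosity inequalities hold only before the terminal time, which is reached by
  continuity. The rule serves two purposes: with \<open>F = G\<close> and a quadratic
  \<open>\<phi>\<close> it gives comparison, and with the perturbed Legendre transform it compares
  solutions for different paths.\<close>

lemma doubling:
  fixes u v :: "(real^'d) \<times> real \<Rightarrow> real"
  assumes T: "T > 0"
    and u: "subsol T F u" "u \<in> BUC (slab T)"
    and v: "supersol T G v" "v \<in> BUC (slab T)"
    and F: "continuous_on (slab T) (\<lambda>(p, t). F p t)"
    and G: "continuous_on (slab T) (\<lambda>(p, t). G p t)"
    and gphi: "\<And>z t. 0 < t \<Longrightarrow> t < T \<Longrightarrow> GDERIV (\<lambda>(z, t). \<phi> z t) (z, t) :> (p z t, F (p z t) t - G (p z t) t)"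
    and cphi: "continuous_on (slab T) (\<lambda>(z, t). \<phi> z t)"
    and cp: "continuous_on (slab T) (\<lambda>(z, t). p z t)"
    and low: "\<And>z t. t \<in> {0..T} \<Longrightarrow> norm z - m \<le> \<phi> z t"
    and init: "\<And>x y. u (x, 0) - v (y, 0) - \<phi> (x - y) 0 \<le> A"
    and t: "t \<in> {0..T}"
  shows "u (x, t) - v (y, t) - \<phi> (x - y) t \<le> A"
proof -
  have uu: "uniformly_continuous_on (slab T) u" "uniformly_continuous_on (slab T) v"
    using u(2) v(2) by (auto simp: BUC_def)
  have "bounded (u ` (slab T) \<union> v ` (slab T))"
    using u(2) v(2) by (auto simp: BUC_def)
  then obtain M where M: "\<And>z. z \<in> slab T \<Longrightarrow> \<bar>u z\<bar> \<le> M" "\<And>z. z \<in> slab T \<Longrightarrow> \<bar>v z\<bar> \<le> M"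
    unfolding bounded_iff by (metis UnCI image_eqI real_norm_def)
  let ?g = "\<lambda>t. u (x, t) - v (y, t) - \<phi> (x - y) t"
  have le: "?g t \<le> A" if "t \<in> {0..<T}" for t
    by (rule doubling_before_terminal_time[OF T u(1) v(1) M uu F G gphi cphi cp low init]) (use that in auto)
  have cu: "continuous_on (slab T) u" "continuous_on (slab T) v"
    using uu by (auto intro: uniformly_continuous_imp_continuous)
  have "continuous_on {0..T} ?g"
  proof -
    have "continuous_on {0..T} (\<lambda>t. (\<lambda>(z, t). \<phi> z t) (x - y, t))"
      by (rule continuous_on_compose2[OF cphi]) (auto intro!: continuous_intros)
    moreover have "continuous_on {0..T} (\<lambda>t. u (x, t))"
      by (rule continuous_on_compose2[OF cu(1)]) (auto intro!: continuous_intros)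
    moreover have "continuous_on {0..T} (\<lambda>t. v (y, t))"
      by (rule continuous_on_compose2[OF cu(2)]) (auto intro!: continuous_intros)
    ultimately show ?thesis by (intro continuous_on_diff) simp_all
  qed
  then have "continuous_on (closure {0..<T}) ?g" using T by simp
  moreover have "t \<in> closure {0..<T}" using t T by simp
  ultimately show ?thesis
    using continuous_le_on_closure[of "{0..<T}" ?g t A] le by blast
qed

text \<open>With equal right-hand sides every time-independent function of \<open>x - y\<close>
  solves the doubled equation exactly, since \<open>F\<close> does not depend on space. A quadratic
  therefore works without any Lipschitz condition on \<open>F\<close>.\<close>

lemma comparison:
  fixes u v :: "(real^'d) \<times> real \<Rightarrow> real"
  assumes T: "T > 0"
    and u: "subsol T F u" "u \<in> BUC (slab T)"
    and v: "supersol T F v" "v \<in> BUC (slab T)"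
    and F: "continuous_on (slab T) (\<lambda>(p, t). F p t)"
    and init: "\<And>x. u (x, 0) - v (x, 0) \<le> c"
    and t: "t \<in> {0..T}"
  shows "u (x, t) - v (x, t) \<le> c"
proof (rule field_le_epsilon)
  fix e :: real assume e: "e > 0"
  have uu: "uniformly_continuous_on (slab T) u" using u(2) by (auto simp: BUC_def)
  obtain r where r: "r > 0" "\<And>a b. a \<in> slab T \<Longrightarrow> b \<in> slab T \<Longrightarrow> dist b a < r \<Longrightarrow> dist (u b) (u a) < e"
    using uu e unfolding uniformly_continuous_on_def by metis
  have "bounded (u ` (slab T))" using u(2) by (auto simp: BUC_def)
  then obtain M where M: "\<And>z. z \<in> slab T \<Longrightarrow> \<bar>u z\<bar> \<le> M"
    unfolding bounded_iff by (metis image_eqI real_norm_def)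
  have M0: "M \<ge> 0" using M[of "(0, 0)"] T by auto
  \<comment> \<open>For \<open>norm (x - y) \<ge> r\<close> the quadratic then exceeds
    \<open>2 * M\<close>, the largest possible oscillation of \<open>u\<close>; closer points are
    handled by uniform continuity.\<close>
  define l where "l = r\<^sup>2 / (4 * (M + 1))"
  have lam: "l > 0" using r M0 by (simp add: l_def)
  have g: "GDERIV (\<lambda>x :: real^'d. (norm x)\<^sup>2 / (2 * l)) z :> z /\<^sub>R l" for z
  proof -
    have "GDERIV (\<lambda>x. (norm (x - 0))\<^sup>2) z :> 2 *\<^sub>R (z - 0)"
      unfolding gderiv_def power2_norm_eq_inner
      by (auto intro!: derivative_eq_intros simp: inner_commute algebra_simps)
    from GDERIV_mult[OF GDERIV_const[of "1 / (2 * l)"] this]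
    have "GDERIV (\<lambda>x. 1 / (2 * l) * (norm x)\<^sup>2) z :> (1 / (2 * l)) *\<^sub>R 2 *\<^sub>R z" by simp
    then show ?thesis using lam by (simp add: inverse_eq_divide)
  qed
  have "u (x, t) - v (x, t) - (norm (x - x))\<^sup>2 / (2 * l) \<le> c + e"
  proof (rule doubling[OF T u v F F, where p = "\<lambda>z t. z /\<^sub>R l"])
    fix z :: "real^'d" and t :: real
    show "GDERIV (\<lambda>(z, t). (norm z)\<^sup>2 / (2 * l)) (z, t) :> (z /\<^sub>R l, F (z /\<^sub>R l) t - F (z /\<^sub>R l) t)"
    proof -
      have "continuous_on UNIV (\<lambda>z :: real^'d. z /\<^sub>R l)" by (intro continuous_intros)
      from C1_test_function_space[OF g this, of UNIV] show ?thesis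
        unfolding C1_test_function_def case_prod_beta by simp
    qed
  next
    fix z :: "real^'d" and t :: real
    have "0 \<le> (norm z - l)\<^sup>2" by simp
    also have "\<dots> = (norm z)\<^sup>2 - (norm z - l / 2) * (2 * l)"
      by (simp add: power2_eq_square left_diff_distrib right_diff_distrib)
    finally have "(norm z - l / 2) * (2 * l) \<le> (norm z)\<^sup>2" by simp
    then show "norm z - l / 2 \<le> (norm z)\<^sup>2 / (2 * l)"
      using lam by (subst pos_le_divide_eq) auto
  next
    fix x y :: "real^'d"
    show "u (x, 0) - v (y, 0) - (norm (x - y))\<^sup>2 / (2 * l) \<le> c + e"
    proof (cases "norm (x - y) < r")
      case True
      then have "dist (u (x, 0)) (u (y, 0)) < e" using T by (intro r) (auto simp: dist_Pair_Pair dist_norm)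
      moreover have "(norm (x - y))\<^sup>2 / (2 * l) \<ge> 0" using lam by simp
      ultimately show ?thesis using init[of y] by (simp add: dist_real_def)
    next
      case False
      have "r\<^sup>2 / (2 * l) = 2 * (M + 1)" using r(1) M0 unfolding l_def by simp
      then have "2 * M \<le> r\<^sup>2 / (2 * l)" by simp
      also have "\<dots> \<le> (norm (x - y))\<^sup>2 / (2 * l)"
        using False lam r by (intro divide_right_mono power_mono) auto
      finally show ?thesis using init[of y] M[of "(x, 0)"] M[of "(y, 0)"] T e by auto
    qed
  next
    show "continuous_on (slab T) (\<lambda>(z :: real^'d, t). (norm z)\<^sup>2 / (2 * l))"
      unfolding case_prod_beta using lam by (intro continuous_intros) auto
    show "continuous_on (slab T) (\<lambda>(z :: real^'d, t). z /\<^sub>R l)"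
      unfolding case_prod_beta by (intro continuous_intros)
  qed (rule t)
  then show "u (x, t) - v (x, t) \<le> c + e" by simp
qed

section \<open>Perron's method\<close>

definition space_time_lipschitz :: "real \<Rightarrow> real \<Rightarrow> real \<Rightarrow> ('a::real_normed_vector \<times> real \<Rightarrow> real) \<Rightarrow> bool" where
  "space_time_lipschitz T K C w \<longleftrightarrow>
     (\<forall>x y. \<forall>t\<in>{0..T}. \<forall>s\<in>{0..T}. w (x, t) \<le> w (y, s) + K * norm (x - y) + C * \<bar>t - s\<bar>)"

lemma space_time_lipschitzD:
  assumes "space_time_lipschitz T K C w" "t \<in> {0..T}" "s \<in> {0..T}"
  shows "w (x, t) \<le> w (y, s) + K * norm (x - y) + C * \<bar>t - s\<bar>"
  using assms unfolding space_time_lipschitz_def by blast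

lemma space_time_lipschitz_max:
  assumes "space_time_lipschitz T K C v" "space_time_lipschitz T K C w"
  shows "space_time_lipschitz T K C (\<lambda>z. max (v z) (w z))"
  unfolding space_time_lipschitz_def
proof (intro allI ballI)
  fix x y t s assume "t \<in> {0..T}" "s \<in> {0..T}"
  from space_time_lipschitzD[OF assms(1) this, of x y] space_time_lipschitzD[OF assms(2) this, of x y]
  show "max (v (x, t)) (w (x, t)) \<le> max (v (y, s)) (w (y, s)) + K * norm (x - y) + C * \<bar>t - s\<bar>"
    by (simp add: max_def)
qed

lemma space_time_lipschitz_uniformly_continuous:
  fixes w :: "'a::real_normed_vector \<times> real \<Rightarrow> real"
  assumes w: "space_time_lipschitz T K C w" and "K \<ge> 0" "C \<ge> 0"
  shows "uniformly_continuous_on (slab T) w"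
  unfolding uniformly_continuous_on_def
proof (intro allI impI)
  fix e :: real assume e: "e > 0"
  define d where "d = e / (K + C + 1)"
  have d: "d > 0" "(K + C) * d < e" using e assms(2,3) by (auto simp: d_def field_simps)
  show "\<exists>d>0. \<forall>a\<in>slab T. \<forall>b\<in>slab T. dist b a < d \<longrightarrow> dist (w b) (w a) < e"
  proof (intro exI[of _ d] conjI ballI impI)
    fix a b :: "'a \<times> real" assume ab: "a \<in> slab T" "b \<in> slab T" "dist b a < d"
    obtain x t where [simp]: "a = (x, t)" by (cases a)
    obtain y s where [simp]: "b = (y, s)" by (cases b)
    have "norm (y - x) \<le> d" "\<bar>s - t\<bar> \<le> d"
      using ab(3) dist_fst_le[of b a] dist_snd_le[of b a] by (auto simp: dist_norm)
    then have "K * norm (y - x) + C * \<bar>s - t\<bar> \<le> K * d + C * d"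
      using assms(2,3) by (intro add_mono mult_left_mono)
    also have "\<dots> < e" using d(2) by (simp add: algebra_simps)
    finally have lt: "K * norm (y - x) + C * \<bar>s - t\<bar> < e" .
    have "w (x, t) \<le> w (y, s) + K * norm (y - x) + C * \<bar>s - t\<bar>"
      "w (y, s) \<le> w (x, t) + K * norm (y - x) + C * \<bar>s - t\<bar>"
      using space_time_lipschitzD[OF w, of t s x y] space_time_lipschitzD[OF w, of s t y x] ab
      by (auto simp: norm_minus_commute abs_minus_commute)
    with lt show "dist (w b) (w a) < e" by (simp add: dist_real_def abs_if)
  qed (use d in auto)
qed

lemma gradient_bound_imp_lipschitz:
  fixes \<psi> :: "'a::real_inner \<times> real \<Rightarrow> real"
  assumes "convex U" and z: "z \<in> U" "z' \<in> U"
    and g: "\<And>z. z \<in> U \<Longrightarrow> GDERIV \<psi> z :> E z"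
    and b: "\<And>z. z \<in> U \<Longrightarrow> norm (fst (E z)) \<le> K" "\<And>z. z \<in> U \<Longrightarrow> \<bar>snd (E z)\<bar> \<le> C"
  shows "\<psi> z \<le> \<psi> z' + K * norm (fst z - fst z') + C * \<bar>snd z - snd z'\<bar>"
proof -
  define \<xi> where "\<xi> = (\<lambda>r. z' + r *\<^sub>R (z - z'))"
  have \<xi>: "\<xi> r \<in> U" if "0 \<le> r" "r \<le> 1" for r
  proof -
    have "\<xi> r = (1 - r) *\<^sub>R z' + r *\<^sub>R z" by (simp add: \<xi>_def algebra_simps)
    then show ?thesis using convexD[OF assms(1) z(2,1), of "1 - r" r] that by simp
  qed
  have "((\<lambda>r. \<psi> (\<xi> r)) has_real_derivative (E (\<xi> r) \<bullet> (z - z'))) (at r)" if "0 \<le> r" "r \<le> 1" for r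
  proof -
    have "(\<xi> has_derivative (\<lambda>h. h *\<^sub>R (z - z'))) (at r)"
      unfolding \<xi>_def by (auto intro!: derivative_eq_intros)
    moreover have "(\<psi> has_derivative (\<lambda>h. h \<bullet> E (\<xi> r))) (at (\<xi> r))"
      using g[OF \<xi>[OF that]] by (simp add: gderiv_def)
    ultimately have "((\<lambda>r. \<psi> (\<xi> r)) has_derivative (\<lambda>h. (h *\<^sub>R (z - z')) \<bullet> E (\<xi> r))) (at r)"
      by (rule has_derivative_compose)
    then show ?thesis unfolding has_field_derivative_def
      by (rule has_derivative_eq_rhs) (simp add: fun_eq_iff inner_commute mult.commute)
  qed
  from MVT2[of 0 1 "\<lambda>r. \<psi> (\<xi> r)" "\<lambda>r. E (\<xi> r) \<bullet> (z - z')", OF _ this]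
  obtain r where r: "0 < r" "r < 1" "\<psi> (\<xi> 1) - \<psi> (\<xi> 0) = E (\<xi> r) \<bullet> (z - z')" by auto
  have "E (\<xi> r) \<bullet> (z - z') = fst (E (\<xi> r)) \<bullet> (fst z - fst z') + snd (E (\<xi> r)) * (snd z - snd z')"
    by (simp add: inner_prod_def)
  also have "\<dots> \<le> norm (fst (E (\<xi> r))) * norm (fst z - fst z') + \<bar>snd (E (\<xi> r))\<bar> * \<bar>snd z - snd z'\<bar>"
    by (intro add_mono norm_cauchy_schwarz) (metis abs_ge_self abs_mult)
  also have "\<dots> \<le> K * norm (fst z - fst z') + C * \<bar>snd z - snd z'\<bar>"
    using b[OF \<xi>[of r]] r by (intro add_mono mult_right_mono) auto
  finally show ?thesis using r(3) by (simp add: \<xi>_def)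
qed

text \<open>
  Perron's method within the class of subsolutions that are Lipschitz in space and time. The
  constants exceed those of the supremum, which leaves room for the bump construction.
\<close>

locale perron =
  fixes T K C :: real and F :: "real^'d \<Rightarrow> real \<Rightarrow> real" and u0 :: "real^'d \<Rightarrow> real"
  assumes T: "T > 0" and K: "K \<ge> 0"
    and u0: "\<And>x y. u0 x \<le> u0 y + K * norm (x - y)"
    and F: "continuous_on (slab T) (\<lambda>(p, t). F p t)"
    and FC: "\<And>p t. norm p \<le> K + 1 \<Longrightarrow> t \<in> {0..T} \<Longrightarrow> \<bar>F p t\<bar> \<le> C"
begin

definition subsols :: "((real^'d) \<times> real \<Rightarrow> real) set" where
  "subsols = {w. space_time_lipschitz T (K + 1) (C + 1) w \<and> subsol T F w \<and> (\<forall>x. w (x, 0) \<le> u0 x)}"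

definition W :: "(real^'d) \<times> real \<Rightarrow> real" where
  "W z = (SUP w\<in>subsols. w z)"

lemma C: "C \<ge> 0"
  using FC[of 0 0] T K by auto

lemma subsols_upper: "w \<in> subsols \<Longrightarrow> t \<in> {0..T} \<Longrightarrow> w (x, t) \<le> u0 x + (C + 1) * t"
  using space_time_lipschitzD[of T "K + 1" "C + 1" w t 0 x x] T
  by (auto simp: subsols_def) (smt (verit, best))

lemma subsol_touching_gradient:
  assumes w: "space_time_lipschitz T L C' w" "L \<ge> 0" and t: "0 < t" "t < T"
    and "C1_test_function (open_slab T) \<phi> D"
    and "\<forall>\<^sub>F z in nhds (x, t). w z - \<phi> z \<le> w (x, t) - \<phi> (x, t)"
  shows "norm (fst (D (x, t))) \<le> L"
proof (rule touching_gradient_bound)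
  show "GDERIV \<phi> (x, t) :> D (x, t)" using assms(5) t by (auto simp: C1_test_function_def)
  show "w (x, t) - L * norm h \<le> w (x + h, t)" for h
    using space_time_lipschitzD[OF w(1), of t t x "x + h"] t by simp
qed fact+

text \<open>Since \<open>F\<close> is at least \<open>- C\<close> at the gradients that can occur,
  decay at rate \<open>C\<close> in time already gives the subsolution inequality. The decay is
  required only backwards from \<open>t\<close>, so the function may have been glued together at an
  earlier time.\<close>

lemma decreasing_touching:
  assumes w: "\<And>h. 0 < h \<Longrightarrow> h < \<delta> \<Longrightarrow> w (x, t) + C * h \<le> w (x, t - h)" "\<delta> > 0"
    and D: "GDERIV \<phi> (x, t) :> D" "norm (fst D) \<le> K + 1"
    and e: "\<forall>\<^sub>F z in nhds (x, t). w z - \<phi> z \<le> w (x, t) - \<phi> (x, t)"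
    and t: "0 < t" "t < T"
  shows "snd D \<le> F (fst D) t"
proof -
  have "C \<le> D \<bullet> (0, - 1)"
  proof (rule touching_directional_ge[OF D(1) e])
    show "\<forall>\<^sub>F h in at_right 0. w (x, t) + C * h \<le> w ((x, t) + h *\<^sub>R (0, - 1))"
      using eventually_at_right_less[of 0] eventually_at_right_real[OF w(2)]
      by eventually_elim (use w in auto)
  qed
  then show ?thesis using FC[OF D(2), of t] t by (auto simp: inner_prod_def)
qed

lemma subsols_base: "(\<lambda>z. u0 (fst z) - C * snd z) \<in> subsols"
proof -
  have "space_time_lipschitz T K C (\<lambda>z. u0 (fst z) - C * snd z)"
    unfolding space_time_lipschitz_def
  proof (intro allI ballI)
    fix x y :: "real^'d" and s t :: real
    have "C * (s - t) \<le> C * \<bar>t - s\<bar>" using C by (intro mult_left_mono) auto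
    then show "u0 (fst (x, t)) - C * snd (x, t) \<le> u0 (fst (y, s)) - C * snd (y, s) + K * norm (x - y) + C * \<bar>t - s\<bar>"
      using u0[of x y] by (simp add: algebra_simps)
  qed
  note lip = this
  have "space_time_lipschitz T (K + 1) (C + 1) (\<lambda>z. u0 (fst z) - C * snd z)"
    unfolding space_time_lipschitz_def
  proof (intro allI ballI)
    fix x y :: "real^'d" and s t assume "t \<in> {0..T}" "s \<in> {0..T}"
    from space_time_lipschitzD[OF lip this, of x y]
    show "u0 (fst (x, t)) - C * snd (x, t) \<le> u0 (fst (y, s)) - C * snd (y, s) + (K + 1) * norm (x - y) + (C + 1) * \<bar>t - s\<bar>"
      using norm_ge_zero[of "x - y"] abs_ge_zero[of "t - s"]
      by (simp only: distrib_right mult_1)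
  qed
  moreover have "subsol T F (\<lambda>z. u0 (fst z) - C * snd z)"
    unfolding subsol_def
  proof (intro allI impI, elim conjE)
    fix \<phi> D x t
    assume a: "C1_test_function (open_slab T) \<phi> D" "0 < t" "t < T"
      and e: "\<forall>\<^sub>F z in nhds (x, t). u0 (fst z) - C * snd z - \<phi> z \<le> u0 (fst (x, t)) - C * snd (x, t) - \<phi> (x, t)"
    have "norm (fst (D (x, t))) \<le> K"
      by (rule subsol_touching_gradient[OF lip K a(2,3,1) e])
    then show "snd (D (x, t)) \<le> F (fst (D (x, t))) t"
      by (intro decreasing_touching[OF _ _ _ _ e, of 1]) (use a in \<open>auto simp: C1_test_function_def algebra_simps\<close>)
  qed
  ultimately show ?thesis by (simp add: subsols_def)
qed

lemma subsols_bdd: "t \<in> {0..T} \<Longrightarrow> bdd_above ((\<lambda>w. w (x, t)) ` subsols)"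
  by (rule bdd_aboveI2[OF subsols_upper])

lemma W_ge: "w \<in> subsols \<Longrightarrow> t \<in> {0..T} \<Longrightarrow> w (x, t) \<le> W (x, t)"
  unfolding W_def by (intro cSUP_upper subsols_bdd)

lemma W_le: "(\<And>w. w \<in> subsols \<Longrightarrow> w (x, t) \<le> c) \<Longrightarrow> W (x, t) \<le> c"
  unfolding W_def using subsols_base by (intro cSUP_least) auto

lemma W_upper: "t \<in> {0..T} \<Longrightarrow> W (x, t) \<le> u0 x + (C + 1) * t"
  by (intro W_le subsols_upper)

lemma W_lower: "t \<in> {0..T} \<Longrightarrow> u0 x - C * t \<le> W (x, t)"
  using W_ge[OF subsols_base, of t x] by simp

lemma W_init: "W (x, 0) = u0 x"
  using W_upper[of 0 x] W_lower[of 0 x] T by simp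

lemma W_lipschitz: "space_time_lipschitz T (K + 1) (C + 1) W"
  unfolding space_time_lipschitz_def
proof (intro allI ballI W_le)
  fix x y s t w assume ts: "t \<in> {0..T}" "s \<in> {0..T}" and w: "w \<in> subsols"
  then have "w (x, t) \<le> w (y, s) + (K + 1) * norm (x - y) + (C + 1) * \<bar>t - s\<bar>"
    by (intro space_time_lipschitzD) (auto simp: subsols_def)
  with W_ge[OF w ts(2), of y]
  show "w (x, t) \<le> W (y, s) + (K + 1) * norm (x - y) + (C + 1) * \<bar>t - s\<bar>" by linarith
qed

lemma lipschitz_continuous_on:
  assumes "space_time_lipschitz T (K + 1) (C + 1) w"
  shows "continuous_on (open_slab T) w"
  using space_time_lipschitz_uniformly_continuous[OF assms] K C
  by (intro continuous_on_subset[OF uniformly_continuous_imp_continuous, of "slab T"]) auto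

lemma continuous_on_F: "continuous_on (open_slab T) (\<lambda>(p, t). F p t)"
  by (rule continuous_on_subset[OF F]) auto

lemma W_subsol: "subsol T F W"
proof (rule subsol_approx[OF continuous_on_F])
  fix z :: "(real^'d) \<times> real" and \<delta> :: real assume z: "z \<in> open_slab T" and d: "\<delta> > 0"
  obtain x t where [simp]: "z = (x, t)" by (cases z)
  have t: "t \<in> {0..T}" using z by auto
  have "W (x, t) - \<delta> < (SUP w\<in>subsols. w (x, t))" using d by (simp add: W_def)
  then obtain w where w: "w \<in> subsols" "W (x, t) - \<delta> < w (x, t)"
    using less_cSUP_iff[OF _ subsols_bdd[OF t]] subsols_base by blast
  show "\<exists>w. subsol T F w \<and> continuous_on (open_slab T) w \<and>
          (\<forall>z'\<in>open_slab T. w z' \<le> W z' + \<delta>) \<and> w z \<ge> W z - \<delta>"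
  proof (intro exI[of _ w] conjI ballI)
    fix z' :: "(real^'d) \<times> real" assume "z' \<in> open_slab T"
    then show "w z' \<le> W z' + \<delta>" using W_ge[OF w(1), of "snd z'" "fst z'"] d by auto
  qed (use w lipschitz_continuous_on in \<open>auto simp: subsols_def\<close>)
qed

text \<open>Translates of members, lowered by \<open>K * norm h\<close>, are again members. This
  recovers the constant \<open>K\<close> of the initial datum instead of the \<open>K + 1\<close>
  allowed in the class.\<close>

lemma W_space: "t \<in> {0..T} \<Longrightarrow> W (x, t) \<le> W (x + h, t) + K * norm h"
proof (rule W_le)
  fix w assume w: "w \<in> subsols" and t: "t \<in> {0..T}"
  let ?w = "\<lambda>z. w (z + (- h, 0)) - K * norm h"
  have "?w \<in> subsols"
    unfolding subsols_def
  proof (intro CollectI conjI allI)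
    show "space_time_lipschitz T (K + 1) (C + 1) ?w"
      unfolding space_time_lipschitz_def
    proof (intro allI ballI)
      fix x y t s assume "t \<in> {0..T}" "s \<in> {0..T}"
      then show "w ((x, t) + (- h, 0)) - K * norm h \<le> w ((y, s) + (- h, 0)) - K * norm h + (K + 1) * norm (x - y) + (C + 1) * \<bar>t - s\<bar>"
        using space_time_lipschitzD[of T "K + 1" "C + 1" w t s "x - h" "y - h"] w
        by (simp add: subsols_def)
    qed
    show "subsol T F ?w" using w by (intro subsol_translate) (auto simp: subsols_def)
    fix x
    have "w (x - h, 0) \<le> u0 (x - h)" using w by (auto simp: subsols_def)
    then show "w ((x, 0) + (- h, 0)) - K * norm h \<le> u0 x" using u0[of "x - h" x] by simp
  qed
  from W_ge[OF this t, of "x + h"] show "w (x, t) \<le> W (x + h, t) + K * norm h" by simp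
qed

text \<open>A member can be frozen at time \<open>s\<close> and then lowered at rate
  \<open>C\<close>; the maximum with the original is again a member. So \<open>W\<close> decreases
  in time at rate at most \<open>C\<close>, which bounds the time derivative of functions touching
  it from below.\<close>

lemma W_time:
  assumes s: "0 \<le> s" "s \<le> t" "t \<le> T"
  shows "W (x, s) \<le> W (x, t) + C * (t - s)"
proof (rule W_le)
  fix w assume w: "w \<in> subsols"
  then have wl: "space_time_lipschitz T (K + 1) (C + 1) w" and ws: "subsol T F w"
    by (auto simp: subsols_def)
  define g where "g = (\<lambda>z. w (fst z, min s (snd z)) - C * max 0 (snd z - s))"
  define v where "v = (\<lambda>z. max (w z) (g z))"
  have "space_time_lipschitz T (K + 1) (C + 1) g"
    unfolding space_time_lipschitz_def
  proof (intro allI ballI)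
    fix x y a b assume ab: "a \<in> {0..T}" "b \<in> {0..T}"
    have "w (x, min s a) \<le> w (y, min s b) + (K + 1) * norm (x - y) + (C + 1) * \<bar>min s a - min s b\<bar>"
      using ab s by (intro space_time_lipschitzD[OF wl]) auto
    moreover have "- C * max 0 (a - s) \<le> - C * max 0 (b - s) + C * \<bar>max 0 (a - s) - max 0 (b - s)\<bar>"
      using mult_left_mono[OF abs_ge_self[of "max 0 (b - s) - max 0 (a - s)"] C]
      by (simp add: algebra_simps abs_minus_commute)
    moreover have "C * \<bar>max 0 (a - s) - max 0 (b - s)\<bar> \<le> (C + 1) * \<bar>max 0 (a - s) - max 0 (b - s)\<bar>"
      by (intro mult_right_mono) auto
    moreover have "(C + 1) * \<bar>min s a - min s b\<bar> + (C + 1) * \<bar>max 0 (a - s) - max 0 (b - s)\<bar> = (C + 1) * \<bar>a - b\<bar>"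
    proof -
      have "\<bar>min s a - min s b\<bar> + \<bar>max 0 (a - s) - max 0 (b - s)\<bar> = \<bar>a - b\<bar>"
        by (auto simp: min_def max_def)
      then show ?thesis by (metis distrib_left)
    qed
    ultimately show "g (x, a) \<le> g (y, b) + (K + 1) * norm (x - y) + (C + 1) * \<bar>a - b\<bar>"
      unfolding g_def by simp
  qed
  then have vl: "space_time_lipschitz T (K + 1) (C + 1) v"
    unfolding v_def by (intro space_time_lipschitz_max wl)
  have "subsol T F v"
    unfolding subsol_def
  proof (intro allI impI, elim conjE)
    fix \<phi> D x r
    assume a: "C1_test_function (open_slab T) \<phi> D" "0 < r" "r < T"
      and e: "\<forall>\<^sub>F z in nhds (x, r). v z - \<phi> z \<le> v (x, r) - \<phi> (x, r)"
    show "snd (D (x, r)) \<le> F (fst (D (x, r))) r"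
    proof (cases "v (x, r) = w (x, r)")
      case True
      have "\<forall>\<^sub>F z in nhds (x, r). w z - \<phi> z \<le> w (x, r) - \<phi> (x, r)"
        using e by eventually_elim (auto simp: True[symmetric], auto simp: v_def)
      then show ?thesis by (rule subsolD[OF ws a])
    next
      case False
      then have vg: "v (x, r) = g (x, r)" "g (x, r) > w (x, r)" by (auto simp: v_def)
      \<comment> \<open>Up to time \<open>s\<close> the two functions coincide, so strict dominance
        of \<open>g\<close> occurs only on the decreasing branch, where
        \<open>decreasing_touching\<close> applies with steps shorter than
        \<open>r - s\<close>.\<close>
      then have "r > s" by (cases "r > s") (auto simp: g_def min_def max_def split: if_splits)
      have "norm (fst (D (x, r))) \<le> K + 1"
        using K by (intro subsol_touching_gradient[OF vl _ a(2,3,1) e]) auto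
      moreover have "GDERIV \<phi> (x, r) :> D (x, r)" using a by (auto simp: C1_test_function_def)
      moreover have "v (x, r) + C * h \<le> v (x, r - h)" if "0 < h" "h < r - s" for h
      proof -
        have "g (x, r) + C * h \<le> g (x, r - h)" using that by (simp add: g_def algebra_simps)
        then show ?thesis using vg(1) by (simp add: v_def)
      qed
      moreover have "r - s > 0" using \<open>r > s\<close> by simp
      ultimately show ?thesis using decreasing_touching[OF _ _ _ _ e a(2,3)] by blast
    qed
  qed
  moreover have "v (x, 0) \<le> u0 x" for x
    using w s by (auto simp: v_def g_def subsols_def)
  ultimately have "v \<in> subsols" using vl by (auto simp: subsols_def)
  from W_ge[OF this, of t x] s show "w (x, s) \<le> W (x, t) + C * (t - s)"
    by (simp add: v_def g_def)
qed

text \<open>Bump construction: where the inequality fails, a lowered paraboloid correction of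
  \<open>\<phi>\<close>, raised by a constant, is a subsolution near the point. Its maximum with
  \<open>W\<close> is a member and exceeds \<open>W\<close> at the centre.\<close>

lemma W_supersol: "supersol T F W"
  unfolding supersol_def
proof (intro allI impI, elim conjE, rule ccontr)
  let ?Q = "open_slab T :: ((real^'d) \<times> real) set"
  fix \<phi> D x t
  assume a: "C1_test_function ?Q \<phi> D" "0 < t" "t < T"
    and e: "\<forall>\<^sub>F z in nhds (x, t). W z - \<phi> z \<ge> W (x, t) - \<phi> (x, t)"
    and neg: "\<not> F (fst (D (x, t))) t \<le> snd (D (x, t))"
  define z0 where "z0 = (x, t)"
  have z0: "z0 \<in> ?Q" using a by (simp add: z0_def)
  have e': "\<forall>\<^sub>F z in nhds (x, t). - W z - - \<phi> z \<le> - W (x, t) - - \<phi> (x, t)"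
    using e by eventually_elim simp
  have gD: "GDERIV (\<lambda>z. - \<phi> z) (x, t) :> - D (x, t)"
    using a by (intro GDERIV_minus) (auto simp: C1_test_function_def)
  have "norm (fst (- D (x, t))) \<le> K"
  proof (rule touching_gradient_bound[OF gD e' K])
    fix h show "- W (x, t) - K * norm h \<le> - W (x + h, t)"
      using W_space[of t "x + h" "- h"] a by simp
  qed
  then have DK: "norm (fst (D z0)) \<le> K" by (simp add: z0_def)
  have "- C \<le> - D (x, t) \<bullet> (0, - 1)"
  proof (rule touching_directional_ge[OF gD e'])
    show "\<forall>\<^sub>F h in at_right 0. - W (x, t) + - C * h \<le> - W ((x, t) + h *\<^sub>R (0, - 1))"
      using eventually_at_right_less[of 0] eventually_at_right_real[OF a(2)]
    proof eventually_elim
      case (elim h)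
      then show ?case using W_time[of "t - h" t x] a by simp
    qed
  qed
  then have DC: "- C \<le> snd (D z0)" by (simp add: z0_def inner_prod_def)
  define E where "E = (\<lambda>z. D z - 2 *\<^sub>R (z - z0))"
  have E0: "E z0 = D z0" by (simp add: E_def)
  have "continuous_on ?Q E"
    unfolding E_def using a by (intro continuous_intros) (auto simp: C1_test_function_def)
  then have E_lim: "(E \<longlongrightarrow> E z0) (nhds z0)"
    using z0 open_space_time[of T]
    by (metis continuous_on_eq_continuous_at isCont_def tendsto_at_iff_tendsto_nhds)
  have F_lim: "((\<lambda>(p, t). F p t) \<longlongrightarrow> (\<lambda>(p, t). F p t) (fst (E z0), snd z0)) (nhds (fst (E z0), snd z0))"
  proof -
    have "(fst (E z0), snd z0) \<in> ?Q" using z0 by auto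
    then show ?thesis using continuous_on_F
      using continuous_on_eq_continuous_at[OF open_space_time[of T], of "\<lambda>(p, t). F p t"]
      unfolding isCont_def tendsto_at_iff_tendsto_nhds by blast
  qed
  have "((\<lambda>z. (fst (E z), snd z)) \<longlongrightarrow> (fst (E z0), snd z0)) (nhds z0)"
    by (intro tendsto_intros E_lim filterlim_ident)
  from filterlim_compose[OF F_lim this]
  have FE_lim: "((\<lambda>z. F (fst (E z)) (snd z) - snd (E z)) \<longlongrightarrow> F (fst (E z0)) (snd z0) - snd (E z0)) (nhds z0)"
    by (intro tendsto_intros E_lim) simp
  have lt: "snd (E z0) < F (fst (E z0)) (snd z0)" using neg E0 by (simp add: z0_def)
  have "F (fst (E z0)) (snd z0) \<le> C" using FC[of "fst (E z0)" "snd z0"] DK z0 by (auto simp: E0)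
  \<comment> \<open>The upper bound comes from the failing inequality and \<open>F \<le> C\<close>,
    the lower one from \<open>W_time\<close>, the spatial one from \<open>W_space\<close>. All are
    strict with respect to the class constants and so persist near \<open>z0\<close>.\<close>
  then have "snd (E z0) < C + 1" "- (C + 1) < snd (E z0)" "norm (fst (E z0)) < K + 1"
    using DC DK lt by (auto simp: E0)
  then have "\<forall>\<^sub>F z in nhds z0. snd (E z) < C + 1" "\<forall>\<^sub>F z in nhds z0. - (C + 1) < snd (E z)"
    "\<forall>\<^sub>F z in nhds z0. norm (fst (E z)) < K + 1"
    by (auto intro!: order_tendstoD tendsto_intros E_lim)
  moreover have "\<forall>\<^sub>F z in nhds z0. 0 < F (fst (E z)) (snd z) - snd (E z)"
    using lt by (intro order_tendstoD(1)[OF FE_lim]) simp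
  moreover have "\<forall>\<^sub>F z in nhds z0. z \<in> ?Q" using eventually_space_time[OF a(2,3)] by (simp add: z0_def)
  ultimately have "\<forall>\<^sub>F z in nhds z0. z \<in> ?Q \<and> W z - \<phi> z \<ge> W z0 - \<phi> z0 \<and> norm (fst (E z)) \<le> K + 1 \<and> \<bar>snd (E z)\<bar> \<le> C + 1
       \<and> snd (E z) \<le> F (fst (E z)) (snd z)"
    using e unfolding z0_def[symmetric] by eventually_elim auto
  then obtain r where r: "r > 0" and rb: "\<And>z. z \<in> ball z0 r \<Longrightarrow> z \<in> ?Q \<and> W z - \<phi> z \<ge> W z0 - \<phi> z0 \<and>
      norm (fst (E z)) \<le> K + 1 \<and> \<bar>snd (E z)\<bar> \<le> C + 1 \<and> snd (E z) \<le> F (fst (E z)) (snd z)"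
    unfolding eventually_nhds_metric by (auto simp: dist_commute)
  \<comment> \<open>At distance at least \<open>r / 2\<close> the paraboloid loses
    \<open>r\<^sup>2 / 4\<close>, which outweighs the lift \<open>r\<^sup>2 / 8\<close>; at the
    centre the whole lift remains.\<close>
  define c where "c = W z0 - \<phi> z0 + r\<^sup>2 / 8"
  define \<psi> where "\<psi> = (\<lambda>z. \<phi> z + - (norm (z - z0))\<^sup>2 + c)"
  have psi_test: "C1_test_function ?Q \<psi> E"
    using C1_test_function_add[OF C1_test_function_add[OF a(1) C1_test_function_minus[OF C1_test_function_norm_square]] C1_test_function_const, of z0 c]
    by (simp add: \<psi>_def E_def)
  have psi_W: "\<psi> z \<le> W z" if "z \<in> ball z0 r" "dist z0 z \<ge> r / 2" for z
  proof -
    have "(r / 2)\<^sup>2 \<le> (norm (z - z0))\<^sup>2"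
      using that r by (intro power_mono) (auto simp: dist_norm norm_minus_commute)
    then have "r\<^sup>2 / 4 \<le> (norm (z - z0))\<^sup>2" by (simp add: power_divide)
    moreover have "0 \<le> r\<^sup>2" by simp
    moreover have "W z - \<phi> z \<ge> W z0 - \<phi> z0" using rb[OF that(1)] by simp
    ultimately show ?thesis unfolding \<psi>_def c_def by linarith
  qed
  have psi_lip: "\<psi> z \<le> \<psi> z' + (K + 1) * norm (fst z - fst z') + (C + 1) * \<bar>snd z - snd z'\<bar>"
    if "z \<in> ball z0 r" "z' \<in> ball z0 r" for z z'
    using psi_test rb that
    by (intro gradient_bound_imp_lipschitz[OF convex_ball, where E = E]) (auto simp: C1_test_function_def)
  define V where "V = (\<lambda>z. if z \<in> ball z0 r then max (W z) (\<psi> z) else W z)"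
  have WV: "W z \<le> V z" for z by (simp add: V_def)
  have "space_time_lipschitz T (K + 1) (C + 1) V"
    unfolding space_time_lipschitz_def
  proof (intro allI ballI)
    fix y y' :: "real^'d" and s s' assume s: "s \<in> {0..T}" "s' \<in> {0..T}"
    define z z' where "z = (y, s)" and "z' = (y', s')"
    let ?N = "(K + 1) * norm (y - y') + (C + 1) * \<bar>s - s'\<bar>"
    have W': "W z \<le> W z' + ?N" using space_time_lipschitzD[OF W_lipschitz s, of y y'] by (simp add: z_def z'_def)
    have "V z \<le> V z' + ?N"
    proof (cases "V z = W z")
      case True then show ?thesis using W' WV[of z'] by linarith
    next
      case False
      then have zb: "z \<in> ball z0 r" and V: "V z = \<psi> z" and big: "\<psi> z > W z"
        by (auto simp: V_def max_def split: if_splits)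
      show ?thesis
      proof (cases "z' \<in> ball z0 r")
        case True
        have "\<psi> z' \<le> V z'" using True by (simp add: V_def)
        then show ?thesis using psi_lip[OF zb True] V by (simp add: z_def z'_def)
      next
        case False
        have z2: "dist z0 z \<le> r / 2" using psi_W[OF zb] big by fastforce
        \<comment> \<open>The segment from a point of the bump to a point outside the ball crosses a
          sphere on which \<open>\<psi> \<le> W\<close>. There the bound for \<open>\<psi>\<close>
          is continued by the one for \<open>W\<close>, and the two pieces add up along the
          segment.\<close>
        have "\<exists>\<tau>\<ge>0. \<tau> \<le> 1 \<and> dist z0 (z + \<tau> *\<^sub>R (z' - z)) = 3 * r / 4"
          using z2 r False by (intro IVT') (auto intro!: continuous_intros simp: algebra_simps)
        then obtain \<tau> where \<tau>: "0 \<le> \<tau>" "\<tau> \<le> 1" "dist z0 (z + \<tau> *\<^sub>R (z' - z)) = 3 * r / 4" by blast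
        define z'' where "z'' = z + \<tau> *\<^sub>R (z' - z)"
        have b: "z'' \<in> ball z0 r" "dist z0 z'' \<ge> r / 2" using \<tau> r by (auto simp: z''_def)
        then have s'': "snd z'' \<in> {0..T}" using rb[OF b(1)] by auto
        have d1: "fst z - fst z'' = \<tau> *\<^sub>R (y - y')" "snd z - snd z'' = \<tau> * (s - s')"
          by (auto simp: z''_def z_def z'_def algebra_simps)
        have d2: "fst z'' - y' = (1 - \<tau>) *\<^sub>R (y - y')" "snd z'' - s' = (1 - \<tau>) * (s - s')"
          by (auto simp: z''_def z_def z'_def algebra_simps)
        have "\<psi> z \<le> \<psi> z'' + (K + 1) * (\<tau> * norm (y - y')) + (C + 1) * (\<tau> * \<bar>s - s'\<bar>)"
          using psi_lip[OF zb b(1)] \<tau> by (simp add: d1 abs_mult)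
        also have "\<psi> z'' \<le> W z''" by (rule psi_W[OF b])
        also have "W z'' \<le> W z' + (K + 1) * ((1 - \<tau>) * norm (y - y')) + (C + 1) * ((1 - \<tau>) * \<bar>s - s'\<bar>)"
          using space_time_lipschitzD[OF W_lipschitz s'' s(2), of "fst z''" y'] \<tau>
          by (simp add: d2 abs_mult z'_def)
        finally have "\<psi> z \<le> W z' + ?N" by (simp add: algebra_simps)
        then show ?thesis using V WV[of z'] by linarith
      qed
    qed
    then show "V (y, s) \<le> V (y', s') + (K + 1) * norm (y - y') + (C + 1) * \<bar>s - s'\<bar>"
      by (simp add: z_def z'_def)
  qed
  moreover have "subsol T F V"
    unfolding subsol_def
  proof (intro allI impI, elim conjE)
    fix \<theta> D' y s
    assume b: "C1_test_function ?Q \<theta> D'" "0 < s" "s < T"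
      and e2: "\<forall>\<^sub>F z in nhds (y, s). V z - \<theta> z \<le> V (y, s) - \<theta> (y, s)"
    show "snd (D' (y, s)) \<le> F (fst (D' (y, s))) s"
    proof (cases "V (y, s) = W (y, s)")
      case True
      have "\<forall>\<^sub>F z in nhds (y, s). W z - \<theta> z \<le> W (y, s) - \<theta> (y, s)"
        using e2
      proof eventually_elim
        case (elim z) then show ?case using True WV[of z] by linarith
      qed
      then show ?thesis by (rule subsolD[OF W_subsol b])
    next
      case False
      then have zb: "(y, s) \<in> ball z0 r" and V: "V (y, s) = \<psi> (y, s)"
        by (auto simp: V_def max_def split: if_splits)
      have "\<forall>\<^sub>F z in nhds (y, s). z \<in> ball z0 r" using zb by (intro eventually_nhds_in_open) auto
      with e2 have "\<forall>\<^sub>F z in nhds (y, s). - (\<theta> z - \<psi> z) \<le> - (\<theta> (y, s) - \<psi> (y, s))"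
      proof eventually_elim
        case (elim z)
        have "\<psi> z \<le> V z" using elim by (simp add: V_def)
        then show ?case using elim(1) V by linarith
      qed
      then have e3: "\<forall>\<^sub>F z in nhds (y, s). 0 - (\<theta> z - \<psi> z) \<le> 0 - (\<theta> (y, s) - \<psi> (y, s))" by simp
      \<comment> \<open>The difference of the two smooth functions has a local minimum; testing the
        direction opposite to its gradient shows that the gradient is zero.\<close>
      have "GDERIV (\<lambda>z. \<theta> z - \<psi> z) (y, s) :> (D' (y, s) - E (y, s))"
        using b psi_test by (intro GDERIV_diff) (auto simp: C1_test_function_def)
      from touching_directional_ge[OF this e3, of 0 "- (D' (y, s) - E (y, s))"]
      have "(D' (y, s) - E (y, s)) \<bullet> (D' (y, s) - E (y, s)) \<le> 0" by (simp add: inner_diff_right)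
      then have "D' (y, s) = E (y, s)" by (metis eq_iff_diff_eq_0 inner_eq_zero_iff inner_ge_zero order_antisym)
      then show ?thesis using rb[OF zb] by simp
    qed
  qed
  moreover have "V (y, 0) \<le> u0 y" for y
  proof -
    have "(y, 0) \<notin> ball z0 r" using rb[of "(y, 0)"] by auto
    then show ?thesis by (simp add: V_def W_init)
  qed
  ultimately have "V \<in> subsols" by (auto simp: subsols_def)
  from W_ge[OF this, of t x] have "V z0 \<le> W z0" using a by (simp add: z0_def)
  moreover have "\<psi> z0 \<le> V z0" using r by (simp add: V_def)
  moreover have "r\<^sup>2 > 0" using r by simp
  moreover have "\<psi> z0 = W z0 + r\<^sup>2 / 8" by (simp add: \<psi>_def c_def)
  ultimately show False by linarith
qed

end

section \<open>Existence and uniqueness\<close>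

definition hj_solution :: "real \<Rightarrow> (real^'d \<Rightarrow> real \<Rightarrow> real) \<Rightarrow> (real^'d \<Rightarrow> real) \<Rightarrow> ((real^'d) \<times> real \<Rightarrow> real) \<Rightarrow> bool" where
  "hj_solution T F u0 u \<longleftrightarrow>
     u \<in> BUC (slab T) \<and> subsol T F u \<and> supersol T F u \<and> (\<forall>x. u (x, 0) = u0 x)"

lemma supersol_cong:
  assumes "supersol T F u"
    and F: "\<And>p t. 0 < t \<Longrightarrow> t < T \<Longrightarrow> F p t = G p t"
    and u: "\<And>x t. 0 < t \<Longrightarrow> t < T \<Longrightarrow> u (x, t) = v (x, t)"
  shows "supersol T G v"
  using assms(1) unfolding supersol_iff_subsol_uminus by (rule subsol_cong) (auto simp: F u)

lemma subsol_uniform_limit: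
  fixes u :: "(real^'d) \<times> real \<Rightarrow> real"
  assumes F: "continuous_on (open_slab T) (\<lambda>(p, t). F p t)"
    and f: "\<And>n. subsol T F (f n)" "\<And>n. continuous_on (open_slab T) (f n)"
    and lim: "uniform_limit (open_slab T) f u sequentially"
  shows "subsol T F u"
proof (rule subsol_approx[OF F])
  fix z :: "(real^'d) \<times> real" and \<delta> :: real assume z: "z \<in> open_slab T" "\<delta> > 0"
  have "\<exists>n. \<forall>z\<in>open_slab T. dist (f n z) (u z) < \<delta>"
    by (rule eventually_happens'[OF sequentially_bot uniform_limitD[OF lim z(2)]])
  then obtain n where "\<forall>z\<in>open_slab T. \<bar>f n z - u z\<bar> < \<delta>" by (auto simp: dist_real_def)
  then have n: "\<bar>f n z - u z\<bar> < \<delta>" if "z \<in> open_slab T" for z using that by blast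
  show "\<exists>w. subsol T F w \<and> continuous_on (open_slab T) w \<and>
        (\<forall>z'\<in>open_slab T. w z' \<le> u z' + \<delta>) \<and> w z \<ge> u z - \<delta>"
  proof (intro exI[of _ "f n"] conjI ballI f)
    show "f n z' \<le> u z' + \<delta>" if "z' \<in> open_slab T" for z' using n[OF that] by linarith
    show "f n z \<ge> u z - \<delta>" using n[OF z(1)] by linarith
  qed
qed

lemma supersol_uniform_limit:
  fixes u :: "(real^'d) \<times> real \<Rightarrow> real"
  assumes F: "continuous_on (open_slab T) (\<lambda>(p, t). F p t)"
    and f: "\<And>n. supersol T F (f n)" "\<And>n. continuous_on (open_slab T) (f n)"
    and lim: "uniform_limit (open_slab T) f u sequentially"
  shows "supersol T F u"
  unfolding supersol_iff_subsol_uminus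
proof (rule subsol_uniform_limit)
  have "continuous_on (open_slab T) (\<lambda>z. - (\<lambda>(p, t). F p t) (- fst z, snd z))"
    by (intro continuous_on_minus continuous_on_compose2[OF F]) (auto intro!: continuous_intros)
  then show "continuous_on (open_slab T) (\<lambda>(p, t). - F (- p) t)" by (simp add: case_prod_beta)
  show "uniform_limit (open_slab T) (\<lambda>n z. - f n z) (\<lambda>z. - u z) sequentially"
    by (rule uniform_limit_uminus[OF lim])
qed (use f in \<open>auto simp: supersol_iff_subsol_uminus intro: continuous_intros\<close>)

lemma BUC_restrictI:
  assumes "bounded (w ` S)" "uniformly_continuous_on S w"
  shows "restrict w S \<in> BUC S"
proof -
  have "restrict w S ` S = w ` S" by auto
  moreover have "uniformly_continuous_on S (restrict w S)"
    using assms(2) by (simp add: uniformly_continuous_on_def)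
  ultimately show ?thesis using assms by (simp add: BUC_def)
qed

lemma BUC_uniform_limit:
  fixes f :: "nat \<Rightarrow> 'a::metric_space \<Rightarrow> real"
  assumes f: "\<And>n. f n \<in> BUC S" and lim: "uniform_limit S f u sequentially"
  shows "restrict u S \<in> BUC S"
proof (rule BUC_restrictI)
  have ex: "\<exists>n. \<forall>x\<in>S. dist (f n x) (u x) < e" if "e > 0" for e
    using uniform_limitD[OF lim that] by (auto simp: eventually_sequentially)
  obtain n where n: "\<And>x. x \<in> S \<Longrightarrow> dist (f n x) (u x) < 1" using ex[of 1] by auto
  obtain M where M: "\<And>x. x \<in> S \<Longrightarrow> \<bar>f n x\<bar> \<le> M"
    using f[of n] unfolding BUC_def bounded_iff by auto
  have "\<bar>u x\<bar> \<le> M + 1" if "x \<in> S" for x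
    using n[OF that] M[OF that] by (simp add: dist_real_def)
  then show "bounded (u ` S)" unfolding bounded_iff by auto
  show "uniformly_continuous_on S u"
    unfolding uniformly_continuous_on_def
  proof (intro allI impI)
    fix e :: real assume e: "e > 0"
    then obtain n where n: "\<And>x. x \<in> S \<Longrightarrow> dist (f n x) (u x) < e / 3" using ex[of "e / 3"] by auto
    have "uniformly_continuous_on S (f n)" using f[of n] by (simp add: BUC_def)
    then obtain d where d: "d > 0" "\<And>x y. x \<in> S \<Longrightarrow> y \<in> S \<Longrightarrow> dist y x < d \<Longrightarrow> dist (f n y) (f n x) < e / 3"
      using e unfolding uniformly_continuous_on_def by (metis divide_pos_pos zero_less_numeral)
    show "\<exists>d>0. \<forall>x\<in>S. \<forall>y\<in>S. dist y x < d \<longrightarrow> dist (u y) (u x) < e"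
    proof (intro exI[of _ d] conjI ballI impI d)
      fix x y assume "x \<in> S" "y \<in> S" "dist y x < d"
      with d(2)[of x y] n[of x] n[of y] show "dist (u y) (u x) < e"
        by (simp add: dist_real_def abs_if split: if_splits)
    qed
  qed
qed

lemma hj_solution_uniform_limit:
  fixes F :: "real^'d \<Rightarrow> real \<Rightarrow> real"
  assumes T: "T > 0" and F: "continuous_on (slab T) (\<lambda>(p, t). F p t)"
    and f: "\<And>n. hj_solution T F (g n) (f n)" and lim: "uniform_limit (slab T) f u sequentially"
    and g: "uniform_limit UNIV g u0 sequentially"
  shows "hj_solution T F u0 (restrict u (slab T))"
proof -
  have F': "continuous_on (open_slab T) (\<lambda>(p, t). F p t)" by (rule continuous_on_subset[OF F]) auto
  have cont: "continuous_on (open_slab T) (f n)" for n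
    using f[of n] unfolding hj_solution_def BUC_def
    by (intro continuous_on_subset[OF uniformly_continuous_imp_continuous, of "slab T"]) auto
  have lim': "uniform_limit (open_slab T) f u sequentially"
    by (rule uniform_limit_on_subset[OF lim]) auto
  have "subsol T F u"
    using f by (intro subsol_uniform_limit[OF F' _ cont lim']) (simp add: hj_solution_def)
  moreover have "supersol T F u"
    using f by (intro supersol_uniform_limit[OF F' _ cont lim']) (simp add: hj_solution_def)
  moreover have "restrict u (slab T) \<in> BUC (slab T)"
    using f by (intro BUC_uniform_limit[OF _ lim]) (simp add: hj_solution_def)
  moreover have "u (x, 0) = u0 x" for x
  proof (rule LIMSEQ_unique)
    show "(\<lambda>n. f n (x, 0)) \<longlonglongrightarrow> u (x, 0)" using T by (intro tendsto_uniform_limitI[OF lim]) auto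
    show "(\<lambda>n. f n (x, 0)) \<longlonglongrightarrow> u0 x"
      using tendsto_uniform_limitI[OF g, of x] f by (simp add: hj_solution_def)
  qed
  ultimately show ?thesis using T
    by (auto simp: hj_solution_def elim!: subsol_cong supersol_cong)
qed

lemma hj_solution_contraction:
  fixes F :: "real^'d \<Rightarrow> real \<Rightarrow> real"
  assumes T: "T > 0" and F: "continuous_on (slab T) (\<lambda>(p, t). F p t)"
    and u: "hj_solution T F u0 u" and v: "hj_solution T F v0 v"
    and c: "\<And>x. \<bar>u0 x - v0 x\<bar> \<le> c" and z: "z \<in> slab T"
  shows "\<bar>u z - v z\<bar> \<le> c"
proof -
  obtain x t where [simp]: "z = (x, t)" by (cases z)
  have t: "t \<in> {0..T}" using z by simp
  have init: "u (x, 0) - v (x, 0) \<le> c" "v (x, 0) - u (x, 0) \<le> c" for x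
    using c[of x] u v unfolding hj_solution_def by (simp_all add: abs_le_iff)
  have "u (x, t) - v (x, t) \<le> c"
    by (rule comparison[where u = u and v = v, OF T _ _ _ _ F init(1) t]) (use u v in \<open>simp_all add: hj_solution_def\<close>)
  moreover have "v (x, t) - u (x, t) \<le> c"
    by (rule comparison[where u = v and v = u, OF T _ _ _ _ F init(2) t]) (use u v in \<open>simp_all add: hj_solution_def\<close>)
  ultimately show ?thesis by simp
qed

lemma hj_solution_unique:
  fixes F :: "real^'d \<Rightarrow> real \<Rightarrow> real"
  assumes T: "T > 0" and F: "continuous_on (slab T) (\<lambda>(p, t). F p t)"
    and u: "hj_solution T F u0 u" and v: "hj_solution T F u0 v"
  shows "u = v"
proof (rule extensionalityI)
  show "u \<in> extensional (slab T)" "v \<in> extensional (slab T)"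
    using u v by (auto simp: hj_solution_def BUC_def)
  show "u z = v z" if "z \<in> slab T" for z
    using hj_solution_contraction[OF T F u v _ that, of 0] by simp
qed

lemma hj_solution_exists_lipschitz:
  fixes F :: "real^'d \<Rightarrow> real \<Rightarrow> real"
  assumes T: "T > 0" and F: "continuous_on (slab T) (\<lambda>(p, t). F p t)"
    and K: "K \<ge> 0" and u0: "\<And>x y. u0 x \<le> u0 y + K * norm (x - y)" and bd: "bounded (range u0)"
  shows "\<exists>u. hj_solution T F u0 u"
proof -
  let ?P = "(cball 0 (K + 1) :: (real^'d) set) \<times> {0..T}"
  have "compact ((\<lambda>(p, t). F p t) ` ?P)"
    by (rule compact_continuous_image[OF continuous_on_subset[OF F]]) (auto intro!: compact_Times)
  from compact_imp_bounded[OF this] obtain C where C: "\<And>z. z \<in> ?P \<Longrightarrow> \<bar>(\<lambda>(p, t). F p t) z\<bar> \<le> C"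
    unfolding bounded_iff by auto
  interpret perron T K C F u0
  proof
    fix p :: "real^'d" and t assume "norm p \<le> K + 1" "t \<in> {0..T}"
    then show "\<bar>F p t\<bar> \<le> C" using C[of "(p, t)"] by simp
  qed fact+
  let ?S = "slab T :: ((real^'d) \<times> real) set"
  obtain M where M: "\<And>x. \<bar>u0 x\<bar> \<le> M" using bd unfolding bounded_iff by auto
  have "\<bar>W z\<bar> \<le> M + (C + 1) * T" if "z \<in> ?S" for z
  proof -
    obtain x t where [simp]: "z = (x, t)" by (cases z)
    have t: "t \<in> {0..T}" using that by auto
    have "C * t \<le> (C + 1) * t" "(C + 1) * t \<le> (C + 1) * T"
      using t local.C by (auto intro!: mult_right_mono mult_left_mono)
    then show ?thesis using W_upper[OF t, of x] W_lower[OF t, of x] M[of x] by simp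
  qed
  then have "bounded (W ` ?S)" unfolding bounded_iff by auto
  moreover have "uniformly_continuous_on ?S W"
    using K local.C by (intro space_time_lipschitz_uniformly_continuous[OF W_lipschitz]) auto
  ultimately have "restrict W ?S \<in> BUC ?S" by (rule BUC_restrictI)
  moreover have "subsol T F (restrict W ?S)" by (rule subsol_cong[OF W_subsol]) auto
  moreover have "supersol T F (restrict W ?S)" by (rule supersol_cong[OF W_supersol]) auto
  ultimately show ?thesis using T W_init by (auto simp: hj_solution_def)
qed

text \<open>Infimal convolution with \<open>K * norm\<close>. The slope \<open>K = 2 * M / d\<close>
  exceeds the oscillation of \<open>u0\<close> at distances of at least \<open>d\<close>; at smaller
  distances uniform continuity loses at most \<open>e\<close>.\<close>

lemma BUC_lipschitz_approximation:
  fixes u0 :: "'a::real_normed_vector \<Rightarrow> real"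
  assumes u0: "u0 \<in> BUC UNIV" and e: "e > 0"
  obtains K g where "K \<ge> 0" "\<And>x y. g x \<le> g y + K * norm (x - y)" "bounded (range g)" "\<And>x. \<bar>g x - u0 x\<bar> \<le> e"
proof -
  obtain M where M: "\<And>x. \<bar>u0 x\<bar> \<le> M" using u0 unfolding BUC_def bounded_iff by auto
  have M0: "M \<ge> 0" using M[of 0] by linarith
  obtain d where d: "d > 0" "\<And>x y. dist y x < d \<Longrightarrow> dist (u0 y) (u0 x) < e"
    using u0 e unfolding BUC_def uniformly_continuous_on_def by auto
  define K where "K = 2 * M / d"
  have K: "K \<ge> 0" using M0 d by (simp add: K_def)
  have lower: "u0 x - e \<le> u0 y + K * norm (x - y)" for x y
  proof (cases "dist y x < d")
    case True
    moreover have "K * norm (x - y) \<ge> 0" using K by simp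
    ultimately show ?thesis using d(2)[of y x] by (simp add: dist_real_def)
  next
    case False
    then have "K * d \<le> K * norm (x - y)" using K by (intro mult_left_mono) (auto simp: dist_norm norm_minus_commute)
    moreover have "K * d = 2 * M" using d by (simp add: K_def)
    ultimately show ?thesis using M[of x] M[of y] e by linarith
  qed
  define g where "g = (\<lambda>x. INF y. u0 y + K * norm (x - y))"
  have bdd: "bdd_below (range (\<lambda>y. u0 y + K * norm (x - y)))" for x
    by (rule bdd_belowI2[of _ "u0 x - e"]) (use lower in auto)
  have g_le: "g x \<le> u0 y + K * norm (x - y)" for x y
    unfolding g_def by (rule cINF_lower[OF bdd]) simp
  have g_ge: "c \<le> g x" if "\<And>y. c \<le> u0 y + K * norm (x - y)" for c x
    unfolding g_def using that by (intro cINF_greatest) auto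
  have g1: "\<bar>g x - u0 x\<bar> \<le> e" for x
    using g_le[of x x] g_ge[of "u0 x - e" x] lower e by (simp add: abs_le_iff)
  have "g x - K * norm (x - y) \<le> g y" for x y
  proof (rule g_ge)
    fix w
    have "K * norm (x - w) \<le> K * norm (x - y) + K * norm (y - w)"
      using mult_left_mono[OF norm_triangle_ineq[of "x - y" "y - w"] K] by (simp add: algebra_simps)
    then show "g x - K * norm (x - y) \<le> u0 w + K * norm (y - w)" using g_le[of x w] by linarith
  qed
  then have "g x \<le> g y + K * norm (x - y)" for x y by (simp add: algebra_simps)
  moreover have "\<bar>g x\<bar> \<le> M + e" for x using g1[of x] M[of x] by linarith
  then have "bounded (range g)" unfolding bounded_iff by auto
  ultimately show ?thesis using that K g1 by blast
qed

text \<open>By contraction, uniform Lipschitz approximations of \<open>u0\<close> have uniformly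
  Cauchy solutions, and the solution property passes to the limit.\<close>

lemma hj_solution_exists:
  fixes F :: "real^'d \<Rightarrow> real \<Rightarrow> real"
  assumes T: "T > 0" and F: "continuous_on (slab T) (\<lambda>(p, t). F p t)"
    and u0: "u0 \<in> BUC UNIV"
  shows "\<exists>u. hj_solution T F u0 u"
proof -
  have "\<exists>g f. (\<forall>x. \<bar>g x - u0 x\<bar> \<le> inverse (real (Suc n))) \<and> hj_solution T F g f" for n
  proof -
    have "inverse (real (Suc n)) > 0" by simp
    from BUC_lipschitz_approximation[OF u0 this] obtain K g where
      g: "K \<ge> 0" "\<And>x y. g x \<le> g y + K * norm (x - y)" "bounded (range g)" "\<And>x. \<bar>g x - u0 x\<bar> \<le> inverse (real (Suc n))"
      by metis
    from hj_solution_exists_lipschitz[OF T F g(1-3)] g(4) show ?thesis by blast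
  qed
  then obtain g f where g: "\<And>n x. \<bar>g n x - u0 x\<bar> \<le> inverse (real (Suc n))" and f: "\<And>n. hj_solution T F (g n) (f n)"
    by metis
  have small: "\<forall>\<^sub>F n in sequentially. inverse (real (Suc n)) < e" if "e > 0" for e
    using LIMSEQ_inverse_real_of_nat that by (rule order_tendstoD)
  have "uniform_limit UNIV g u0 sequentially"
  proof (rule uniform_limitI)
    fix e :: real assume "e > 0"
    from small[OF this] show "\<forall>\<^sub>F n in sequentially. \<forall>x\<in>UNIV. dist (g n x) (u0 x) < e"
      by eventually_elim (use g in \<open>auto simp: dist_real_def intro: le_less_trans\<close>)
  qed
  have "uniformly_Cauchy_on (slab T) f"
    unfolding uniformly_Cauchy_on_def
  proof (intro allI impI)
    fix e :: real assume "e > 0"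
    then obtain N where N: "\<And>n. n \<ge> N \<Longrightarrow> inverse (real (Suc n)) < e / 2"
      using small[of "e / 2"] by (auto simp: eventually_sequentially)
    show "\<exists>M. \<forall>x\<in>slab T. \<forall>m\<ge>M. \<forall>n\<ge>M. dist (f m x) (f n x) < e"
    proof (intro exI[of _ N] ballI allI impI)
      fix z :: "(real^'d) \<times> real" and m n assume z: "z \<in> slab T" and mn: "m \<ge> N" "n \<ge> N"
      have "\<bar>g m x - g n x\<bar> \<le> inverse (real (Suc m)) + inverse (real (Suc n))" for x
        using g[of m x] g[of n x] by linarith
      from hj_solution_contraction[OF T F f f this z]
      show "dist (f m z) (f n z) < e" using N[OF mn(1)] N[OF mn(2)] by (simp add: dist_real_def)
    qed
  qed
  from Cauchy_uniformly_convergent[OF this] obtain u where "uniform_limit (slab T) f u sequentially"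
    unfolding uniformly_convergent_on_def by blast
  from hj_solution_uniform_limit[OF T F f this] \<open>uniform_limit UNIV g u0 sequentially\<close>
  show ?thesis by blast
qed

text \<open>
  \<^const>\<open>hamiltonian\<close> uses the two-sided derivative, which is junk at the endpoints of the time
  interval; \<open>path_hamiltonian\<close> takes the derivative as an argument and is continuous up to the
  endpoints.
\<close>

definition path_hamiltonian ::
  "('m::finite \<Rightarrow> real^'d \<Rightarrow> real) \<Rightarrow> (real \<Rightarrow> real^'m) \<Rightarrow> real^'d \<Rightarrow> real \<Rightarrow> real" where
  "path_hamiltonian H B' p t = (\<Sum>i\<in>UNIV. H i p * (B' t $ i))"

lemma hamiltonian_eq:
  assumes "\<And>t. t \<in> {0..T} \<Longrightarrow> (B has_vector_derivative B' t) (at t within {0..T})" "0 < t" "t < T"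
  shows "hamiltonian H B p t = path_hamiltonian H B' p t"
proof -
  have "(B has_vector_derivative B' t) (at t within {0..T})" using assms by auto
  moreover have "at t within {0..T} = at t" using assms by (intro at_within_interior) auto
  ultimately show ?thesis
    using vector_derivative_at[of B "B' t" t] by (simp add: hamiltonian_def path_hamiltonian_def)
qed

lemma continuous_on_path_hamiltonian:
  assumes "\<And>i. continuous_on UNIV (H i)" "continuous_on {0..T} B'"
  shows "continuous_on (slab T) (\<lambda>(p, t). path_hamiltonian H B' p t)"
proof -
  have "continuous_on (slab T) (\<lambda>z. H i (fst z))" for i
    by (rule continuous_on_compose2[OF assms(1)]) (auto intro: continuous_intros)
  moreover have "continuous_on (slab T) (\<lambda>z. B' (snd z))"
    by (rule continuous_on_compose2[OF assms(2)]) (auto intro: continuous_intros)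
  ultimately show ?thesis
    unfolding path_hamiltonian_def case_prod_beta by (intro continuous_intros)
qed

lemma viscosity_solution_iff:
  assumes "\<And>t. t \<in> {0..T} \<Longrightarrow> (B has_vector_derivative B' t) (at t within {0..T})"
  shows "viscosity_solution T H B u0 u \<longleftrightarrow> hj_solution T (path_hamiltonian H B') u0 u"
proof -
  have eq: "hamiltonian H B p t = path_hamiltonian H B' p t" if "0 < t" "t < T" for p t
    using hamiltonian_eq[OF assms that] .
  have "viscosity_subsolution T H B u \<longleftrightarrow> subsol T (hamiltonian H B) u"
    by (simp add: viscosity_subsolution_def subsol_def)
  also have "\<dots> \<longleftrightarrow> subsol T (path_hamiltonian H B') u"
    by (auto elim!: subsol_cong simp: eq)
  finally have 1: "viscosity_subsolution T H B u \<longleftrightarrow> subsol T (path_hamiltonian H B') u" .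
  have "viscosity_supersolution T H B u \<longleftrightarrow> supersol T (hamiltonian H B) u"
    by (simp add: viscosity_supersolution_def supersol_def)
  also have "\<dots> \<longleftrightarrow> supersol T (path_hamiltonian H B') u"
    by (auto elim!: supersol_cong simp: eq)
  finally show ?thesis using 1 by (simp add: viscosity_solution_def hj_solution_def)
qed

lemma C1_paths_derivative:
  assumes "B \<in> C1_paths T"
  obtains B' where "\<And>t. t \<in> {0..T} \<Longrightarrow> (B has_vector_derivative B' t) (at t within {0..T})"
    "continuous_on {0..T} B'" "B 0 = 0"
  using assms unfolding C1_paths_def by blast

text \<open>Gives meaning to the \<open>THE\<close> in \<open>solution_operator\<close>.\<close>

lemma viscosity_solution_ex1:
  assumes "T > 0" "\<And>i. continuous_on UNIV (H i)" "B \<in> C1_paths T" "u0 \<in> BUC UNIV"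
  shows "\<exists>!u. viscosity_solution T H B u0 u"
proof -
  obtain B' where B': "\<And>t. t \<in> {0..T} \<Longrightarrow> (B has_vector_derivative B' t) (at t within {0..T})"
    "continuous_on {0..T} B'"
    using C1_paths_derivative[OF assms(3)] by metis
  note F = continuous_on_path_hamiltonian[of H, OF assms(2) B'(2)]
  have eq: "viscosity_solution T H B u0 u \<longleftrightarrow> hj_solution T (path_hamiltonian H B') u0 u" for u
    by (rule viscosity_solution_iff) (rule B')
  obtain u where "hj_solution T (path_hamiltonian H B') u0 u"
    using hj_solution_exists[OF assms(1) F assms(4)] by blast
  then show ?thesis
    unfolding eq using hj_solution_unique[OF assms(1) F] by blast
qed

lemma viscosity_solution_operator:
  assumes "T > 0" "\<And>i. continuous_on UNIV (H i)" "B \<in> C1_paths T" "u0 \<in> BUC UNIV"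
  shows "viscosity_solution T H B u0 (solution_operator T H B u0)"
  unfolding solution_operator_def by (rule theI'[OF viscosity_solution_ex1[of T H, OF assms]])

section \<open>The perturbed Legendre transform\<close>

text \<open>For \<open>norm p > 1\<close> the unit vector \<open>p / norm p\<close> lies between 0
  and \<open>p\<close>, so convexity bounds \<open>g p\<close> from below by extrapolating the
  values on the unit ball, which are bounded by compactness.\<close>

lemma convex_on_linear_lower_bound:
  fixes g :: "'a::euclidean_space \<Rightarrow> real"
  assumes g: "convex_on UNIV g"
  obtains C where "C \<ge> 0" "\<And>p. - C * (1 + norm p) \<le> g p"
proof -
  have "continuous_on UNIV g" by (rule convex_on_continuous[OF open_UNIV g])
  then have "compact (g ` cball 0 1)"
    by (intro compact_continuous_image) (auto intro: continuous_on_subset)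
  then obtain M where M: "\<And>p. norm p \<le> 1 \<Longrightarrow> \<bar>g p\<bar> \<le> M"
    unfolding bounded_iff[of "g ` cball 0 1"] using compact_imp_bounded by (fastforce simp: bounded_iff)
  have M0: "M \<ge> 0" using M[of 0] by simp
  show ?thesis
  proof
    show "2 * M \<ge> 0" using M0 by simp
    fix p show "- (2 * M) * (1 + norm p) \<le> g p"
    proof (cases "norm p \<le> 1")
      case True
      have "0 \<le> M * norm p" using M0 by simp
      moreover have "- (2 * M) * (1 + norm p) = - 2 * M - 2 * (M * norm p)" by (simp add: algebra_simps)
      ultimately show ?thesis using M[OF True] M0 by linarith
    next
      case False
      then have p: "norm p > 1" by simp
      let ?q = "(1 / norm p) *\<^sub>R p"
      have "?q = (1 - 1 / norm p) *\<^sub>R 0 + (1 / norm p) *\<^sub>R p" by simp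
      then have "g ?q \<le> (1 - 1 / norm p) * g 0 + (1 / norm p) * g p"
        using convex_onD[OF g, of "1 / norm p" 0 p] p by (simp add: divide_le_eq_1)
      then have "norm p * g ?q \<le> norm p * ((1 - 1 / norm p) * g 0 + (1 / norm p) * g p)"
        using p by (intro mult_left_mono) auto
      also have "\<dots> = (norm p - 1) * g 0 + g p" using p by (simp add: field_simps)
      finally have 1: "norm p * g ?q - (norm p - 1) * g 0 \<le> g p" by simp
      have "norm ?q \<le> 1" using p by simp
      then have "- M \<le> g ?q" using M[of ?q] by linarith
      then have 2: "norm p * - M \<le> norm p * g ?q" by (intro mult_left_mono) auto
      have "(norm p - 1) * g 0 \<le> (norm p - 1) * M"
        using M[of 0] p by (intro mult_left_mono) auto
      then show ?thesis using 1 2 M0 by (simp add: algebra_simps)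
    qed
  qed
qed

text \<open>The same convex function is added to both parts. Nonnegativity will keep
  \<open>N\<close> nonnegative for small \<open>c\<close>, which gives both the coercivity of the
  Legendre transform and its sign at the origin.\<close>

lemma difference_of_convex_nonneg:
  fixes f :: "'a::euclidean_space \<Rightarrow> real"
  assumes "difference_of_convex f"
  obtains g h where "convex_on UNIV g" "convex_on UNIV h" "\<And>p. g p \<ge> 0" "\<And>p. h p \<ge> 0" "\<And>p. f p = g p - h p"
proof -
  obtain g h where gh: "convex_on UNIV g" "convex_on UNIV h" "\<And>p. f p = g p - h p"
    using assms by (auto simp: difference_of_convex_def)
  obtain C D where C: "C \<ge> 0" "\<And>p. - C * (1 + norm p) \<le> g p" and D: "D \<ge> 0" "\<And>p. - D * (1 + norm p) \<le> h p"
    using convex_on_linear_lower_bound[OF gh(1)] convex_on_linear_lower_bound[OF gh(2)] by metis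
  let ?N = "\<lambda>p :: 'a. (C + D) * (1 + norm p)"
  have N: "convex_on UNIV ?N"
  proof -
    have "convex_on UNIV (\<lambda>p :: 'a. (C + D) + (C + D) * norm p)"
      using C D by (intro convex_on_add convex_on_const[THEN iffD2] convex_on_cmul convex_on_dist[of UNIV "0::'a", simplified]) auto
    then show ?thesis by (simp add: algebra_simps)
  qed
  show ?thesis
  proof (rule that)
    show "convex_on UNIV (\<lambda>p. g p + ?N p)" "convex_on UNIV (\<lambda>p. h p + ?N p)"
      using gh N by auto
    fix p :: 'a
    have "D * (1 + norm p) \<ge> 0" "C * (1 + norm p) \<ge> 0" using C D by auto
    then show "0 \<le> g p + ?N p" "0 \<le> h p + ?N p" using C(2)[of p] D(2)[of p]
      by (simp_all only: distrib_right minus_mult_left[symmetric])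
    show "f p = g p + ?N p - (h p + ?N p)" using gh by simp
  qed
qed

text \<open>Danskin's theorem for the supremum of a family that is affine in the parameter.\<close>

locale strongly_concave_family =
  fixes g :: "'p::euclidean_space \<Rightarrow> 'w::euclidean_space" and \<Psi> :: "'p \<Rightarrow> real" and U :: "'w set" and l A :: real
    and f :: "'w \<Rightarrow> 'p \<Rightarrow> real"
  assumes f_def: "\<And>w p. f w p = g p \<bullet> w - \<Psi> p" and U: "open U" and g: "continuous_on UNIV g" and Psi: "continuous_on UNIV \<Psi>" and l: "l > 0" and A: "A \<ge> 0"
    and midpoint: "\<And>w p q. w \<in> U \<Longrightarrow> (f w p + f w q) / 2 + l / 8 * (norm (p - q))\<^sup>2 \<le> f w ((1/2) *\<^sub>R (p + q))"
    and growth: "\<And>w p. w \<in> U \<Longrightarrow> f w p \<le> norm p * norm w - l / 2 * (norm p)\<^sup>2"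
    and zero: "\<And>w. w \<in> U \<Longrightarrow> - A \<le> f w 0"
begin

definition P :: "'w \<Rightarrow> 'p" where "P w = (SOME p. \<forall>q. f w q \<le> f w p)"

text \<open>Beyond this radius \<open>growth\<close> pushes \<open>f w p\<close> below
  \<open>- A\<close>, hence below the value at 0, so the maximum is attained inside.\<close>

definition R :: "real \<Rightarrow> real" where "R r = 2 * r / l + (2 * A / l + 1)"

lemma R_bound:
  assumes w: "w \<in> U" and p: "- A \<le> f w p"
  shows "norm p \<le> R (norm w)"
proof (rule ccontr)
  define s where "s = 2 * A / l + 1"
  have s: "s \<ge> 1" "l / 2 * s > A" using l A by (auto simp: s_def field_simps)
  assume "\<not> ?thesis"
  then have n: "norm p > 2 * norm w / l + s" by (simp add: R_def s_def)
  then have 1: "l / 2 * norm p - norm w > l / 2 * s" using l by (simp add: field_simps)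
  have "2 * norm w / l \<ge> 0" using l by simp
  then have "norm p > 1" using n s by linarith
  then have "1 * (l / 2 * s) < norm p * (l / 2 * norm p - norm w)"
    using 1 s l A by (intro mult_strict_mono) auto
  then have "norm p * norm w - l / 2 * (norm p)\<^sup>2 < - A"
    using s by (simp add: algebra_simps power2_eq_square)
  then show False using growth[OF w, of p] p by linarith
qed

lemma P_max:
  assumes w: "w \<in> U"
  shows "f w q \<le> f w (P w)"
proof -
  have "f w = (\<lambda>p. g p \<bullet> w - \<Psi> p)" by (rule ext) (rule f_def)
  then have "continuous_on UNIV (f w)" by (simp only:) (intro continuous_intros g Psi)
  then have c: "continuous_on (cball 0 (R (norm w))) (f w)" by (rule continuous_on_subset) simp
  have "f w 0 \<ge> - A" by (rule zero[OF w])
  then have "0 \<in> cball (0::'p) (R (norm w))" using R_bound[OF w, of 0] by simp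
  then obtain p where p: "\<And>q. norm q \<le> R (norm w) \<Longrightarrow> f w q \<le> f w p"
    using continuous_attains_sup[OF compact_cball _ c] by force
  have "f w q \<le> f w p" for q
  proof (cases "norm q \<le> R (norm w)")
    case False
    then have "f w q < - A" using R_bound[OF w, of q] by linarith
    moreover have "f w 0 \<le> f w p" using p[of 0] \<open>0 \<in> cball 0 (R (norm w))\<close> by simp
    ultimately show ?thesis using zero[OF w] by linarith
  qed (use p in auto)
  then have "\<forall>q. f w q \<le> f w p" by blast
  then show ?thesis unfolding P_def by (rule someI2) blast
qed

lemma P_norm: "w \<in> U \<Longrightarrow> norm (P w) \<le> R (norm w)"
  using R_bound[of w "P w"] P_max[of w 0] zero[of w] by linarith

lemma P_strict:
  assumes w: "w \<in> U"
  shows "f w q + l / 4 * (norm (P w - q))\<^sup>2 \<le> f w (P w)"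
  using midpoint[OF w, of "P w" q] P_max[OF w, of "(1/2) *\<^sub>R (P w + q)"]
  by (simp add: field_simps)

text \<open>Adding \<open>P_strict\<close> at \<open>w\<close> and at \<open>w'\<close> cancels
  \<open>\<Psi>\<close>. With \<open>g\<close> bounded on compact sets this makes the maximiser
  locally Hoelder continuous with exponent 1/2.\<close>

lemma P_monotone:
  assumes "w \<in> U" "w' \<in> U"
  shows "l / 2 * (norm (P w - P w'))\<^sup>2 \<le> (g (P w) - g (P w')) \<bullet> (w - w')"
  using P_strict[OF assms(1), of "P w'"] P_strict[OF assms(2), of "P w"]
  unfolding f_def by (simp add: norm_minus_commute inner_diff_left inner_diff_right)

lemma continuous_on_P: "continuous_on U P"
  unfolding continuous_on_iff
proof (intro ballI allI impI)
  fix w and e :: real assume w: "w \<in> U" and e: "e > 0"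
  have "continuous_on (cball 0 (R (norm w + 1))) g" by (rule continuous_on_subset[OF g]) simp
  then have "bounded (g ` cball 0 (R (norm w + 1)))"
    by (intro compact_imp_bounded compact_continuous_image) auto
  then obtain M where M: "\<And>p. norm p \<le> R (norm w + 1) \<Longrightarrow> norm (g p) \<le> M"
    unfolding bounded_iff by fastforce
  have Rmono: "R r \<le> R (norm w + 1)" if "r \<le> norm w + 1" for r
    using that l by (simp add: R_def divide_right_mono)
  have gM: "norm (g (P w')) \<le> M" if "w' \<in> U" "norm w' \<le> norm w + 1" for w'
    using P_norm[OF that(1)] Rmono[OF that(2)] M by fastforce
  then have M0: "M \<ge> 0" using w norm_ge_zero[of "g (P w)"] by (meson add_increasing2 order_trans order_refl zero_le_one)
  define d where "d = min 1 (l * e\<^sup>2 / (8 * (M + 1)))"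
  have d: "d > 0" using l e M0 by (simp add: d_def)
  show "\<exists>d>0. \<forall>w'\<in>U. dist w' w < d \<longrightarrow> dist (P w') (P w) < e"
  proof (intro exI[of _ d] conjI ballI impI d)
    fix w' assume w': "w' \<in> U" and dist: "dist w' w < d"
    have "norm w' \<le> norm w + norm (w' - w)" by (metis norm_triangle_sub add.commute)
    then have n: "norm w' \<le> norm w + 1" using dist by (simp add: d_def dist_norm)
    have "l / 2 * (norm (P w - P w'))\<^sup>2 \<le> norm (g (P w) - g (P w')) * norm (w - w')"
      using P_monotone[OF w w'] norm_cauchy_schwarz order_trans by blast
    also have "\<dots> \<le> (M + M) * d"
      using norm_triangle_ineq4[of "g (P w)" "g (P w')"] gM[OF w] gM[OF w' n] dist M0
      by (intro mult_mono) (auto simp: dist_norm norm_minus_commute)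
    also have "\<dots> \<le> (M + M) * (l * e\<^sup>2 / (8 * (M + 1)))"
      using M0 by (intro mult_left_mono) (auto simp: d_def)
    also have "\<dots> = l / 2 * e\<^sup>2 * (M / (2 * (M + 1)))"
      using M0 by (simp add: field_simps)
    also have "\<dots> < l / 2 * e\<^sup>2 * 1"
      using l e M0 by (intro mult_strict_left_mono) (auto simp: field_simps)
    finally have "(norm (P w - P w'))\<^sup>2 < e\<^sup>2" using l by simp
    then have "norm (P w - P w') < e" using e by (meson less_imp_le power_less_imp_less_base)
    then show "dist (P w') (P w) < e" by (simp add: dist_norm norm_minus_commute)
  qed
qed

lemma GDERIV_max:
  assumes w: "w \<in> U"
  shows "GDERIV (\<lambda>w. f w (P w)) w :> g (P w)"
proof -
  obtain e where e: "e > 0" "ball w e \<subseteq> U" using U w by (auto simp: open_contains_ball)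
  show ?thesis
    unfolding gderiv_def
  proof (rule has_derivativeI_sandwich[OF e(1)])
    show "bounded_linear (\<lambda>h. h \<bullet> g (P w))" by (rule bounded_linear_inner_left)
    fix w' assume "w' \<in> UNIV" and ne: "w' \<noteq> w" and "dist w' w < e"
    then have w': "w' \<in> U" using e by (auto simp: dist_commute)
    \<comment> \<open>Inserting each maximiser into the other problem encloses the increment between
      two linear expressions in \<open>w' - w\<close>, whose slopes \<open>g (P w)\<close> and
      \<open>g (P w')\<close> merge by continuity.\<close>
    have 1: "f w' (P w') - f w (P w) \<ge> (w' - w) \<bullet> g (P w)"
      using P_max[OF w', of "P w"] by (simp add: f_def inner_diff_left inner_diff_right inner_commute)
    have 2: "f w' (P w') - f w (P w) \<le> (w' - w) \<bullet> g (P w')"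
      using P_max[OF w, of "P w'"] by (simp add: f_def inner_diff_left inner_diff_right inner_commute)
    have "(w' - w) \<bullet> (g (P w') - g (P w)) \<le> norm (w' - w) * norm (g (P w') - g (P w))"
      by (rule norm_cauchy_schwarz)
    with 1 2 have "norm (f w' (P w') - f w (P w) - (w' - w) \<bullet> g (P w)) \<le> norm (w' - w) * norm (g (P w') - g (P w))"
      by (simp add: inner_diff_right)
    then show "norm (f w' (P w') - f w (P w) - (w' - w) \<bullet> g (P w)) / norm (w' - w) \<le> norm (g (P w') - g (P w))"
      using ne by (simp add: field_simps)
  next
    have "isCont P w" using continuous_on_P U w by (simp add: continuous_on_eq_continuous_at)
    moreover have "isCont g (P w)" using g by (simp add: continuous_on_eq_continuous_at)
    ultimately have "isCont (\<lambda>w. g (P w)) w" by (rule isCont_o2)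
    then have "((\<lambda>w'. g (P w') - g (P w)) \<longlongrightarrow> 0) (at w)" unfolding isCont_def LIM_zero_iff .
    then show "((\<lambda>w'. norm (g (P w') - g (P w))) \<longlongrightarrow> 0) (at w)" by (rule tendsto_norm_zero)
  qed
qed

lemma continuous_on_max: "continuous_on U (\<lambda>w. f w (P w))"
  using GDERIV_max unfolding gderiv_def
  by (meson continuous_at_imp_continuous_on has_derivative_continuous)

end

lemma midpoint_norm_square:
  fixes p q :: "'a::real_inner"
  shows "(norm ((1/2) *\<^sub>R (p + q)))\<^sup>2 = ((norm p)\<^sup>2 + (norm q)\<^sup>2) / 2 - (norm (p - q))\<^sup>2 / 4"
  unfolding power2_norm_eq_inner
  by (simp add: inner_add_left inner_add_right inner_diff_left inner_diff_right inner_commute field_simps)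

text \<open>
  With \<open>H i = G i - K i\<close> the function \<open>p \<mapsto> l (\<Sum>i. G i p + K i p) - (\<Sum>i. c i * H i p)\<close> equals
  \<open>\<Sum>i. (l - c i) * G i p + (l + c i) * K i p\<close>, hence is convex as long as all \<open>\<bar>c i\<bar> \<le> l\<close>.
  Its perturbed Legendre transform is an exact solution of the doubled equation.
\<close>

locale dc_hamiltonian =
  fixes H G K :: "'m::finite \<Rightarrow> real^'d \<Rightarrow> real" and l :: real
  assumes H: "\<And>i p. H i p = G i p - K i p"
    and G: "\<And>i. convex_on UNIV (G i)" "\<And>i p. G i p \<ge> 0"
    and K: "\<And>i. convex_on UNIV (K i)" "\<And>i p. K i p \<ge> 0"
    and l: "l > 0"
begin

definition Q :: "real^'d \<Rightarrow> real" where "Q p = (\<Sum>i\<in>UNIV. G i p + K i p)"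

definition N :: "real^'m \<Rightarrow> real^'d \<Rightarrow> real" where
  "N c p = (\<Sum>i\<in>UNIV. (l - c $ i) * G i p + (l + c $ i) * K i p)"

definition Hv :: "real^'d \<Rightarrow> real^'m" where "Hv p = (\<chi> i. H i p)"

definition U :: "((real^'d) \<times> (real^'m)) set" where "U = {w. \<forall>i. \<bar>snd w $ i\<bar> < l}"

abbreviation g :: "real^'d \<Rightarrow> (real^'d) \<times> (real^'m)" where "g p \<equiv> (p, Hv p)"

abbreviation \<Psi> :: "real^'d \<Rightarrow> real" where "\<Psi> p \<equiv> l * Q p + l / 2 * (norm p)\<^sup>2"

abbreviation f :: "(real^'d) \<times> (real^'m) \<Rightarrow> real^'d \<Rightarrow> real" where "f w p \<equiv> g p \<bullet> w - \<Psi> p"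

lemma N_eq: "N c p = l * Q p - Hv p \<bullet> c"
  unfolding N_def Q_def Hv_def inner_vec_def sum_distrib_left sum_subtractf[symmetric]
  by (rule sum.cong) (simp_all add: H algebra_simps)

lemma f_eq: "f (z, c) p = p \<bullet> z - N c p - l / 2 * (norm p)\<^sup>2"
  by (simp add: N_eq)

lemma Q_nonneg: "Q p \<ge> 0"
  unfolding Q_def using G(2) K(2) by (intro sum_nonneg add_nonneg_nonneg) auto

lemma N_bounds:
  assumes "(z, c) \<in> U"
  shows "0 \<le> N c p" "N c p \<le> 2 * l * Q p"
proof -
  have c: "\<bar>c $ i\<bar> < l" for i using assms by (simp add: U_def)
  have i: "- l < c $ i" "c $ i < l" for i using c[of i] by linarith+
  have "0 \<le> (l - c $ i) * G i p" "0 \<le> (l + c $ i) * K i p" for i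
    using i[of i] G(2)[of i p] K(2)[of i p] by (auto intro!: mult_nonneg_nonneg)
  then show "0 \<le> N c p" unfolding N_def by (intro sum_nonneg add_nonneg_nonneg)
  have "(l - c $ i) * G i p \<le> 2 * l * G i p" "(l + c $ i) * K i p \<le> 2 * l * K i p" for i
    using i[of i] G(2)[of i p] K(2)[of i p] by (auto intro!: mult_right_mono)
  then show "N c p \<le> 2 * l * Q p"
    unfolding N_def Q_def sum_distrib_left
    by (intro sum_mono) (simp add: distrib_left add_mono)
qed

lemma N_midpoint:
  assumes "(z, c) \<in> U"
  shows "N c ((1/2) *\<^sub>R (p + q)) \<le> (N c p + N c q) / 2"
proof -
  have c: "\<bar>c $ i\<bar> < l" for i using assms by (simp add: U_def)
  have mid: "F ((1/2) *\<^sub>R (p + q)) \<le> (F p + F q) / 2" if "convex_on UNIV F" for F :: "real^'d \<Rightarrow> real"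
    using convex_onD[OF that, of "1/2" p q] by (simp add: scaleR_add_right add_divide_distrib)
  have 1: "(l - c $ i) * G i ((1/2) *\<^sub>R (p + q)) + (l + c $ i) * K i ((1/2) *\<^sub>R (p + q))
     \<le> (l - c $ i) * ((G i p + G i q) / 2) + (l + c $ i) * ((K i p + K i q) / 2)" for i
    using c[of i] by (intro add_mono mult_left_mono mid G K) auto
  have "N c ((1/2) *\<^sub>R (p + q)) \<le> (\<Sum>i\<in>UNIV. (l - c $ i) * ((G i p + G i q) / 2) + (l + c $ i) * ((K i p + K i q) / 2))"
    unfolding N_def by (intro sum_mono 1)
  also have "\<dots> = (N c p + N c q) / 2"
    unfolding N_def sum.distrib[symmetric] sum_divide_distrib by (rule sum.cong) (simp_all add: field_simps)
  finally show ?thesis .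
qed

lemma continuous_on_G: "continuous_on UNIV (G i)" and continuous_on_K: "continuous_on UNIV (K i)"
  using G(1) K(1) by (auto intro: convex_on_continuous)

lemma continuous_on_Q: "continuous_on UNIV Q"
  unfolding Q_def by (intro continuous_intros continuous_on_G continuous_on_K)

lemma continuous_on_H: "continuous_on UNIV (H i)"
proof -
  have "H i = (\<lambda>p. G i p - K i p)" by (rule ext) (rule H)
  then show ?thesis by (simp only:) (intro continuous_intros continuous_on_G continuous_on_K)
qed

lemma continuous_on_Hv: "continuous_on UNIV Hv"
  unfolding Hv_def by (intro continuous_intros continuous_on_H)

text \<open>The parameter is the pair \<open>(z, c)\<close>, so Danskin's gradient consists of the
  maximiser \<open>p\<close>, which is the spatial gradient, and of the vector of all
  \<open>H i p\<close>. The strong concavity is due to the quadratic term alone.\<close>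

sublocale strongly_concave_family g \<Psi> U l "2 * l * Q 0" f
proof
  show "f w p = g p \<bullet> w - \<Psi> p" for w p ..
  have "open {w. \<bar>snd w $ i\<bar> < l}" for i
    by (intro open_Collect_less continuous_intros)
  then have "open (\<Inter>i. {w :: (real^'d) \<times> (real^'m). \<bar>snd w $ i\<bar> < l})" by (intro open_INT) auto
  moreover have "U = (\<Inter>i. {w. \<bar>snd w $ i\<bar> < l})" by (auto simp: U_def)
  ultimately show "open U" by simp
  show "continuous_on UNIV g" by (intro continuous_intros continuous_on_Hv)
  show "continuous_on UNIV \<Psi>" by (intro continuous_intros continuous_on_Q)
  show "l > 0" by (rule l)
  show "2 * l * Q 0 \<ge> 0" using l Q_nonneg by simp
  fix w :: "(real^'d) \<times> (real^'m)" and p q assume "w \<in> U"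
  then obtain z c where w: "w = (z, c)" "(z, c) \<in> U" by (cases w) auto
  show "(f w p + f w q) / 2 + l / 8 * (norm (p - q))\<^sup>2 \<le> f w ((1/2) *\<^sub>R (p + q))"
  proof -
    have lin: "((1/2) *\<^sub>R (p + q)) \<bullet> z = (p \<bullet> z + q \<bullet> z) / 2" by (simp add: inner_add_left)
    have sq: "l / 2 * (norm ((1/2) *\<^sub>R (p + q)))\<^sup>2
       = l / 2 * (((norm p)\<^sup>2 + (norm q)\<^sup>2) / 2 - (norm (p - q))\<^sup>2 / 4)"
      by (simp only: midpoint_norm_square)
    have "(f w p + f w q) / 2 + l / 8 * (norm (p - q))\<^sup>2
       = (p \<bullet> z + q \<bullet> z) / 2 - (N c p + N c q) / 2 - l / 2 * (((norm p)\<^sup>2 + (norm q)\<^sup>2) / 2 - (norm (p - q))\<^sup>2 / 4)"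
      unfolding w f_eq by (simp add: field_simps)
    moreover have "f w ((1/2) *\<^sub>R (p + q)) = (p \<bullet> z + q \<bullet> z) / 2 - N c ((1/2) *\<^sub>R (p + q))
       - l / 2 * (((norm p)\<^sup>2 + (norm q)\<^sup>2) / 2 - (norm (p - q))\<^sup>2 / 4)"
      using f_eq[where z = z and c = c and p = "(1/2) *\<^sub>R (p + q)"] unfolding w lin sq .
    ultimately show ?thesis using N_midpoint[OF w(2), of p q] by linarith
  qed
  show "f w p \<le> norm p * norm w - l / 2 * (norm p)\<^sup>2"
  proof -
    have "p \<bullet> z \<le> norm p * norm z" by (rule norm_cauchy_schwarz)
    also have "\<dots> \<le> norm p * norm w"
      using norm_fst_le[of z c] by (intro mult_left_mono) (auto simp: w)
    finally show ?thesis using N_bounds(1)[OF w(2), of p] unfolding w f_eq by linarith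
  qed
  show "- (2 * l * Q 0) \<le> f w 0"
    using N_bounds(2)[OF w(2), of 0] unfolding w f_eq by simp
qed

definition \<phi> :: "real^'d \<Rightarrow> real^'m \<Rightarrow> real" where "\<phi> z c = f (z, c) (P (z, c))"

lemma phi_ge: "(z, c) \<in> U \<Longrightarrow> p \<bullet> z - N c p - l / 2 * (norm p)\<^sup>2 \<le> \<phi> z c"
  using P_max[of "(z, c)" p] unfolding \<phi>_def f_eq by simp

lemma phi_zero: "(0, c) \<in> U \<Longrightarrow> \<phi> 0 c \<le> 0"
proof -
  assume "(0, c) \<in> U"
  from N_bounds(1)[OF this, of "P (0, c)"] have "0 \<le> N c (P (0, c))" .
  moreover have "0 \<le> l / 2 * (norm (P (0, c)))\<^sup>2" using l by simp
  ultimately show ?thesis unfolding \<phi>_def f_eq inner_zero_right by linarith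
qed

text \<open>By the chain rule \<open>\<phi> z (B t - D t)\<close> has time derivative
  \<open>Hv p \<bullet> (B' t - D' t)\<close>, the difference of the Hamiltonians at its own spatial
  gradient \<open>p\<close>. The derivatives of the paths therefore leave no trace in the estimate,
  and on the diagonal \<open>\<phi>\<close> is nonpositive.\<close>

lemma path_comparison:
  assumes T: "T > 0"
    and B: "\<And>t. t \<in> {0..T} \<Longrightarrow> (B has_vector_derivative B' t) (at t within {0..T})" "continuous_on {0..T} B'" "B 0 = 0"
    and D: "\<And>t. t \<in> {0..T} \<Longrightarrow> (D has_vector_derivative D' t) (at t within {0..T})" "continuous_on {0..T} D'" "D 0 = 0"
    and small: "\<And>t i. t \<in> {0..T} \<Longrightarrow> \<bar>(B t - D t) $ i\<bar> < l"
    and u: "hj_solution T (path_hamiltonian H B') u0 u"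
    and v: "hj_solution T (path_hamiltonian H D') v0 v"
    and init: "\<And>x y. u0 x - v0 y - \<phi> (x - y) 0 \<le> A"
    and t: "t \<in> {0..T}"
  shows "u (x, t) - v (x, t) \<le> A"
proof -
  define c where "c = (\<lambda>t. B t - D t)"
  have cU: "(z, c t) \<in> U" if "t \<in> {0..T}" for z t using small[OF that] by (simp add: U_def c_def)
  have c0: "c 0 = 0" using B D by (simp add: c_def)
  have ham: "path_hamiltonian H B' p t - path_hamiltonian H D' p t = Hv p \<bullet> (B' t - D' t)" for p t
    unfolding path_hamiltonian_def Hv_def inner_vec_def
    by (simp add: sum_subtractf[symmetric] algebra_simps)
  have c_cont: "continuous_on {0..T} c"
    unfolding c_def continuous_on_eq_continuous_within
    using has_vector_derivative_continuous[OF B(1)] has_vector_derivative_continuous[OF D(1)]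
    by (blast intro: continuous_diff)
  have zc_cont: "continuous_on (slab T) (\<lambda>w :: (real^'d) \<times> real. (fst w, c (snd w)))"
    by (intro continuous_intros continuous_on_compose2[OF c_cont]) auto
  have "u (x, t) - v (x, t) - \<phi> (x - x) (c t) \<le> A"
  proof (rule doubling[where u = u and v = v and p = "\<lambda>z t. P (z, c t)" and m = "2 * l * Sup (Q ` cball 0 1) + l / 2", OF T _ _ _ _
      continuous_on_path_hamiltonian[of H, OF continuous_on_H B(2)] continuous_on_path_hamiltonian[of H, OF continuous_on_H D(2)]])
    fix z :: "real^'d" and s :: real assume s: "0 < s" "s < T"
    then have s': "s \<in> {0..T}" by simp
    have at: "at s within {0..T} = at s" using s by (intro at_within_interior) auto
    have "(c has_vector_derivative (B' s - D' s)) (at s)"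
      unfolding c_def using B(1)[OF s'] D(1)[OF s'] by (auto simp: at intro!: derivative_intros)
    then have "(c has_derivative (\<lambda>h. h *\<^sub>R (B' s - D' s))) (at (snd (z, s)))"
      by (simp add: has_vector_derivative_def)
    from has_derivative_compose[OF has_derivative_snd[OF has_derivative_ident] this]
    have "((\<lambda>w. (fst w, c (snd w))) has_derivative (\<lambda>h. (fst h, snd h *\<^sub>R (B' s - D' s)))) (at (z, s))"
      by (intro has_derivative_Pair has_derivative_fst has_derivative_ident) simp
    moreover have "((\<lambda>w. f w (P w)) has_derivative (\<lambda>h. h \<bullet> g (P (z, c s)))) (at (fst (z, s), c (snd (z, s))))"
      using GDERIV_max[OF cU[OF s'], of z] by (simp add: gderiv_def)
    ultimately have "((\<lambda>w. \<phi> (fst w) (c (snd w))) has_derivative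
        (\<lambda>h. (fst h, snd h *\<^sub>R (B' s - D' s)) \<bullet> g (P (z, c s)))) (at (z, s))"
      unfolding \<phi>_def by (rule has_derivative_compose)
    then show "GDERIV (\<lambda>(z, t). \<phi> z (c t)) (z, s) :> (P (z, c s), path_hamiltonian H B' (P (z, c s)) s - path_hamiltonian H D' (P (z, c s)) s)"
      unfolding gderiv_def case_prod_beta ham
      by (rule has_derivative_eq_rhs) (simp add: fun_eq_iff inner_prod_def inner_commute)
  next
    show "continuous_on (slab T) (\<lambda>(z, t). \<phi> z (c t))"
      unfolding case_prod_beta \<phi>_def
      by (rule continuous_on_compose2[OF continuous_on_max zc_cont]) (use cU in auto)
    show "continuous_on (slab T) (\<lambda>(z, t). P (z, c t))"
      unfolding case_prod_beta
      by (rule continuous_on_compose2[OF continuous_on_P zc_cont]) (use cU in auto)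
  next
    fix z :: "real^'d" and s assume s: "s \<in> {0..T}"
    \<comment> \<open>Choosing \<open>p = sgn z\<close> in the supremum gives growth
      \<open>norm z\<close>, up to the values of \<open>Q\<close> on the unit ball.\<close>
    have n: "norm (sgn z) \<le> 1" by (simp add: norm_sgn)
    have "compact (Q ` cball 0 1)"
      by (intro compact_continuous_image continuous_on_subset[OF continuous_on_Q]) auto
    then have "Q (sgn z) \<le> Sup (Q ` cball 0 1)"
      using n by (intro cSup_upper) (auto intro: bounded_imp_bdd_above compact_imp_bounded)
    then have "2 * l * Q (sgn z) \<le> 2 * l * Sup (Q ` cball 0 1)" using l by (intro mult_left_mono) auto
    moreover have "sgn z \<bullet> z = norm z"
      by (cases "z = 0") (simp_all add: sgn_div_norm dot_square_norm power2_eq_square)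
    moreover have "l / 2 * (norm (sgn z))\<^sup>2 \<le> l / 2 * 1"
      using l n by (intro mult_left_mono) (auto simp: power_le_one)
    moreover note phi_ge[OF cU[OF s], of "sgn z" z] N_bounds(2)[OF cU[OF s], of "sgn z" ]
    ultimately show "norm z - (2 * l * Sup (Q ` cball 0 1) + l / 2) \<le> \<phi> z (c s)" by linarith
  next
    fix x y show "u (x, 0) - v (y, 0) - \<phi> (x - y) (c 0) \<le> A"
      using init[of x y] u v by (simp add: hj_solution_def c0)
  qed (use u v t in \<open>auto simp: hj_solution_def\<close>)
  moreover have "\<phi> 0 (c t) \<le> 0" using phi_zero cU[OF t] by simp
  ultimately show ?thesis by simp
qed

end

section \<open>Differences of convex functions admit the extension\<close>

text \<open>Uniform continuity in the path at the fixed datum \<open>u0\<close>: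
  \<open>\<epsilon>\<close> measures the perturbation of the data and \<open>e\<close> the loss due
  to the paths. One inequality suffices because the two solutions can be exchanged.\<close>

definition path_stable where
  "path_stable T H u0 l e \<longleftrightarrow> (\<forall>B D va wa v w \<epsilon> z. B \<in> C1_paths T \<and> D \<in> C1_paths T \<and>
     (\<forall>t\<in>{0..T}. norm (B t - D t) < l) \<and> (\<forall>x. \<bar>va x - u0 x\<bar> \<le> \<epsilon>) \<and> (\<forall>x. \<bar>wa x - u0 x\<bar> \<le> \<epsilon>) \<and>
     viscosity_solution T H B va v \<and> viscosity_solution T H D wa w \<and> z \<in> slab T \<longrightarrow> v z - w z \<le> 2 * \<epsilon> + e)"

lemma path_stableD:
  assumes "path_stable T H u0 l e" "B \<in> C1_paths T" "D \<in> C1_paths T"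
    and n: "\<And>t. t \<in> {0..T} \<Longrightarrow> norm (B t - D t) < l"
    and "\<And>x. \<bar>va x - u0 x\<bar> \<le> \<epsilon>" "\<And>x. \<bar>wa x - u0 x\<bar> \<le> \<epsilon>"
    "viscosity_solution T H B va v" "viscosity_solution T H D wa w" "z \<in> slab T"
  shows "\<bar>v z - w z\<bar> \<le> 2 * \<epsilon> + e"
proof -
  note st = assms(1)[unfolded path_stable_def]
  have "v z - w z \<le> 2 * \<epsilon> + e"
    by (rule st[rule_format, where B = B and D = D and va = va and wa = wa and v = v and w = w])
       (use assms in blast)
  moreover have "norm (D t - B t) < l" if "t \<in> {0..T}" for t using n[OF that] by (simp add: norm_minus_commute)
  then have "w z - v z \<le> 2 * \<epsilon> + e"
    by (intro st[rule_format, where B = D and D = B and va = wa and wa = va and v = w and w = v])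
       (use assms in blast)
  ultimately show ?thesis by simp
qed

text \<open>It remains to compare at time 0, where no path enters: for small \<open>l\<close> the
  function \<open>\<phi> z 0\<close> is at least \<open>- e / 2\<close> everywhere and at least
  \<open>2 * M\<close> outside the radius given by the modulus of continuity of
  \<open>u0\<close>.\<close>

lemma dc_stability:
  fixes H :: "'m::finite \<Rightarrow> real^'d \<Rightarrow> real"
  assumes T: "T > 0" and H: "\<And>i. difference_of_convex (H i)" and u0: "u0 \<in> BUC UNIV" and e: "e > 0"
  obtains l where "l > 0" "path_stable T H u0 l e"
proof -
  have "\<forall>i. \<exists>G K. convex_on UNIV G \<and> convex_on UNIV K \<and> (\<forall>p. G p \<ge> 0) \<and> (\<forall>p. K p \<ge> 0) \<and> (\<forall>p. H i p = G p - K p)"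
    using difference_of_convex_nonneg[OF H] by metis
  then obtain G K where GK: "\<And>i. convex_on UNIV (G i)" "\<And>i. convex_on UNIV (K i)" "\<And>i p. G i p \<ge> 0" "\<And>i p. K i p \<ge> 0"
     "\<And>i p. H i p = G i p - K i p" by metis
  have dc: "dc_hamiltonian H G K l" if "l > 0" for l
    using GK that by unfold_locales auto
  obtain M where M: "\<And>x. \<bar>u0 x\<bar> \<le> M" using u0 unfolding BUC_def bounded_iff by auto
  have M0: "M \<ge> 0" using M[of 0] by linarith
  obtain r where r: "r > 0" "\<And>x y. dist y x < r \<Longrightarrow> dist (u0 y) (u0 x) < e / 2"
  proof -
    have "uniformly_continuous_on UNIV u0" using u0 by (simp add: BUC_def)
    then show thesis
      using half_gt_zero[OF e] that unfolding uniformly_continuous_on_def by (metis UNIV_I)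
  qed
  \<comment> \<open>The slope at which \<open>p \<bullet> (x - y)\<close> reaches
    \<open>2 * M + 1\<close> at distance \<open>r\<close>; the extra 1 pays for the terms weighted
    by \<open>l\<close>.\<close>
  define \<rho> where "\<rho> = (2 * M + 1) / r"
  have \<rho>: "\<rho> > 0" using M0 r by (simp add: \<rho>_def)
  let ?Q = "\<lambda>p. \<Sum>i\<in>UNIV. G i p + K i p"
  have "continuous_on UNIV ?Q"
    using GK(1,2) by (intro continuous_intros) (auto intro: convex_on_continuous)
  then have "bounded (?Q ` cball 0 \<rho>)"
    by (intro compact_imp_bounded compact_continuous_image) (auto intro: continuous_on_subset)
  then obtain q where q: "\<And>p. norm p \<le> \<rho> \<Longrightarrow> \<bar>?Q p\<bar> \<le> q" unfolding bounded_iff by fastforce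
  have q0: "q \<ge> 0" using q[of 0] \<rho> abs_ge_zero[of "?Q 0"] by (simp only: norm_zero) linarith
  \<comment> \<open>The first entry gives \<open>l * (q + \<rho>\<^sup>2 / 2) \<le> 1\<close>, for
    distant points; the second gives \<open>l * q \<le> e / 2\<close>, for near ones.\<close>
  define l where "l = min (1 / (q + \<rho>\<^sup>2 / 2 + 1)) (e / (2 * (q + 1)))"
  have den: "q + \<rho>\<^sup>2 / 2 + 1 > 0" using q0 by (simp add: add_nonneg_pos)
  have l: "l > 0" using den e q0 by (simp add: l_def)
  have l1: "l * (q + \<rho>\<^sup>2 / 2) \<le> 1"
  proof -
    have "l * (q + \<rho>\<^sup>2 / 2 + 1) \<le> 1" using den by (simp add: l_def pos_le_divide_eq[symmetric])
    then show ?thesis using l by (simp add: distrib_left)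
  qed
  have l2: "l * q \<le> e / 2"
  proof -
    have "l * (2 * (q + 1)) \<le> e" using q0 unfolding l_def by (subst pos_le_divide_eq[symmetric]) auto
    then show ?thesis using l by (simp add: algebra_simps)
  qed
  interpret dc_hamiltonian H G K l by (rule dc[OF l])
  show ?thesis
  proof (rule that[OF l], unfold path_stable_def, intro allI impI, elim conjE)
    fix B D :: "real \<Rightarrow> real^'m" and va wa v w \<epsilon> and z :: "(real^'d) \<times> real"
    assume B: "B \<in> C1_paths T" and D: "D \<in> C1_paths T" and BD: "\<forall>t\<in>{0..T}. norm (B t - D t) < l"
      and va: "\<forall>x. \<bar>va x - u0 x\<bar> \<le> \<epsilon>" and wa: "\<forall>x. \<bar>wa x - u0 x\<bar> \<le> \<epsilon>"
      and v: "viscosity_solution T H B va v" and w: "viscosity_solution T H D wa w" and z: "z \<in> slab T"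
    obtain B' where B': "\<And>t. t \<in> {0..T} \<Longrightarrow> (B has_vector_derivative B' t) (at t within {0..T})"
      "continuous_on {0..T} B'" "B 0 = 0" using C1_paths_derivative[OF B] by metis
    obtain D' where D': "\<And>t. t \<in> {0..T} \<Longrightarrow> (D has_vector_derivative D' t) (at t within {0..T})"
      "continuous_on {0..T} D'" "D 0 = 0" using C1_paths_derivative[OF D] by metis
    have vs: "hj_solution T (path_hamiltonian H B') va v" using v viscosity_solution_iff[OF B'(1)] by blast
    have ws: "hj_solution T (path_hamiltonian H D') wa w" using w viscosity_solution_iff[OF D'(1)] by blast
    have small: "\<bar>(B t - D t) $ i\<bar> < l" if "t \<in> {0..T}" for t i
      using component_le_norm_cart[of "B t - D t" i] bspec[OF BD that] by linarith
    obtain x t where [simp]: "z = (x, t)" by (cases z)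
    have zU: "(y, 0) \<in> U" for y using l by (simp add: U_def)
    have init: "va x - wa y - \<phi> (x - y) 0 \<le> 2 * \<epsilon> + e" for x y
    proof (cases "dist y x < r")
      case True
      have "- (l * Q 0) \<le> \<phi> (x - y) 0"
        using phi_ge[OF zU[of "x - y"], of 0] by (simp add: N_eq)
      moreover have "l * Q 0 \<le> l * q" using q[of 0] \<rho> l by (intro mult_left_mono) (auto simp: Q_def)
      moreover have "u0 x - u0 y < e / 2" using r(2)[OF True] unfolding dist_real_def by linarith
      ultimately show ?thesis using va[rule_format, of x] wa[rule_format, of y] l2 by linarith
    next
      case False
      define p where "p = \<rho> *\<^sub>R sgn (x - y)"
      have pn: "norm p \<le> \<rho>" using \<rho> by (simp add: p_def norm_sgn)
      have n: "norm (x - y) \<ge> r" using False by (simp add: dist_norm norm_minus_commute)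
      have ip: "p \<bullet> (x - y) = \<rho> * norm (x - y)"
        by (cases "x - y = 0") (simp_all add: p_def sgn_div_norm dot_square_norm power2_eq_square)
      have "\<rho> * r \<le> \<rho> * norm (x - y)" using n \<rho> by (intro mult_left_mono) auto
      moreover have "\<rho> * r = 2 * M + 1" using r(1) by (simp add: \<rho>_def)
      ultimately have "2 * M + 1 \<le> p \<bullet> (x - y)" using ip by linarith
      moreover have "l * Q p \<le> l * q" using q[OF pn] l by (intro mult_left_mono) (auto simp: Q_def)
      moreover have "l / 2 * (norm p)\<^sup>2 \<le> l / 2 * \<rho>\<^sup>2"
        using pn l by (intro mult_left_mono power_mono) auto
      moreover have "p \<bullet> (x - y) - l * Q p - l / 2 * (norm p)\<^sup>2 \<le> \<phi> (x - y) 0"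
        using phi_ge[OF zU[of "x - y"], of p] by (simp add: N_eq)
      moreover have "l * q + l / 2 * \<rho>\<^sup>2 \<le> 1" using l1 by (simp add: distrib_left)
      ultimately have "\<phi> (x - y) 0 \<ge> 2 * M" by linarith
      then show ?thesis using va[rule_format, of x] wa[rule_format, of y] M[of x] M[of y] e by linarith
    qed
    have "v (x, t) - w (x, t) \<le> 2 * \<epsilon> + e"
      by (rule path_comparison[where u = v and v = w, OF T B' D' small vs ws init]) (use z in auto)
    then show "v z - w z \<le> 2 * \<epsilon> + e" by simp
  qed
qed

text \<open>Weierstrass approximation; subtracting \<open>P 0\<close> restores the initial value and
  costs at most another \<open>e / 2\<close>.\<close>

lemma C1_paths_dense:
  fixes B :: "real \<Rightarrow> real^'m::finite"
  assumes T: "T > 0" and B: "B \<in> continuous_paths T" and e: "e > 0"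
  shows "\<exists>D\<in>C1_paths T. \<forall>t\<in>{0..T}. norm (D t - B t) < e"
proof -
  have "continuous_on {0..T} B" "B 0 = 0" using B by (auto simp: continuous_paths_def)
  then obtain P where P: "polynomial_function P" "\<And>t. t \<in> {0..T} \<Longrightarrow> norm (B t - P t) < e / 2"
    using Stone_Weierstrass_polynomial_function[of "{0..T}" B "e / 2"] e by auto
  obtain P' where P': "polynomial_function P'" "\<And>t. (P has_vector_derivative (P' t)) (at t)"
    using has_vector_derivative_polynomial_function[OF P(1)] by blast
  have "((\<lambda>t. P t - P 0) has_vector_derivative P' t) (at t within {0..T})" for t
    using has_vector_derivative_at_within[OF P'(2)] by (auto intro!: derivative_eq_intros)
  moreover have "continuous_on {0..T} P'" using P'(1) by (rule continuous_on_polymonial_function)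
  ultimately have "(\<lambda>t. P t - P 0) \<in> C1_paths T" by (auto simp: C1_paths_def)
  moreover have "norm (P t - P 0 - B t) < e" if "t \<in> {0..T}" for t
  proof -
    have "norm (P 0) < e / 2" using P(2)[of 0] T \<open>B 0 = 0\<close> by simp
    moreover have "norm (P t - P 0 - B t) \<le> norm (B t - P t) + norm (P 0)"
      using norm_triangle_ineq4[of "P t - B t" "P 0"] by (simp add: norm_minus_commute algebra_simps)
    ultimately show ?thesis using P(2)[OF that] by linarith
  qed
  ultimately show ?thesis by (intro bexI[of _ "\<lambda>t. P t - P 0"] ballI)
qed

text \<open>The limit is built along one sequence \<open>Dn\<close> of smooth paths. Any other
  approximating sequence is eventually within the stability radius of a fixed \<open>Dn N\<close>,
  so it has the same limit.\<close>

lemma dc_imp_has_unique_extension: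
  fixes H :: "'m::finite \<Rightarrow> real^'d \<Rightarrow> real"
  assumes T: "T > 0" and cont: "\<And>i. continuous_on UNIV (H i)" and dc: "\<And>i. difference_of_convex (H i)"
  shows "has_unique_extension T H"
  unfolding has_unique_extension_def
proof (intro ballI)
  fix B :: "real \<Rightarrow> real^'m" and u0 :: "real^'d \<Rightarrow> real"
  assume B: "B \<in> continuous_paths T" and u0: "u0 \<in> BUC UNIV"
  let ?S = "slab T :: ((real^'d) \<times> real) set"
  let ?conv = "\<lambda>u. \<forall>Bn u0n. (\<forall>n. Bn n \<in> C1_paths T) \<and> uniform_limit {0..T} Bn B sequentially \<and>
                  (\<forall>n. u0n n \<in> BUC UNIV) \<and> uniform_limit UNIV u0n u0 sequentially \<longrightarrow>
           uniform_limit ?S (\<lambda>n. solution_operator T H (Bn n) (u0n n)) u sequentially"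
  have "\<exists>D\<in>C1_paths T. \<forall>t\<in>{0..T}. norm (D t - B t) < inverse (real (Suc n))" for n
    by (rule C1_paths_dense[OF T B]) simp
  then obtain Dn where Dn: "\<And>n. Dn n \<in> C1_paths T" "\<And>n t. t \<in> {0..T} \<Longrightarrow> norm (Dn n t - B t) < inverse (real (Suc n))"
    by metis
  have small: "\<exists>N. \<forall>n\<ge>N. inverse (real (Suc n)) < e" if "e > 0" for e
    using order_tendstoD(2)[OF LIMSEQ_inverse_real_of_nat that] by (simp add: eventually_sequentially)
  have Dn_lim: "uniform_limit {0..T} Dn B sequentially"
  proof (rule uniform_limitI)
    fix e :: real assume "e > 0"
    from small[OF this] obtain N where "\<And>n. n \<ge> N \<Longrightarrow> inverse (real (Suc n)) < e" by blast
    then show "\<forall>\<^sub>F n in sequentially. \<forall>t\<in>{0..T}. dist (Dn n t) (B t) < e"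
      unfolding eventually_sequentially dist_norm using Dn(2) by (meson less_trans)
  qed
  define V where "V = (\<lambda>n. solution_operator T H (Dn n) u0)"
  have V: "viscosity_solution T H (Dn n) u0 (V n)" for n
    unfolding V_def by (rule viscosity_solution_operator[of T H, OF T cont Dn(1) u0])
  have "uniformly_Cauchy_on ?S V"
    unfolding uniformly_Cauchy_on_def
  proof (intro allI impI)
    fix e :: real assume e: "e > 0"
    obtain l where l: "l > 0" and st: "path_stable T H u0 l (e / 2)"
      using dc_stability[of T H, OF T dc u0 half_gt_zero[OF e]] .
    obtain N where N: "\<And>n. n \<ge> N \<Longrightarrow> inverse (real (Suc n)) < l / 2" using small[of "l / 2"] l by auto
    show "\<exists>N. \<forall>z\<in>?S. \<forall>m\<ge>N. \<forall>n\<ge>N. dist (V m z) (V n z) < e"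
    proof (intro exI[of _ N] ballI allI impI)
      fix z :: "(real^'d) \<times> real" and m n assume z: "z \<in> ?S" and mn: "m \<ge> N" "n \<ge> N"
      have "norm (Dn m t - Dn n t) < l" if "t \<in> {0..T}" for t
        using norm_triangle_ineq4[of "Dn m t - B t" "Dn n t - B t"] Dn(2)[OF that, of m] Dn(2)[OF that, of n]
          N[OF mn(1)] N[OF mn(2)] by simp
      from path_stableD[where \<epsilon> = 0 and va = u0 and wa = u0 and v = "V m" and w = "V n", OF st Dn(1) Dn(1) this _ _ V V z]
      show "dist (V m z) (V n z) < e" using e by (simp add: dist_real_def)
    qed
  qed
  from Cauchy_uniformly_convergent[OF this] obtain U where U: "uniform_limit ?S V U sequentially"
    unfolding uniformly_convergent_on_def by blast
  have conv: "?conv (restrict U ?S)"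
  proof (intro allI impI, elim conjE, rule uniform_limitI)
    fix Bn u0n and e :: real
    assume Bn: "\<forall>n. Bn n \<in> C1_paths T" "uniform_limit {0..T} Bn B sequentially"
      and u0n: "\<forall>n. u0n n \<in> BUC UNIV" "uniform_limit UNIV u0n u0 sequentially" and e: "e > 0"
    have e8: "e / 8 > 0" using e by simp
    obtain l where l: "l > 0" and st: "path_stable T H u0 l (e / 8)"
      using dc_stability[of T H, OF T dc u0 e8] .
    have "\<forall>\<^sub>F N in sequentially. (\<forall>z\<in>?S. dist (V N z) (U z) < e / 8) \<and> (\<forall>t\<in>{0..T}. dist (Dn N t) (B t) < l / 2)"
      by (intro eventually_conj uniform_limitD U Dn_lim) (use e l in auto)
    then obtain N where N: "\<And>z. z \<in> ?S \<Longrightarrow> dist (V N z) (U z) < e / 8" "\<And>t. t \<in> {0..T} \<Longrightarrow> dist (Dn N t) (B t) < l / 2"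
      using eventually_happens'[OF sequentially_bot] by blast
    have "\<forall>\<^sub>F n in sequentially. (\<forall>t\<in>{0..T}. dist (Bn n t) (B t) < l / 2) \<and> (\<forall>x\<in>UNIV. dist (u0n n x) (u0 x) < e / 8)"
      by (intro eventually_conj uniform_limitD Bn(2) u0n(2)) (use e l in auto)
    then show "\<forall>\<^sub>F n in sequentially. \<forall>z\<in>?S. dist (solution_operator T H (Bn n) (u0n n) z) (restrict U ?S z) < e"
    proof eventually_elim
      case (elim n)
      show ?case
      proof
        fix z :: "(real^'d) \<times> real" assume z: "z \<in> ?S"
        have vs: "viscosity_solution T H (Bn n) (u0n n) (solution_operator T H (Bn n) (u0n n))"
          using viscosity_solution_operator[of T H, OF T cont] Bn(1) u0n(1) by blast
        have near: "norm (Bn n t - Dn N t) < l" if "t \<in> {0..T}" for t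
        proof -
          have "dist (Bn n t) (Dn N t) \<le> dist (Bn n t) (B t) + dist (Dn N t) (B t)" by (rule dist_triangle2)
          then show ?thesis using elim N(2)[OF that] that by (fastforce simp: dist_norm)
        qed
        have d1: "\<bar>u0n n x - u0 x\<bar> \<le> e / 8" for x using elim by (auto simp: dist_real_def less_imp_le)
        have d2: "\<bar>u0 x - u0 x\<bar> \<le> e / 8" for x using e by simp
        have "\<bar>solution_operator T H (Bn n) (u0n n) z - V N z\<bar> \<le> 2 * (e / 8) + e / 8"
          by (rule path_stableD[where B = "Bn n" and D = "Dn N", OF st _ Dn(1) near d1 d2 vs V z]) (use Bn(1) in auto)
        moreover have "\<bar>V N z - U z\<bar> < e / 8" using N(1)[OF z] by (simp add: dist_real_def)
        ultimately have "\<bar>solution_operator T H (Bn n) (u0n n) z - U z\<bar> < e" using e by linarith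
        then show "dist (solution_operator T H (Bn n) (u0n n) z) (restrict U ?S z) < e"
          using z by (simp add: dist_real_def del: mem_Sigma_iff)
      qed
    qed
  qed
  show "\<exists>!u. u \<in> BUC ?S \<and> ?conv u"
  proof (rule ex1I[of _ "restrict U ?S"])
    have "restrict U ?S \<in> BUC ?S"
      using V by (intro BUC_uniform_limit[OF _ U]) (simp add: viscosity_solution_def)
    then show "restrict U ?S \<in> BUC ?S \<and> ?conv (restrict U ?S)" using conv by blast
  next
    \<comment> \<open>Uniqueness tests the convergence property with the single sequence
      \<open>Dn\<close> and constant data.\<close>
    fix u assume u: "u \<in> BUC ?S \<and> ?conv u"
    have "uniform_limit UNIV (\<lambda>n. u0) u0 sequentially" by (rule uniform_limit_const)
    with Dn(1) Dn_lim u0 have prem: "(\<forall>n. Dn n \<in> C1_paths T) \<and> uniform_limit {0..T} Dn B sequentially \<and>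
       (\<forall>n::nat. u0 \<in> BUC UNIV) \<and> uniform_limit UNIV (\<lambda>n. u0) u0 sequentially" by simp
    have ul: "uniform_limit ?S V u sequentially"
      unfolding V_def by (rule mp[OF spec[OF spec[OF conjunct2[OF u]]] prem])
    show "u = restrict U ?S"
    proof (rule extensionalityI[of _ ?S])
      show "u \<in> extensional ?S" using u by (simp add: BUC_def)
      show "u z = restrict U ?S z" if "z \<in> ?S" for z
        using LIMSEQ_unique[OF tendsto_uniform_limitI[OF ul that] tendsto_uniform_limitI[OF U that]] that by simp
    qed simp
  qed
qed

section \<open>The extension forces differences of convex functions\<close>

text \<open>
  Linear functions, transported by the equation, are barriers: comparing with them needs only
  the definition of a supersolution.
\<close>

lemma supersol_linear_barrier:
  fixes v :: "(real^'d) \<times> real \<Rightarrow> real"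
  assumes v: "supersol T F v" and cv: "continuous_on (slab T) v"
    and b: "\<And>t. t \<in> {0<..<T} \<Longrightarrow> (b has_real_derivative b' t) (at t)" "continuous_on {0<..<T} b'" "continuous_on {0..T} b"
    and F: "\<And>t. t \<in> {0<..<T} \<Longrightarrow> F p t = b' t"
    and s: "0 \<le> s" "s < T"
    and init: "\<And>x. norm x \<le> R \<Longrightarrow> p \<bullet> x + b s \<le> v (x, s)"
    and bdry: "\<And>x t. norm x = R \<Longrightarrow> s \<le> t \<Longrightarrow> t < T \<Longrightarrow> p \<bullet> x + b t \<le> v (x, t)"
    and x: "norm x \<le> R" and t: "s \<le> t" "t < T"
  shows "p \<bullet> x + b t \<le> v (x, t)"
proof (rule ccontr)
  assume neg: "\<not> ?thesis"
  define w where "w = (\<lambda>z. v z - p \<bullet> fst z - b (snd z))"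
  \<comment> \<open>The barrier \<open>\<eta> / (T - t)\<close> takes back only half of the negative
    value at \<open>(x, t)\<close>. It keeps the minimum away from the terminal time and makes the
    inequality there strict.\<close>
  define \<eta> where "\<eta> = - w (x, t) / 2 * (T - t)"
  have \<eta>: "\<eta> > 0" using neg t by (simp add: \<eta>_def w_def)
  have w_cont: "continuous_on (slab T) w"
    unfolding w_def by (intro continuous_intros cv continuous_on_compose2[OF b(3)]) auto
  have "compact (w ` (cball 0 R \<times> {0..T}))"
    by (intro compact_continuous_image continuous_on_subset[OF w_cont] compact_Times) auto
  then have "bounded (w ` (cball 0 R \<times> {0..T}))" by (rule compact_imp_bounded)
  then obtain M where M: "\<And>z. z \<in> cball 0 R \<times> {0..T} \<Longrightarrow> \<bar>w z\<bar> \<le> M" unfolding bounded_iff by auto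
  have M0: "M \<ge> 0" using M[of "(x, t)"] x t s by auto
  define \<delta> where "\<delta> = \<eta> / (M + 1)"
  have \<delta>: "\<delta> > 0" using \<eta> M0 by (simp add: \<delta>_def)
  define \<Theta> where "\<Theta> = (\<lambda>z. w z + \<eta> / (T - snd z))"
  have ref: "\<Theta> (x, t) < 0"
  proof -
    have "T - t \<noteq> 0" using t by simp
    then have "\<eta> / (T - t) = - w (x, t) / 2" unfolding \<eta>_def
      by (metis nonzero_mult_div_cancel_right)
    then show ?thesis using neg by (simp add: \<Theta>_def w_def)
  qed
  have early: "r < T - \<delta>" if neg: "\<Theta> (y, r) < 0" and "norm y \<le> R" "0 \<le> r" "r < T" for y r
  proof -
    have "\<bar>w (y, r)\<bar> \<le> M" using that by (intro M) auto
    then have "\<eta> / (T - r) < M + 1" using neg by (simp add: \<Theta>_def)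
    then have "\<eta> < (M + 1) * (T - r)" using that by (simp add: pos_divide_less_eq)
    then have "\<delta> < T - r" using M0 unfolding \<delta>_def by (simp add: pos_divide_less_eq mult.commute)
    then show ?thesis by simp
  qed
  let ?K = "cball (0 :: real^'d) R \<times> {s..T - \<delta>}"
  have "continuous_on ?K \<Theta>"
    unfolding \<Theta>_def using \<delta> s
    by (intro continuous_intros continuous_on_subset[OF w_cont]) auto
  moreover have xtK: "(x, t) \<in> ?K" using early[OF ref x] x t s by auto
  moreover have "compact ?K" by (intro compact_Times) auto
  ultimately obtain z0 where z0: "z0 \<in> ?K" "\<And>z. z \<in> ?K \<Longrightarrow> \<Theta> z0 \<le> \<Theta> z"
    using continuous_attains_inf[of ?K \<Theta>] by blast
  obtain y r where [simp]: "z0 = (y, r)" by (cases z0)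
  have y: "norm y \<le> R" and r: "s \<le> r" "r < T" using z0(1) \<delta> by auto
  have lt: "\<Theta> (y, r) < 0" using z0(2)[OF xtK] ref by simp
  have "\<eta> / (T - r) > 0" using \<eta> r by simp
  then have wneg: "w (y, r) < 0" using lt by (simp add: \<Theta>_def)
  have "r \<noteq> s" using init[OF y] wneg by (auto simp: w_def)
  then have r': "s < r" "r < T - \<delta>" using r early[OF lt y] s by auto
  have "norm y \<noteq> R" using bdry[OF _ r, of y] wneg by (auto simp: w_def)
  then have y': "norm y < R" using y by simp
  let ?Q = "open_slab T :: ((real^'d) \<times> real) set"
  have tf1: "C1_test_function ?Q (\<lambda>z. b (snd z) - \<eta> / (T - snd z)) (\<lambda>z. (0, b' (snd z) - \<eta> / (T - snd z)\<^sup>2))"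
  proof (rule C1_test_function_time)
    fix q assume "q \<in> {0<..<T}"
    then show "((\<lambda>q. b q - \<eta> / (T - q)) has_real_derivative b' q - \<eta> / (T - q)\<^sup>2) (at q)"
      using b(1) by (auto intro!: derivative_eq_intros simp: power2_eq_square)
  next
    show "continuous_on {0<..<T} (\<lambda>q. b' q - \<eta> / (T - q)\<^sup>2)"
      using b(2) by (intro continuous_intros) auto
  qed
  have tf2: "C1_test_function ?Q (\<lambda>z. p \<bullet> fst z) (\<lambda>z. (p, 0))"
    by (rule C1_test_function_space) (auto simp: gderiv_def inner_commute intro!: derivative_eq_intros)
  have "\<forall>\<^sub>F z in nhds (y, r). z \<in> ball 0 R \<times> {s<..<T - \<delta>}"
    using y' r' by (intro eventually_nhds_in_open open_Times) auto
  then have "\<forall>\<^sub>F z in nhds (y, r). v z - (p \<bullet> fst z + (b (snd z) - \<eta> / (T - snd z))) \<ge>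
     v (y, r) - (p \<bullet> fst (y, r) + (b (snd (y, r)) - \<eta> / (T - snd (y, r))))"
  proof eventually_elim
    case (elim z)
    then have "z \<in> ?K" by (cases z) auto
    from z0(2)[OF this] show ?case by (simp add: \<Theta>_def w_def)
  qed
  from supersolD[OF v C1_test_function_add[OF tf2 tf1] _ _ this]
  have "F p r \<le> b' r - \<eta> / (T - r)\<^sup>2" using r' s r by simp
  moreover have "\<eta> / (T - r)\<^sup>2 > 0" using \<eta> r by simp
  moreover have "F p r = b' r" using r' r s by (intro F) auto
  ultimately show False by linarith
qed

text \<open>A function that is constant in time forces the time derivative of every touching test
  function to have the right sign, already by looking backwards in time.\<close>

lemma hj_solution_zero:
  fixes u0 :: "real^'d \<Rightarrow> real"
  assumes u0: "u0 \<in> BUC UNIV" and T: "T > 0"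
  shows "hj_solution T (\<lambda>p t. 0) u0 (restrict (\<lambda>z. u0 (fst z)) (slab T))"
proof -
  let ?S = "slab T :: ((real^'d) \<times> real) set"
  let ?u = "\<lambda>z :: (real^'d) \<times> real. u0 (fst z)"
  have sub: "subsol T (\<lambda>p t. 0) (\<lambda>z. v (fst z))" for v :: "real^'d \<Rightarrow> real"
    unfolding subsol_def
  proof (intro allI impI, elim conjE)
    fix \<phi> D x t
    assume a: "C1_test_function (open_slab T) \<phi> D" "0 < t" "t < T"
      and e: "\<forall>\<^sub>F z in nhds (x, t). v (fst z) - \<phi> z \<le> v (fst (x, t)) - \<phi> (x, t)"
    have "GDERIV \<phi> (x, t) :> D (x, t)" using a by (auto simp: C1_test_function_def)
    from touching_directional_ge[where u = "\<lambda>z. v (fst z)", OF this e, of 0 "(0, - 1)"]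
    show "snd (D (x, t)) \<le> 0" by (simp add: inner_prod_def)
  qed
  have "supersol T (\<lambda>p t. 0) ?u"
    using sub[of "\<lambda>x. - u0 x"] by (simp add: supersol_iff_subsol_uminus)
  moreover have "restrict ?u ?S \<in> BUC ?S"
  proof (rule BUC_restrictI)
    have "?u ` ?S = range u0" using T by force
    then show "bounded (?u ` ?S)" using u0 by (simp add: BUC_def)
    have "uniformly_continuous_on ?S (fst :: (real^'d) \<times> real \<Rightarrow> real^'d)"
      unfolding uniformly_continuous_on_def by (meson dist_fst_le le_less_trans)
    moreover have "uniformly_continuous_on (fst ` ?S) u0"
      using u0 unfolding BUC_def uniformly_continuous_on_def by blast
    ultimately show "uniformly_continuous_on ?S ?u" by (rule uniformly_continuous_on_compose)
  qed
  ultimately show ?thesis using T sub[of u0]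
    by (auto simp: hj_solution_def elim!: subsol_cong supersol_cong)
qed

text \<open>Constant sequences identify the extension at the zero path as \<open>u0\<close>. Were
  there arbitrarily small paths with a deviation above 1, they would form a sequence violating
  uniform convergence.\<close>

lemma has_unique_extension_imp_close:
  fixes H :: "'m::finite \<Rightarrow> real^'d \<Rightarrow> real"
  assumes T: "T > 0" and cont: "\<And>i. continuous_on UNIV (H i)" and ext: "has_unique_extension T H"
    and u0: "u0 \<in> BUC UNIV"
  obtains e where "e > 0" "\<And>B z. B \<in> C1_paths T \<Longrightarrow> (\<And>t. t \<in> {0..T} \<Longrightarrow> norm (B t) < e) \<Longrightarrow>
     z \<in> slab T \<Longrightarrow> \<bar>solution_operator T H B u0 z - u0 (fst z)\<bar> \<le> 1"
proof -
  let ?S = "slab T :: ((real^'d) \<times> real) set"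
  have "(\<lambda>t. 0) \<in> continuous_paths T" by (simp add: continuous_paths_def)
  then obtain u where u: "\<And>Bn u0n. (\<And>n. Bn n \<in> C1_paths T) \<Longrightarrow> uniform_limit {0..T} Bn (\<lambda>t. 0) sequentially \<Longrightarrow>
                  (\<And>n. u0n n \<in> BUC UNIV) \<Longrightarrow> uniform_limit UNIV u0n u0 sequentially \<Longrightarrow>
           uniform_limit ?S (\<lambda>n. solution_operator T H (Bn n) (u0n n)) u sequentially"
    using ext u0 unfolding has_unique_extension_def by blast
  have zero_C1: "(\<lambda>t. 0) \<in> C1_paths T"
    unfolding C1_paths_def by (auto intro!: exI[of _ "\<lambda>t. 0"] derivative_eq_intros)
  have const: "uniform_limit UNIV (\<lambda>n. u0) u0 sequentially" by (rule uniform_limit_const)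
  have lim0: "uniform_limit ?S (\<lambda>n. solution_operator T H (\<lambda>t. 0) u0) u sequentially"
    using u[of "\<lambda>n t. 0" "\<lambda>n. u0"] zero_C1 u0 const by (simp add: uniform_limit_const)
  have z0: "viscosity_solution T H (\<lambda>t. 0) u0 (restrict (\<lambda>z. u0 (fst z)) ?S)"
  proof -
    have "path_hamiltonian H (\<lambda>t. 0) = (\<lambda>p t. 0)" by (simp add: path_hamiltonian_def fun_eq_iff)
    moreover have "viscosity_solution T H (\<lambda>t. 0) u0 w \<longleftrightarrow> hj_solution T (path_hamiltonian H (\<lambda>t. 0)) u0 w" for w
      by (rule viscosity_solution_iff) (auto intro!: derivative_eq_intros)
    ultimately show ?thesis using hj_solution_zero[OF u0 T] by simp
  qed
  have "solution_operator T H (\<lambda>t. 0) u0 = restrict (\<lambda>z. u0 (fst z)) ?S"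
    using viscosity_solution_ex1[of T H, OF T cont zero_C1 u0] z0
      viscosity_solution_operator[of T H, OF T cont zero_C1 u0] by blast
  then have u_eq: "u z = u0 (fst z)" if "z \<in> ?S" for z
    using tendsto_uniform_limitI[OF lim0 that] that by (simp add: tendsto_const_iff)
  have "\<exists>e>0. \<forall>B\<in>C1_paths T. (\<forall>t\<in>{0..T}. norm (B t) < e) \<longrightarrow> (\<forall>z\<in>?S. \<bar>solution_operator T H B u0 z - u0 (fst z)\<bar> \<le> 1)"
  proof (rule ccontr)
    assume neg: "\<not> ?thesis"
    have "\<exists>B\<in>C1_paths T. (\<forall>t\<in>{0..T}. norm (B t) < inverse (real (Suc n))) \<and> (\<exists>z\<in>?S. 1 < \<bar>solution_operator T H B u0 z - u0 (fst z)\<bar>)" for n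
    proof -
      have "inverse (real (Suc n)) > 0" by simp
      with neg show ?thesis by (meson not_less)
    qed
    then obtain Bn where Bn: "\<And>n. Bn n \<in> C1_paths T" "\<And>n t. t \<in> {0..T} \<Longrightarrow> norm (Bn n t) < inverse (real (Suc n))"
      "\<And>n. \<exists>z\<in>?S. 1 < \<bar>solution_operator T H (Bn n) u0 z - u0 (fst z)\<bar>" by metis
    have "uniform_limit {0..T} Bn (\<lambda>t. 0) sequentially"
    proof (rule uniform_limitI)
      fix e :: real assume "e > 0"
      from order_tendstoD(2)[OF LIMSEQ_inverse_real_of_nat this]
      show "\<forall>\<^sub>F n in sequentially. \<forall>t\<in>{0..T}. dist (Bn n t) 0 < e"
        by eventually_elim (use Bn(2) in \<open>force intro: less_trans\<close>)
    qed
    then have "uniform_limit ?S (\<lambda>n. solution_operator T H (Bn n) u0) u sequentially"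
      using u[of Bn "\<lambda>n. u0"] Bn(1) u0 const by blast
    then have "\<forall>\<^sub>F n in sequentially. \<forall>z\<in>?S. dist (solution_operator T H (Bn n) u0 z) (u z) < 1"
      by (rule uniform_limitD) simp
    then have "\<exists>n. \<forall>z\<in>?S. dist (solution_operator T H (Bn n) u0 z) (u z) < 1"
      by (rule eventually_happens'[OF sequentially_bot])
    then obtain n where n: "\<forall>z\<in>?S. dist (solution_operator T H (Bn n) u0 z) (u z) < 1" by blast
    obtain z where z: "z \<in> ?S" "1 < \<bar>solution_operator T H (Bn n) u0 z - u0 (fst z)\<bar>" using Bn(3)[of n] by blast
    show False using bspec[OF n z(1)] z(2) u_eq[OF z(1)] by (simp add: dist_real_def)
  qed
  then show ?thesis using that by blast
qed

text \<open>The upper limit in the form in which it is combined later: an event that happens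
  frequently can be joined with finitely many that happen eventually.\<close>

lemma limsup_witness:
  fixes a :: "nat \<Rightarrow> real"
  assumes bd: "\<And>n. \<bar>a n\<bar> \<le> M"
  shows "\<exists>L. (\<forall>e>0. \<forall>\<^sub>F n in sequentially. a n < L + e) \<and> (\<forall>e>0. \<exists>\<^sub>F n in sequentially. L - e < a n)"
proof -
  define S where "S = (\<lambda>n. SUP k\<in>{n..}. a k)"
  have bda: "bdd_above (a ` {n..})" for n by (rule bdd_aboveI2[of _ _ M]) (use bd in \<open>simp add: abs_le_iff\<close>)
  have S_ge: "a k \<le> S n" if "n \<le> k" for n k unfolding S_def using that bda by (intro cSUP_upper) auto
  have bdS: "bdd_below (range S)"
    by (rule bdd_belowI2[of _ "- M"]) (use bd S_ge in \<open>meson abs_le_D2 minus_le_iff order_refl order_trans\<close>)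
  show ?thesis
  proof (intro exI[of _ "INF n. S n"] conjI allI impI)
    fix e :: real assume e: "e > 0"
    have "(INF n. S n) < (INF n. S n) + e" using e by simp
    then obtain n where "S n < (INF n. S n) + e" using cINF_less_iff[OF _ bdS] by blast
    then show "\<forall>\<^sub>F n in sequentially. a n < (INF n. S n) + e"
      unfolding eventually_sequentially using S_ge by (meson le_less_trans)
    show "\<exists>\<^sub>F n in sequentially. (INF n. S n) - e < a n"
      unfolding frequently_sequentially
    proof
      fix n
      have "(INF n. S n) \<le> S n" by (rule cINF_lower[OF bdS]) simp
      then have "(INF n. S n) - e < (SUP k\<in>{n..}. a k)" using e unfolding S_def by linarith
      then show "\<exists>k\<ge>n. (INF n. S n) - e < a k" using less_cSUP_iff[OF _ bda[of n]] by auto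
    qed
  qed
qed

text \<open>
  Pointwise upper limits replace a compactness argument: they preserve convexity, and they
  preserve differences that converge.
\<close>

lemma convex_difference_limit:
  fixes a c :: "nat \<Rightarrow> 'a::real_vector \<Rightarrow> real"
  assumes "\<And>n. convex_on S (a n)" "\<And>n. convex_on S (c n)"
    and bd: "\<And>n x. x \<in> S \<Longrightarrow> \<bar>a n x\<bar> \<le> M" "\<And>n x. x \<in> S \<Longrightarrow> \<bar>c n x\<bar> \<le> M"
    and lim: "\<And>x. x \<in> S \<Longrightarrow> (\<lambda>n. a n x - c n x) \<longlonglongrightarrow> f x"
  obtains A C where "convex_on S A" "convex_on S C" "\<And>x. x \<in> S \<Longrightarrow> f x = A x - C x"
proof -
  have ex: "\<exists>L. \<forall>x\<in>S. (\<forall>e>0. \<forall>\<^sub>F n in sequentially. a n x < L x + e) \<and> (\<forall>e>0. \<exists>\<^sub>F n in sequentially. L x - e < a n x)"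
    if bd: "\<And>n x. x \<in> S \<Longrightarrow> \<bar>a n x\<bar> \<le> M" for a :: "nat \<Rightarrow> 'a \<Rightarrow> real"
  proof (intro bchoice ballI)
    fix x assume x: "x \<in> S"
    show "\<exists>L. (\<forall>e>0. \<forall>\<^sub>F n in sequentially. a n x < L + e) \<and> (\<forall>e>0. \<exists>\<^sub>F n in sequentially. L - e < a n x)"
      by (rule limsup_witness[where a = "\<lambda>n. a n x" and M = M]) (rule bd[OF x])
  qed
  have cv: "convex_on S L"
    if a: "\<And>n. convex_on S (a n)"
      and L: "\<And>x e. x \<in> S \<Longrightarrow> e > 0 \<Longrightarrow> \<forall>\<^sub>F n in sequentially. a n x < L x + e" "\<And>x e. x \<in> S \<Longrightarrow> e > 0 \<Longrightarrow> \<exists>\<^sub>F n in sequentially. L x - e < a n x"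
    for a :: "nat \<Rightarrow> 'a \<Rightarrow> real" and L
  proof (rule convex_onI)
    show S: "convex S" using a[of 0] by (simp add: convex_on_def)
    fix t x y assume t: "(0::real) < t" "t < 1" and xy: "x \<in> S" "y \<in> S"
    let ?z = "(1 - t) *\<^sub>R x + t *\<^sub>R y"
    have z: "?z \<in> S" using convexD[OF S xy, of "1 - t" t] t by simp
    show "L ?z \<le> (1 - t) * L x + t * L y"
    proof (rule field_le_epsilon)
      fix e :: real assume e: "e > 0"
      then have e2: "e / 2 > 0" by simp
      have "\<exists>\<^sub>F n in sequentially. L ?z - e / 2 < a n ?z \<and> a n x < L x + e / 2 \<and> a n y < L y + e / 2"
        using frequently_eventually_conj[OF L(2)[OF z e2] eventually_conj[OF L(1)[OF xy(1) e2] L(1)[OF xy(2) e2]]]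
        by (rule frequently_elim1) auto
      then obtain n where n: "L ?z - e / 2 < a n ?z" "a n x < L x + e / 2" "a n y < L y + e / 2"
        using frequently_ex by blast
      have "a n ?z \<le> (1 - t) * a n x + t * a n y" using convex_onD[OF a, of t x y] t xy by simp
      also have "\<dots> \<le> (1 - t) * (L x + e / 2) + t * (L y + e / 2)"
        using n t by (intro add_mono mult_left_mono) auto
      also have "\<dots> = (1 - t) * L x + t * L y + e / 2" by (simp add: field_simps)
      finally show "L ?z \<le> (1 - t) * L x + t * L y + e" using n(1) by linarith
    qed
  qed
  obtain A where A: "\<And>x e. x \<in> S \<Longrightarrow> e > 0 \<Longrightarrow> \<forall>\<^sub>F n in sequentially. a n x < A x + e"
    "\<And>x e. x \<in> S \<Longrightarrow> e > 0 \<Longrightarrow> \<exists>\<^sub>F n in sequentially. A x - e < a n x" using ex[where a = a, OF bd(1)] by blast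
  obtain C where C: "\<And>x e. x \<in> S \<Longrightarrow> e > 0 \<Longrightarrow> \<forall>\<^sub>F n in sequentially. c n x < C x + e"
    "\<And>x e. x \<in> S \<Longrightarrow> e > 0 \<Longrightarrow> \<exists>\<^sub>F n in sequentially. C x - e < c n x" using ex[where a = c, OF bd(2)] by blast
  have "f x = A x - C x" if x: "x \<in> S" for x
  proof (rule antisym)
    show "f x \<le> A x - C x"
    proof (rule field_le_epsilon)
      fix e :: real assume "e > 0"
      then have e: "e / 3 > 0" by simp
      have "\<forall>\<^sub>F n in sequentially. f x - e / 3 < a n x - c n x" using e by (intro order_tendstoD(1)[OF lim[OF x]]) simp
      from frequently_eventually_conj[OF C(2)[OF x e] eventually_conj[OF A(1)[OF x e] this]]
      obtain n where "C x - e / 3 < c n x" "a n x < A x + e / 3" "f x - e / 3 < a n x - c n x"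
        using frequently_ex by blast
      then show "f x \<le> A x - C x + e" by linarith
    qed
    show "A x - C x \<le> f x"
    proof (rule field_le_epsilon)
      fix e :: real assume "e > 0"
      then have e: "e / 3 > 0" by simp
      have "\<forall>\<^sub>F n in sequentially. a n x - c n x < f x + e / 3" using e by (intro order_tendstoD(2)[OF lim[OF x]]) simp
      from frequently_eventually_conj[OF A(2)[OF x e] eventually_conj[OF C(1)[OF x e] this]]
      obtain n where "A x - e / 3 < a n x" "c n x < C x + e / 3" "a n x - c n x < f x + e / 3"
        using frequently_ex by blast
      then show "A x - C x \<le> f x + e" by linarith
    qed
  qed
  then show ?thesis using that cv[OF assms(1) A] cv[OF assms(2) C] by blast
qed

section \<open>Gluing convex decompositions of growing balls\<close>

lemma convex_on_max:
  fixes f g :: "'a::real_vector \<Rightarrow> real"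
  assumes "convex_on S f" "convex_on S g"
  shows "convex_on S (\<lambda>x. max (f x) (g x))"
proof (rule convex_onI)
  show "convex S" using assms(1) by (simp add: convex_on_def)
  fix t x y assume t: "(0::real) < t" "t < 1" and xy: "x \<in> S" "y \<in> S"
  have "f ((1 - t) *\<^sub>R x + t *\<^sub>R y) \<le> (1 - t) * f x + t * f y"
    using convex_onD[OF assms(1), of t x y] t xy by simp
  also have "\<dots> \<le> (1 - t) * max (f x) (g x) + t * max (f y) (g y)"
    using t by (intro add_mono mult_left_mono) auto
  finally have 1: "f ((1 - t) *\<^sub>R x + t *\<^sub>R y) \<le> (1 - t) * max (f x) (g x) + t * max (f y) (g y)" .
  have "g ((1 - t) *\<^sub>R x + t *\<^sub>R y) \<le> (1 - t) * g x + t * g y"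
    using convex_onD[OF assms(2), of t x y] t xy by simp
  also have "\<dots> \<le> (1 - t) * max (f x) (g x) + t * max (f y) (g y)"
    using t by (intro add_mono mult_left_mono) auto
  finally show "max (f ((1 - t) *\<^sub>R x + t *\<^sub>R y)) (g ((1 - t) *\<^sub>R x + t *\<^sub>R y)) \<le> (1 - t) * max (f x) (g x) + t * max (f y) (g y)"
    using 1 by simp
qed

lemma convex_on_cong:
  assumes "convex_on S f" "\<And>x. x \<in> S \<Longrightarrow> f x = g x"
  shows "convex_on S g"
  using assms unfolding convex_on_def by (metis convexD)

text \<open>
  If the graph exceeded a chord, the leftmost point where the excess is maximal would violate
  convexity near that point.
\<close>

lemma locally_convex_imp_convex_on:
  fixes f :: "'a::euclidean_space \<Rightarrow> real"
  assumes S: "convex S" and loc: "\<And>x. x \<in> S \<Longrightarrow> \<exists>e>0. convex_on (ball x e) f"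
  shows "convex_on S f"
proof (rule convex_onI[OF _ S], rule ccontr)
  fix t x y assume t: "(0::real) < t" "t < 1" and xy: "x \<in> S" "y \<in> S"
    and neg: "\<not> f ((1 - t) *\<^sub>R x + t *\<^sub>R y) \<le> (1 - t) * f x + t * f y"
  define \<xi> where "\<xi> = (\<lambda>s. (1 - s) *\<^sub>R x + s *\<^sub>R y)"
  have xiS: "\<xi> s \<in> S" if "s \<in> {0..1}" for s
    using convexD[OF S xy, of "1 - s" s] that by (simp add: \<xi>_def)
  have xi_cont: "continuous_on UNIV \<xi>" unfolding \<xi>_def by (intro continuous_intros)
  have f_cont: "isCont f z" if "z \<in> S" for z
  proof -
    obtain e where e: "e > 0" "convex_on (ball z e) f" using loc[OF \<open>z \<in> S\<close>] by blast
    have "continuous_on (ball z e) f" by (rule convex_on_continuous[OF open_ball e(2)])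
    then show ?thesis using e(1) by (simp add: continuous_on_eq_continuous_at)
  qed
  define g where "g = (\<lambda>s. f (\<xi> s) - ((1 - s) * f x + s * f y))"
  have "continuous_on S f" using f_cont by (simp add: continuous_at_imp_continuous_on)
  then have "continuous_on {0..1} (\<lambda>s. f (\<xi> s))"
    using xiS by (intro continuous_on_compose2[of S f "{0..1}" \<xi>] continuous_on_subset[OF xi_cont]) auto
  then have g_cont: "continuous_on {0..1} g" unfolding g_def by (intro continuous_intros)
  then obtain s1 where s1: "s1 \<in> {0..1}" "\<And>s. s \<in> {0..1} \<Longrightarrow> g s \<le> g s1"
    using continuous_attains_sup[of "{0..1}" g] by auto
  have "g t > 0" using neg by (simp add: g_def \<xi>_def)
  then have M: "g s1 > 0" using s1(2)[of t] t by simp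
  define Z where "Z = {s \<in> {0..1}. g s = g s1}"
  have "closed Z" unfolding Z_def by (rule continuous_closed_preimage_constant[OF g_cont]) simp
  moreover have "{0..1} \<inter> Z = Z" by (auto simp: Z_def)
  ultimately have "compact Z" using compact_Int_closed[of "{0..1::real}" Z] by simp
  moreover have "Z \<noteq> {}" using s1(1) by (auto simp: Z_def)
  ultimately have "\<exists>s0\<in>Z. \<forall>s\<in>Z. s0 \<le> s" by (rule compact_attains_inf)
  then obtain s0 where s0: "s0 \<in> Z" "\<And>s. s \<in> Z \<Longrightarrow> s0 \<le> s" by blast
  have "g 0 = 0" "g 1 = 0" by (simp_all add: g_def \<xi>_def)
  then have s01: "0 < s0" "s0 < 1" using s0(1) M by (auto simp: Z_def less_le)
  obtain e where e: "e > 0" "convex_on (ball (\<xi> s0) e) f"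
    using loc[OF xiS, of s0] s01 by auto
  define d where "d = Min {s0 / 2, (1 - s0) / 2, e / (2 * (norm (y - x) + 1))}"
  have np: "norm (y - x) + 1 > 0" by (simp add: add_nonneg_pos)
  have d0: "d > 0" using s01 e np by (simp add: d_def)
  have d_le: "d \<le> s0 / 2" "d \<le> (1 - s0) / 2" "d \<le> e / (2 * (norm (y - x) + 1))"
    unfolding d_def by (rule Min_le; simp)+
  have "d * (2 * (norm (y - x) + 1)) \<le> e" using d_le(3) np by (subst pos_le_divide_eq[symmetric]) auto
  moreover have "norm (y - x) < 2 * (norm (y - x) + 1)"
    by (smt (verit) norm_ge_zero)
  from mult_strict_left_mono[OF this d0] have "d * norm (y - x) < d * (2 * (norm (y - x) + 1))" .
  ultimately have de: "d * norm (y - x) < e" by linarith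
  have diff: "\<xi> s0 - \<xi> (s0 + h) = h *\<^sub>R (x - y)" for h by (simp add: \<xi>_def algebra_simps)
  have inb: "\<xi> (s0 + d) \<in> ball (\<xi> s0) e" "\<xi> (s0 + - d) \<in> ball (\<xi> s0) e"
    using de d0 by (simp_all only: mem_ball dist_norm diff norm_scaleR abs_minus_cancel norm_minus_commute[of x y] abs_of_pos)
  have mid: "(1 - 1/2) *\<^sub>R \<xi> (s0 + - d) + (1/2) *\<^sub>R \<xi> (s0 + d) = \<xi> s0"
  proof -
    have "(1 - 1/2) *\<^sub>R \<xi> (s0 + - d) + (1/2) *\<^sub>R \<xi> (s0 + d) = (1/2) *\<^sub>R (\<xi> (s0 + - d) + \<xi> (s0 + d))"
      by (simp add: scaleR_add_right)
    also have "\<xi> (s0 + - d) + \<xi> (s0 + d) = \<xi> s0 + \<xi> s0"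
      by (simp add: \<xi>_def algebra_simps)
    finally show ?thesis by (simp add: scaleR_half_double)
  qed
  have "f (\<xi> s0) \<le> (1 - 1/2) * f (\<xi> (s0 + - d)) + 1/2 * f (\<xi> (s0 + d))"
    using convex_onD[OF e(2), of "1/2", OF _ _ inb(2,1)] unfolding mid by simp
  then have "g s0 \<le> (g (s0 + - d) + g (s0 + d)) / 2" by (simp add: g_def field_simps)
  moreover have "g (s0 + d) \<le> g s1" using d_le d0 s01 by (intro s1(2)) auto
  moreover have "g (s0 + - d) < g s1"
  proof -
    have i: "s0 + - d \<in> {0..1}" using d_le d0 s01 by auto
    have "s0 + - d \<notin> Z" using s0(2)[of "s0 + - d"] d0 by auto
    then show ?thesis using s1(2)[OF i] i by (auto simp: Z_def)
  qed
  moreover have "g s0 = g s1" using s0(1) by (simp add: Z_def)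
  ultimately show False by argo
qed

text \<open>Encodes the decomposition \<open>f = (f + h) - h\<close> by the single function
  \<open>h\<close>. This suits gluing by maxima, because \<open>f + max k \<psi>\<close> is
  \<open>max (f + k) (f + \<psi>)\<close> and both convexity conditions survive.\<close>

definition convexifies :: "('a::real_normed_vector \<Rightarrow> real) \<Rightarrow> real \<Rightarrow> ('a \<Rightarrow> real) \<Rightarrow> bool" where
  "convexifies f r h \<longleftrightarrow> convex_on (ball 0 r) h \<and> convex_on (ball 0 r) (\<lambda>x. f x + h x)"

text \<open>
  \<open>c\<close> is chosen such that \<open>h + c (\<bar>x\<bar> - r + 7/8)\<close> lies below \<open>k\<close> on the ball of radius \<open>r - 1\<close>
  and above it on a shell inside the ball of radius \<open>r\<close>; the maximum of the two then extends \<open>k\<close>.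
\<close>

lemma convexifies_extend:
  fixes f :: "'a::euclidean_space \<Rightarrow> real"
  assumes r: "r \<ge> 1" and k: "convexifies f r k" and h: "convexifies f (r + 1) h"
  obtains k' where "convexifies f (r + 1) k'" "\<And>x. norm x < r - 1 \<Longrightarrow> k' x = k x"
proof -
  have bd: "\<exists>M. \<forall>x\<in>cball 0 (r - 1/2). \<bar>q x\<bar> \<le> M" if "convex_on (ball 0 \<rho>) q" "\<rho> > r - 1/2" for q :: "'a \<Rightarrow> real" and \<rho>
  proof -
    have "continuous_on (cball 0 (r - 1/2)) q"
      by (rule continuous_on_subset[OF convex_on_continuous[OF open_ball that(1)]]) (use that(2) in auto)
    then have "bounded (q ` cball 0 (r - 1/2))" by (intro compact_imp_bounded compact_continuous_image) auto
    then show ?thesis unfolding bounded_iff by auto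
  qed
  obtain M1 where M1: "\<And>x. norm x \<le> r - 1/2 \<Longrightarrow> \<bar>k x\<bar> \<le> M1"
    using bd[of r k] k by (fastforce simp: convexifies_def)
  obtain M2 where M2: "\<And>x. norm x \<le> r - 1/2 \<Longrightarrow> \<bar>h x\<bar> \<le> M2"
    using bd[of "r + 1" h] h by (fastforce simp: convexifies_def)
  define M where "M = \<bar>M1\<bar> + \<bar>M2\<bar> + 1"
  \<comment> \<open>The norm differs from \<open>r - 7/8\<close> by at least 1/8 both inside radius
    \<open>r - 1\<close> and outside radius \<open>r - 3/4\<close>, and \<open>c / 8 = M\<close>
    exceeds the bounds of \<open>k\<close> and \<open>h\<close> together.\<close>
  define c where "c = 8 * M"
  have "M > 0" by (simp add: M_def add_nonneg_pos)
  then have c: "c > 0" by (simp add: c_def)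
  define \<psi> where "\<psi> = (\<lambda>x. h x + c * (norm x - (r - 7/8)))"
  have nc: "convex_on (ball 0 (r + 1)) (\<lambda>x :: 'a. c * (norm x - (r - 7/8)))"
  proof -
    have "convex_on (ball 0 (r + 1)) (\<lambda>x :: 'a. c * norm x + - c * (r - 7/8))"
      using c by (intro convex_on_add convex_on_cmul convex_on_const[THEN iffD2] convex_on_dist[of _ "0::'a", simplified]) auto
    then show ?thesis by (simp add: algebra_simps)
  qed
  have psi: "convex_on (ball 0 (r + 1)) \<psi>" "convex_on (ball 0 (r + 1)) (\<lambda>x. f x + \<psi> x)"
    using convex_on_add[OF _ nc, of h] convex_on_add[OF _ nc, of "\<lambda>x. f x + h x"] h
    unfolding \<psi>_def convexifies_def by (simp_all add: add.assoc)
  have below: "\<psi> x < k x" if "norm x < r - 1" for x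
  proof -
    have "c * (norm x - (r - 7/8)) \<le> c * (- 1/8)" using that c by (intro mult_left_mono) auto
    moreover have "c * (- 1/8) = - M" by (simp add: c_def)
    moreover have "\<bar>k x\<bar> \<le> M1" "\<bar>h x\<bar> \<le> M2" using that by (auto intro: M1 M2)
    ultimately show ?thesis unfolding \<psi>_def M_def by linarith
  qed
  have above: "k x \<le> \<psi> x" if "r - 3/4 < norm x" "norm x < r - 1/2" for x
  proof -
    have "c * (1/8) \<le> c * (norm x - (r - 7/8))" using that c by (intro mult_left_mono) auto
    moreover have "c * (1/8) = M" by (simp add: c_def)
    moreover have "\<bar>k x\<bar> \<le> M1" "\<bar>h x\<bar> \<le> M2" using that by (auto intro: M1 M2)
    ultimately show ?thesis unfolding \<psi>_def M_def by linarith
  qed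
  \<comment> \<open>The switch at radius \<open>r - 1/2\<close> leaves no seam, since
    \<open>\<psi>\<close> already attains the maximum on the shell from \<open>r - 3/4\<close>
    on.\<close>
  define k' where "k' = (\<lambda>x. if norm x < r - 1/2 then max (k x) (\<psi> x) else \<psi> x)"
  have outer: "k' x = \<psi> x" if "r - 3/4 < norm x" for x
    using above[OF that] by (auto simp: k'_def)
  have local: "\<exists>e>0. convex_on (ball x e) k' \<and> convex_on (ball x e) (\<lambda>x. f x + k' x)" if x: "x \<in> ball 0 (r + 1)" for x
  proof (cases "norm x < r - 1/2")
    case True
    define e where "e = r - 1/2 - norm x"
    have sub: "norm y < r - 1/2" if "y \<in> ball x e" for y
      using that norm_triangle_sub[of y x] by (simp add: e_def dist_norm norm_minus_commute)
    then have "ball x e \<subseteq> ball 0 r" "ball x e \<subseteq> ball 0 (r + 1)" by force+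
    then have cv: "convex_on (ball x e) k" "convex_on (ball x e) (\<lambda>x. f x + k x)"
      "convex_on (ball x e) \<psi>" "convex_on (ball x e) (\<lambda>x. f x + \<psi> x)"
      using k psi unfolding convexifies_def by (meson convex_on_subset convex_ball)+
    have "convex_on (ball x e) k'"
      by (rule convex_on_cong[OF convex_on_max[OF cv(1,3)]]) (use sub in \<open>simp add: k'_def\<close>)
    moreover have "convex_on (ball x e) (\<lambda>x. f x + k' x)"
      by (rule convex_on_cong[OF convex_on_max[OF cv(2,4)]]) (use sub in \<open>auto simp: k'_def max_def\<close>)
    ultimately show ?thesis using True by (intro exI[of _ e]) (auto simp: e_def)
  next
    case False
    define e where "e = min (1/4) (r + 1 - norm x)"
    have e: "e > 0" using x by (simp add: e_def)
    have sub: "r - 3/4 < norm y" "norm y < r + 1" if "y \<in> ball x e" for y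
      using that False norm_triangle_sub[of y x] norm_triangle_sub[of x y]
      by (auto simp: e_def dist_norm norm_minus_commute)
    then have "ball x e \<subseteq> ball 0 (r + 1)" by force
    then have cv: "convex_on (ball x e) \<psi>" "convex_on (ball x e) (\<lambda>x. f x + \<psi> x)"
      using psi by (meson convex_on_subset convex_ball)+
    have "convex_on (ball x e) k'"
      by (rule convex_on_cong[OF cv(1)]) (use sub outer in simp)
    moreover have "convex_on (ball x e) (\<lambda>x. f x + k' x)"
      by (rule convex_on_cong[OF cv(2)]) (use sub outer in simp)
    ultimately show ?thesis using e by blast
  qed
  have "convexifies f (r + 1) k'"
    unfolding convexifies_def
    by (intro conjI locally_convex_imp_convex_on convex_ball) (use local in blast)+
  moreover have "k' x = k x" if "norm x < r - 1" for x
    using below[OF that] that by (simp add: k'_def)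
  ultimately show ?thesis using that by blast
qed

text \<open>Each extension changes the function only near the boundary of the previous ball, so on
  every fixed ball the sequence is eventually constant and has a limit that inherits both
  convexities.\<close>

lemma difference_of_convex_if_on_balls:
  fixes f :: "'a::euclidean_space \<Rightarrow> real"
  assumes ex: "\<And>r. r > 0 \<Longrightarrow> \<exists>h. convexifies f r h"
  shows "difference_of_convex f"
proof -
  let ?r = "\<lambda>n::nat. real n + 2"
  have "\<exists>k. \<forall>n. convexifies f (?r n) (k n) \<and> (\<forall>x. norm x < ?r n - 1 \<longrightarrow> k (Suc n) x = k n x)"
  proof (rule dependent_nat_choice)
    show "\<exists>h. convexifies f (?r 0) h" using ex by simp
    fix k n assume k: "convexifies f (?r n) k"
    obtain h where h: "convexifies f (?r n + 1) h" using ex[of "?r n + 1"] by auto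
    have "1 \<le> ?r n" by simp
    from convexifies_extend[OF this k h] obtain k' where "convexifies f (?r n + 1) k'" "\<And>x. norm x < ?r n - 1 \<Longrightarrow> k' x = k x"
      by metis
    then show "\<exists>k'. convexifies f (?r (Suc n)) k' \<and> (\<forall>x. norm x < ?r n - 1 \<longrightarrow> k' x = k x)"
      by (intro exI[of _ k']) (auto simp: algebra_simps)
  qed
  then obtain k where k: "\<And>n. convexifies f (?r n) (k n)" "\<And>n x. norm x < ?r n - 1 \<Longrightarrow> k (Suc n) x = k n x"
    by blast
  have stable: "k (n + j) x = k n x" if "norm x < real n + 1" for n j x
  proof (induction j)
    case (Suc j)
    have "k (Suc (n + j)) x = k (n + j) x" using that by (intro k(2)) auto
    then show ?case using Suc by simp
  qed simp
  \<comment> \<open>This index satisfies \<open>norm x < index + 1\<close>, the region in which all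
    later functions agree with the chosen one.\<close>
  define h where "h = (\<lambda>x. k (nat \<lceil>norm x\<rceil>) x)"
  have h: "h x = k n x" if x: "norm x < real n + 1" for x n
  proof -
    have N: "norm x < real (nat \<lceil>norm x\<rceil>) + 1" by linarith
    have "k n x = k (n + nat \<lceil>norm x\<rceil>) x" using stable[OF x] by simp
    also have "\<dots> = h x" using stable[OF N, of n] by (simp add: h_def add.commute)
    finally show ?thesis by simp
  qed
  \<comment> \<open>The values 0 and 1 of \<open>c\<close> treat \<open>h\<close> and
    \<open>f + h\<close> at once.\<close>
  have glob: "convex_on UNIV (\<lambda>x. c * f x + h x)" if c: "c = 0 \<or> c = 1" for c
  proof (rule convex_onI)
    fix t :: real and x y :: 'a assume t: "0 < t" "t < 1"
    obtain n where n: "max (norm x) (norm y) < real n" using reals_Archimedean2 by blast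
    have xy: "x \<in> ball 0 (real n + 1)" "y \<in> ball 0 (real n + 1)" using n by auto
    have z: "(1 - t) *\<^sub>R x + t *\<^sub>R y \<in> ball 0 (real n + 1)"
      using convexD[OF convex_ball xy, of "1 - t" t] t by simp
    have "convex_on (ball 0 (?r n)) (\<lambda>x. c * f x + k n x)"
      using k(1)[of n] c by (auto simp: convexifies_def)
    from convex_onD[OF this, of t x y] xy t
    have "c * f ((1 - t) *\<^sub>R x + t *\<^sub>R y) + k n ((1 - t) *\<^sub>R x + t *\<^sub>R y) \<le> (1 - t) * (c * f x + k n x) + t * (c * f y + k n y)"
      by simp
    then show "c * f ((1 - t) *\<^sub>R x + t *\<^sub>R y) + h ((1 - t) *\<^sub>R x + t *\<^sub>R y) \<le> (1 - t) * (c * f x + h x) + t * (c * f y + h y)"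
      using h[of x n] h[of y n] h[of "(1 - t) *\<^sub>R x + t *\<^sub>R y" n] xy z by simp
  qed simp
  show ?thesis
    unfolding difference_of_convex_def
    by (intro exI[of _ "\<lambda>x. f x + h x"] exI[of _ h]) (use glob[of 1] glob[of 0] in simp)
qed

section \<open>Oscillating paths and the cone datum\<close>

lemma cosine_path:
  fixes \<kappa> \<omega> :: real
  defines "b \<equiv> \<lambda>t. \<kappa> / 2 * (1 - cos (\<omega> * t))"
  shows "(b has_real_derivative \<kappa> / 2 * (\<omega> * sin (\<omega> * t))) (at t within A)"
    and "\<kappa> > 0 \<Longrightarrow> 0 \<le> b t" and "\<kappa> > 0 \<Longrightarrow> b t \<le> \<kappa>"
proof -
  show "(b has_real_derivative \<kappa> / 2 * (\<omega> * sin (\<omega> * t))) (at t within A)"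
    unfolding b_def by (auto intro!: derivative_eq_intros)
  assume k: "\<kappa> > 0"
  then show "0 \<le> b t" unfolding b_def using cos_le_one[of "\<omega> * t"] by (intro mult_nonneg_nonneg) auto
  have "\<kappa> / 2 * (1 - cos (\<omega> * t)) \<le> \<kappa> / 2 * 2"
    using k cos_ge_minus_one[of "\<omega> * t"] by (intro mult_left_mono) auto
  then show "b t \<le> \<kappa>" by (simp add: b_def)
qed

lemma axis_path:
  assumes b: "\<And>t. t \<in> {0..T} \<Longrightarrow> (b has_real_derivative b' t) (at t within {0..T})"
    and "continuous_on {0..T} b'" "b 0 = 0"
  shows "(\<lambda>t. b t *\<^sub>R axis i 1 :: real^'m::finite) \<in> C1_paths T"
    and "\<And>t. t \<in> {0..T} \<Longrightarrow> ((\<lambda>t. b t *\<^sub>R axis i 1 :: real^'m) has_vector_derivative b' t *\<^sub>R axis i 1) (at t within {0..T})"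
    and "path_hamiltonian H (\<lambda>t. b' t *\<^sub>R axis i 1) p t = H i p * b' t"
proof -
  show d: "((\<lambda>t. b t *\<^sub>R axis i 1 :: real^'m) has_vector_derivative b' t *\<^sub>R axis i 1) (at t within {0..T})" if "t \<in> {0..T}" for t
    using b[OF that] by (auto intro!: derivative_eq_intros simp: has_real_derivative_iff_has_vector_derivative)
  have "continuous_on {0..T} (\<lambda>t. b' t *\<^sub>R (axis i 1 :: real^'m))" using assms(2) by (intro continuous_intros)
  then show "(\<lambda>t. b t *\<^sub>R axis i 1 :: real^'m::finite) \<in> C1_paths T"
    using d assms(3) unfolding C1_paths_def by (intro CollectI conjI exI[of _ "\<lambda>t. b' t *\<^sub>R axis i 1"] ballI) simp_all
  have "path_hamiltonian H (\<lambda>t. b' t *\<^sub>R axis i 1) p t = (\<Sum>j\<in>UNIV. if j = i then H i p * b' t else 0)"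
    unfolding path_hamiltonian_def by (rule sum.cong) (auto simp: axis_def)
  then show "path_hamiltonian H (\<lambda>t. b' t *\<^sub>R axis i 1) p t = H i p * b' t" by simp
qed

text \<open>Here \<open>a k\<close> and \<open>c k\<close> are values at successive bottoms and tops
  of the path, and \<open>q\<close> is the guaranteed gain on the way up. The surplus of each rise
  is nonnegative and, by \<open>down\<close>, at most \<open>a (Suc k) - a k\<close>, so the
  surpluses telescope and their average is at most \<open>M / Suc n\<close>.\<close>

lemma oscillating_average:
  fixes a c :: "nat \<Rightarrow> real"
  assumes up: "\<And>k. k \<le> n \<Longrightarrow> a k + q \<le> c k" and down: "\<And>k. k < n \<Longrightarrow> c k - q \<le> a (Suc k)"
    and bd: "c n - a 0 - q \<le> M"
  shows "q \<le> (\<Sum>k\<le>n. c k) / real (Suc n) - (\<Sum>k\<le>n. a k) / real (Suc n)"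
    and "(\<Sum>k\<le>n. c k) / real (Suc n) - (\<Sum>k\<le>n. a k) / real (Suc n) \<le> q + M / real (Suc n)"
proof -
  have e: "(\<Sum>k\<le>n. c k) - (\<Sum>k\<le>n. a k) = (\<Sum>k\<le>n. c k - a k)" by (simp add: sum_subtractf)
  have "(\<Sum>k\<le>n. q) \<le> (\<Sum>k\<le>n. c k - a k)"
    by (intro sum_mono) (use up in \<open>auto simp: algebra_simps\<close>)
  then have "q * real (Suc n) \<le> (\<Sum>k\<le>n. c k) - (\<Sum>k\<le>n. a k)" by (simp add: e algebra_simps)
  then show "q \<le> (\<Sum>k\<le>n. c k) / real (Suc n) - (\<Sum>k\<le>n. a k) / real (Suc n)"
    by (simp only: diff_divide_distrib[symmetric]) (subst pos_le_divide_eq; simp)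
  have "(\<Sum>k\<le>n. c k - a k - q) = (\<Sum>k<n. c k - a k - q) + (c n - a n - q)"
    by (simp add: lessThan_Suc_atMost[symmetric])
  also have "(\<Sum>k<n. c k - a k - q) \<le> (\<Sum>k<n. a (Suc k) - a k)"
    by (intro sum_mono) (use down in \<open>auto simp: algebra_simps\<close>)
  also have "(\<Sum>k<n. a (Suc k) - a k) = a n - a 0" by (rule sum_lessThan_telescope)
  finally have "(\<Sum>k\<le>n. c k - a k - q) \<le> M" using bd by linarith
  moreover have "(\<Sum>k\<le>n. c k - a k - q) = (\<Sum>k\<le>n. c k) - (\<Sum>k\<le>n. a k) - q * real (Suc n)"
    by (simp add: sum_subtractf mult.commute)
  ultimately have "(\<Sum>k\<le>n. c k) - (\<Sum>k\<le>n. a k) \<le> q * real (Suc n) + M" by linarith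
  then have "((\<Sum>k\<le>n. c k) - (\<Sum>k\<le>n. a k)) / real (Suc n) \<le> (q * real (Suc n) + M) / real (Suc n)"
    by (intro divide_right_mono) auto
  also have "\<dots> = q + M / real (Suc n)" by (simp add: add_divide_distrib)
  finally show "(\<Sum>k\<le>n. c k) / real (Suc n) - (\<Sum>k\<le>n. a k) / real (Suc n) \<le> q + M / real (Suc n)"
    by (simp add: diff_divide_distrib)
qed

lemma cone_BUC:
  fixes L R :: real
  assumes that: "L \<ge> 0" "R \<ge> 0"
  shows "(\<lambda>x :: real^'d. L * min (norm x) R) \<in> BUC UNIV"
  unfolding BUC_def
proof (intro CollectI conjI)
  show "(\<lambda>x :: real^'d. L * min (norm x) R) \<in> extensional UNIV" by (simp add: extensional_def)
  show "bounded (range (\<lambda>x :: real^'d. L * min (norm x) R))"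
    unfolding bounded_iff using that by (intro exI[of _ "L * R"]) (auto simp: abs_mult intro!: mult_left_mono)
  have "L-lipschitz_on UNIV (\<lambda>x :: real^'d. L * min (norm x) R)"
  proof (rule lipschitz_onI)
    fix x y :: "real^'d"
    have "\<bar>min (norm x) R - min (norm y) R\<bar> \<le> norm (x - y)"
      using norm_triangle_ineq3[of x y] by (auto simp: min_def)
    then show "dist (L * min (norm x) R) (L * min (norm y) R) \<le> L * dist x y"
      using that by (simp add: dist_real_def dist_norm right_diff_distrib[symmetric] abs_mult mult_left_mono)
  qed (use that in auto)
  then show "uniformly_continuous_on UNIV (\<lambda>x :: real^'d. L * min (norm x) R)"
    by (rule lipschitz_on_uniformly_continuous)
qed

text \<open>The averages over bottoms and tops are concave in \<open>p\<close> and bounded uniformly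
  in \<open>n\<close>, and their difference tends to \<open>\<kappa> * H i p\<close>. The height
  \<open>\<kappa>\<close> comes from the closeness radius of a cone depending on \<open>r\<close>,
  so the result is confined to one ball.\<close>

lemma has_unique_extension_imp_convexifies:
  fixes H :: "'m::finite \<Rightarrow> real^'d \<Rightarrow> real"
  assumes T: "T > 0" and cont: "\<And>i. continuous_on UNIV (H i)" and ext: "has_unique_extension T H"
    and r: "r > 0"
  shows "\<exists>h. convexifies (H i) r h"
proof -
  \<comment> \<open>For \<open>norm p \<le> r\<close> the slope \<open>r + 1\<close> gives
    \<open>u0 x - p \<bullet> x \<ge> norm x\<close> up to radius 4. With solutions within 1 of
    \<open>u0\<close>, the value on the sphere is at least 3, above the level 2 that a barrier
    starting at \<open>m \<le> 1\<close> can reach.\<close>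
  define u0 where "u0 = (\<lambda>x :: real^'d. (r + 1) * min (norm x) 4)"
  have u0: "u0 \<in> BUC UNIV" unfolding u0_def using r by (intro cone_BUC) auto
  obtain e where e: "e > 0" and close: "\<And>B z. B \<in> C1_paths T \<Longrightarrow> (\<And>t. t \<in> {0..T} \<Longrightarrow> norm (B t) < e) \<Longrightarrow>
     z \<in> slab T \<Longrightarrow> \<bar>solution_operator T H B u0 z - u0 (fst z)\<bar> \<le> 1"
    using has_unique_extension_imp_close[of T H, OF T cont ext u0] by metis
  have "continuous_on (cball 0 r) (H i)" using cont by (rule continuous_on_subset) simp
  then have "bounded (H i ` cball 0 r)" by (intro compact_imp_bounded compact_continuous_image) auto
  then obtain h where h: "\<And>p. p \<in> cball 0 r \<Longrightarrow> \<bar>H i p\<bar> \<le> h" unfolding bounded_iff by fastforce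
  have h0: "h \<ge> 0" using h[of 0] r by force
  \<comment> \<open>Below \<open>e\<close>, so that all the oscillating paths are in the range of
    \<open>close\<close>, and small enough that \<open>\<kappa> * H i p\<close> is at most 1 in
    absolute value.\<close>
  define \<kappa> where "\<kappa> = min (e / 2) (1 / (h + 1))"
  have \<kappa>: "\<kappa> > 0" "\<kappa> < e" using e h0 by (auto simp: \<kappa>_def min_def)
  have \<kappa>h: "\<bar>\<kappa> * H i p\<bar> \<le> 1" if "norm p \<le> r" for p
  proof -
    have "\<kappa> * \<bar>H i p\<bar> \<le> (1 / (h + 1)) * (h + 1)"
      using h[of p] that \<kappa> h0 by (intro mult_mono) (auto simp: \<kappa>_def)
    then show ?thesis using \<kappa> h0 by (simp add: abs_mult)
  qed
  define b where "b = (\<lambda>n t. \<kappa> / 2 * (1 - cos (2 * pi * real (Suc n) / T * t)))"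
  define b' where "b' = (\<lambda>n t. \<kappa> / 2 * ((2 * pi * real (Suc n) / T) * sin (2 * pi * real (Suc n) / T * t)))"
  have b_deriv: "(b n has_real_derivative b' n t) (at t within A)" for n t A
    unfolding b_def b'_def by (rule cosine_path)
  have b_bounds: "0 \<le> b n t" "b n t \<le> \<kappa>" for n t
    unfolding b_def using cosine_path(2,3)[OF \<kappa>(1)] by blast+
  have b'_cont: "continuous_on A (b' n)" for n A unfolding b'_def by (intro continuous_intros)
  have b_cont: "continuous_on A (b n)" for n A unfolding b_def by (intro continuous_intros)
  have b0: "b n 0 = 0" for n by (simp add: b_def)
  define B where "B = (\<lambda>n t. b n t *\<^sub>R axis i 1 :: real^'m)"
  note path = axis_path[where b = "b n" and b' = "b' n" and T = T for n, OF b_deriv b'_cont b0]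
  have B: "B n \<in> C1_paths T" for n unfolding B_def by (rule path)
  have B_small: "norm (B n t) < e" for n t
    using b_bounds[of n t] \<kappa>(2) by (simp add: B_def)
  define u where "u = (\<lambda>n. solution_operator T H (B n) u0)"
  have "viscosity_solution T H (B n) u0 (u n)" for n
    unfolding u_def by (rule viscosity_solution_operator[of T H, OF T cont B u0])
  then have sol: "hj_solution T (path_hamiltonian H (\<lambda>t. b' n t *\<^sub>R axis i 1)) u0 (u n)" for n
    using viscosity_solution_iff[of T "B n" "\<lambda>t. b' n t *\<^sub>R axis i 1" H u0 "u n"] path(2) unfolding B_def by blast
  have u_close: "\<bar>u n (x, t) - u0 x\<bar> \<le> 1" if "t \<in> {0..T}" for n x t
    using close[OF B B_small, of "(x, t)" n] that by (simp add: u_def)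
  have u_cont: "continuous_on (slab T) (u n)" for n
    using sol[of n] by (auto simp: hj_solution_def BUC_def intro: uniformly_continuous_imp_continuous)
  have lower: "- 1 \<le> u n (x, t) - p \<bullet> x" if "norm x \<le> 4" "norm p \<le> r" "t \<in> {0..T}" for n x p t
  proof -
    have "p \<bullet> x \<le> norm p * norm x" by (rule norm_cauchy_schwarz)
    also have "\<dots> \<le> (r + 1) * norm x" using that by (intro mult_right_mono) auto
    also have "\<dots> = u0 x" using that by (simp add: u0_def min_def)
    finally show ?thesis using u_close[OF that(3), of n x] by linarith
  qed
  have boundary: "3 \<le> u n (x, t) - p \<bullet> x" if "norm x = 4" "norm p \<le> r" "t \<in> {0..T}" for n x p t
  proof -
    have "p \<bullet> x \<le> norm p * norm x" by (rule norm_cauchy_schwarz)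
    also have "\<dots> \<le> r * 4" using that by simp
    finally show ?thesis using u_close[OF that(3), of n x] that(1) by (simp add: u0_def)
  qed
  define m where "m = (\<lambda>n p t. INF x\<in>cball 0 4. u n (x, t) - p \<bullet> x)"
  have bdd: "bdd_below ((\<lambda>x. u n (x, t) - p \<bullet> x) ` cball 0 4)" if "norm p \<le> r" "t \<in> {0..T}" for n p t
    by (rule bdd_belowI2[of _ "- 1"]) (use lower that in auto)
  have m_le: "m n p t \<le> u n (x, t) - p \<bullet> x" if "norm p \<le> r" "t \<in> {0..T}" "norm x \<le> 4" for n p t x
    unfolding m_def using that by (intro cINF_lower bdd) auto
  have m_ge: "k \<le> m n p t" if "\<And>x. norm x \<le> 4 \<Longrightarrow> k \<le> u n (x, t) - p \<bullet> x" for k n p t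
    unfolding m_def using that by (intro cINF_greatest) auto
  have m_bounds: "\<bar>m n p t\<bar> \<le> 1" if "norm p \<le> r" "t \<in> {0..T}" for n p t
  proof -
    have "u n (0, t) \<le> 1" using u_close[OF that(2), of n 0] by (simp add: u0_def)
    then have "m n p t \<le> 1" using m_le[OF that, of 0 n] by simp
    moreover have "- 1 \<le> m n p t" by (rule m_ge) (use lower that in auto)
    ultimately show ?thesis by simp
  qed
  have m_convex: "convex_on (ball 0 r) (\<lambda>p. - m n p t)" if t: "t \<in> {0..T}" for n t
  proof (rule convex_onI)
    fix s :: real and p q :: "real^'d" assume s: "0 < s" "s < 1" and pq: "p \<in> ball 0 r" "q \<in> ball 0 r"
    have "(1 - s) * m n p t + s * m n q t \<le> m n ((1 - s) *\<^sub>R p + s *\<^sub>R q) t"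
    proof (rule m_ge)
      fix x :: "real^'d" assume x: "norm x \<le> 4"
      have "(1 - s) * m n p t + s * m n q t \<le> (1 - s) * (u n (x, t) - p \<bullet> x) + s * (u n (x, t) - q \<bullet> x)"
        using s pq t x by (intro add_mono mult_left_mono m_le) auto
      also have "\<dots> = u n (x, t) - ((1 - s) *\<^sub>R p + s *\<^sub>R q) \<bullet> x"
        by (simp add: inner_add_left algebra_simps)
      finally show "(1 - s) * m n p t + s * m n q t \<le> u n (x, t) - ((1 - s) *\<^sub>R p + s *\<^sub>R q) \<bullet> x" .
    qed
    then show "- m n ((1 - s) *\<^sub>R p + s *\<^sub>R q) t \<le> (1 - s) * - m n p t + s * - m n q t" by simp
  qed simp
  \<comment> \<open>The affine function with intercept \<open>m n p s\<close> lies below the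
    solution at time \<open>s\<close>. Its intercept moves by \<open>H i p\<close> times the
    increment of the path, so it solves the equation exactly, and
    \<open>supersol_linear_barrier\<close> keeps it below.\<close>
  have monotone: "m n p s + H i p * (b n t - b n s) \<le> m n p t"
    if p: "norm p \<le> r" and st: "0 \<le> s" "s \<le> t" "t < T" for n p s t
  proof (rule m_ge)
    fix x :: "real^'d" assume x: "norm x \<le> 4"
    define \<beta> where "\<beta> = (\<lambda>t. m n p s + H i p * (b n t - b n s))"
    have sT: "s \<in> {0..T}" "s < T" using st by auto
    have "p \<bullet> x + \<beta> t \<le> u n (x, t)"
    proof (rule supersol_linear_barrier[where R = 4 and b = \<beta> and b' = "\<lambda>t. H i p * b' n t" and F = "path_hamiltonian H (\<lambda>t. b' n t *\<^sub>R axis i 1)"])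
      show "supersol T (path_hamiltonian H (\<lambda>t. b' n t *\<^sub>R axis i 1)) (u n)" using sol[of n] by (simp add: hj_solution_def)
      show "(\<beta> has_real_derivative H i p * b' n t) (at t)" for t
        unfolding \<beta>_def using b_deriv[of n t UNIV] by (auto intro!: derivative_eq_intros)
      show "continuous_on {0..T} \<beta>" unfolding \<beta>_def by (intro continuous_intros b_cont)
      show "continuous_on {0<..<T} (\<lambda>t. H i p * b' n t)" by (intro continuous_intros b'_cont)
      show "path_hamiltonian H (\<lambda>t. b' n t *\<^sub>R axis i 1) p t = H i p * b' n t" for t by (rule path(3))
      show "p \<bullet> x + \<beta> s \<le> u n (x, s)" if "norm x \<le> 4" for x
        using m_le[OF p sT(1) that, of n] by (simp add: \<beta>_def)
      show "p \<bullet> x + \<beta> t \<le> u n (x, t)" if "norm x = 4" "s \<le> t" "t < T" for x t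
      proof -
        have "H i p * (b n t - b n s) \<le> \<bar>H i p\<bar> * \<bar>b n t - b n s\<bar>"
          by (metis abs_ge_self abs_mult)
        also have "\<bar>b n t - b n s\<bar> \<le> \<kappa>"
          using b_bounds(1)[of n t] b_bounds(2)[of n t] b_bounds(1)[of n s] b_bounds(2)[of n s] by linarith
        then have "\<bar>H i p\<bar> * \<bar>b n t - b n s\<bar> \<le> \<bar>H i p\<bar> * \<kappa>" by (rule mult_left_mono) simp
        also have "\<dots> \<le> 1" using \<kappa>h[OF p] \<kappa>(1) by (simp add: abs_mult mult.commute)
        finally have "\<beta> t \<le> 2" using m_bounds[OF p sT(1), of n] by (simp add: \<beta>_def)
        moreover have "t \<in> {0..T}" using that st by auto
        ultimately show ?thesis using boundary[OF that(1) p, of t n] by linarith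
      qed
    qed (use u_cont st sT x in auto)
    then show "m n p s + H i p * (b n t - b n s) \<le> u n (x, t) - p \<bullet> x" by (simp add: \<beta>_def)
  qed
  \<comment> \<open>\<open>\<tau> n k\<close> are bottoms of the path \<open>b n\<close> and
    \<open>\<tau>' n k\<close> its tops. For \<open>k \<le> n\<close> all of them lie strictly
    before \<open>T\<close>, as \<open>monotone\<close> requires.\<close>
  define \<tau> where "\<tau> = (\<lambda>n k. real k * T / real (Suc n))"
  define \<tau>' where "\<tau>' = (\<lambda>n k. (real k + 1/2) * T / real (Suc n))"
  have cancel: "2 * pi * x / T * (q * T / x) = q * (2 * pi)" if "x \<noteq> 0" for x q :: real
    using T that by simp
  have b_low: "b n (\<tau> n k) = 0" for n k
  proof -
    have "2 * pi * real (Suc n) / T * \<tau> n k = 2 * real k * pi"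
      unfolding \<tau>_def by (subst cancel) simp_all
    then show ?thesis unfolding b_def using cos_2npi[of k] by (simp only:) simp
  qed
  have b_high: "b n (\<tau>' n k) = \<kappa>" for n k
  proof -
    have "2 * pi * real (Suc n) / T * \<tau>' n k = 2 * real k * pi + pi"
      unfolding \<tau>'_def by (subst cancel) (simp_all add: algebra_simps)
    moreover have "cos (2 * real k * pi + pi) = - 1" using cos_2npi[of k] by simp
    ultimately show ?thesis unfolding b_def by (simp only:) simp
  qed
  have times: "0 \<le> \<tau> n k" "\<tau> n k \<le> \<tau>' n k" "\<tau>' n k \<le> \<tau> n (Suc k)" for n k
    using T by (auto simp: \<tau>_def \<tau>'_def intro!: divide_right_mono)
  have times_T: "\<tau> n k < T" "\<tau>' n k < T" if "k \<le> n" for n k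
    using T that by (auto simp: \<tau>_def \<tau>'_def divide_less_eq)
  define a where "a = (\<lambda>n p. (\<Sum>k\<le>n. m n p (\<tau> n k)) / real (Suc n))"
  define c where "c = (\<lambda>n p. (\<Sum>k\<le>n. m n p (\<tau>' n k)) / real (Suc n))"
  have avg: "\<kappa> * H i p \<le> c n p - a n p" "c n p - a n p \<le> \<kappa> * H i p + 3 / real (Suc n)" if p: "norm p \<le> r" for n p
  proof -
    have up: "m n p (\<tau> n k) + \<kappa> * H i p \<le> m n p (\<tau>' n k)" if "k \<le> n" for k
      using monotone[OF p times(1,2) times_T(2)[OF that], of n] by (simp add: b_low b_high mult.commute)
    have down: "m n p (\<tau>' n k) - \<kappa> * H i p \<le> m n p (\<tau> n (Suc k))" if "k < n" for k
    proof -
      have "Suc k \<le> n" using that by simp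
      from monotone[OF p order_trans[OF times(1,2)] times(3) times_T(1)[OF this], of n]
      show ?thesis by (simp add: b_low b_high mult.commute)
    qed
    have "\<tau> n 0 \<in> {0..T}" "\<tau>' n n \<in> {0..T}"
      using times[of n n] times[of n 0] times_T[of n n] times_T[of 0 n] by auto
    from m_bounds[OF p this(1), of n] m_bounds[OF p this(2), of n] \<kappa>h[OF p]
    \<comment> \<open>Two values of \<open>m\<close> and \<open>\<kappa> * H i p\<close>, each at
      most 1 in absolute value; the bound does not depend on the number of oscillations.\<close>
    have bd: "m n p (\<tau>' n n) - m n p (\<tau> n 0) - \<kappa> * H i p \<le> 3" by linarith
    show "\<kappa> * H i p \<le> c n p - a n p" "c n p - a n p \<le> \<kappa> * H i p + 3 / real (Suc n)"
      unfolding a_def c_def using oscillating_average[OF up down bd] by auto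
  qed
  have avg_convex: "convex_on (ball 0 r) (\<lambda>p. - ((\<Sum>k\<le>n. m n p (\<theta> k)) / real (Suc n)))"
    and avg_bound: "\<And>p. norm p \<le> r \<Longrightarrow> \<bar>- ((\<Sum>k\<le>n. m n p (\<theta> k)) / real (Suc n))\<bar> \<le> 1"
    if \<theta>: "\<And>k. k \<le> n \<Longrightarrow> \<theta> k \<in> {0..T}" for n and \<theta> :: "nat \<Rightarrow> real"
  proof -
    have "convex_on (ball 0 r) (\<lambda>p. \<Sum>k\<in>A. - m n p (\<theta> k))" if "finite A" "A \<subseteq> {..n}" for A
      using that
    proof (induction A)
      case (insert k A)
      then have "convex_on (ball 0 r) (\<lambda>p. - m n p (\<theta> k) + (\<Sum>k\<in>A. - m n p (\<theta> k)))"
        by (intro convex_on_add m_convex \<theta>) auto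
      then show ?case by (simp only: sum.insert[OF insert.hyps])
    qed (simp add: convex_on_const)
    then have "convex_on (ball 0 r) (\<lambda>p. \<Sum>k\<le>n. - m n p (\<theta> k))" by simp
    then have "convex_on (ball 0 r) (\<lambda>p. inverse (real (Suc n)) * (\<Sum>k\<le>n. - m n p (\<theta> k)))"
      by (rule convex_on_cmul[rotated]) simp
    then show "convex_on (ball 0 r) (\<lambda>p. - ((\<Sum>k\<le>n. m n p (\<theta> k)) / real (Suc n)))"
      by (simp add: sum_negf divide_inverse mult.commute)
    fix p :: "real^'d" assume p: "norm p \<le> r"
    have "\<bar>\<Sum>k\<le>n. m n p (\<theta> k)\<bar> \<le> (\<Sum>k\<le>n. 1)"
      using m_bounds[OF p \<theta>] by (intro order_trans[OF sum_abs] sum_mono) auto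
    then show "\<bar>- ((\<Sum>k\<le>n. m n p (\<theta> k)) / real (Suc n))\<bar> \<le> 1"
      by (simp add: abs_divide divide_le_eq)
  qed
  have \<tau>T: "\<tau> n k \<in> {0..T}" "\<tau>' n k \<in> {0..T}" if "k \<le> n" for n k
    using times[of n k] times_T[OF that] by auto
  obtain A C where AC: "convex_on (ball 0 r) A" "convex_on (ball 0 r) C" "\<And>p. p \<in> ball 0 r \<Longrightarrow> \<kappa> * H i p = A p - C p"
  proof (rule convex_difference_limit[where S = "ball 0 r" and a = "\<lambda>n p. - a n p" and c = "\<lambda>n p. - c n p" and M = 1 and f = "\<lambda>p. \<kappa> * H i p"])
    show "convex_on (ball 0 r) (\<lambda>p. - a n p)" "convex_on (ball 0 r) (\<lambda>p. - c n p)" for n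
      unfolding a_def c_def by (intro avg_convex \<tau>T; assumption)+
    show "\<bar>- a n p\<bar> \<le> 1" "\<bar>- c n p\<bar> \<le> 1" if "p \<in> ball 0 r" for n p
    proof -
      have p: "norm p \<le> r" using that by simp
      show "\<bar>- a n p\<bar> \<le> 1" "\<bar>- c n p\<bar> \<le> 1"
        unfolding a_def c_def by (rule avg_bound[OF _ p]; intro \<tau>T; assumption)+
    qed
    fix p :: "real^'d" assume "p \<in> ball 0 r"
    then have p: "norm p \<le> r" by simp
    have "(\<lambda>n. \<kappa> * H i p + 3 * inverse (real (Suc n))) \<longlonglongrightarrow> \<kappa> * H i p + 3 * 0"
      by (intro tendsto_intros LIMSEQ_inverse_real_of_nat)
    then have "(\<lambda>n. \<kappa> * H i p + 3 / real (Suc n)) \<longlonglongrightarrow> \<kappa> * H i p" by (simp add: divide_inverse)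
    from tendsto_sandwich[OF _ _ tendsto_const this, of "\<lambda>n. - a n p - - c n p"]
    show "(\<lambda>n. - a n p - - c n p) \<longlonglongrightarrow> \<kappa> * H i p"
      using avg[OF p] by auto
  qed blast
  have "convexifies (H i) r (\<lambda>p. inverse \<kappa> * C p)"
    unfolding convexifies_def
  proof
    show "convex_on (ball 0 r) (\<lambda>p. inverse \<kappa> * C p)" using AC(2) \<kappa>(1) by (intro convex_on_cmul) auto
    have "convex_on (ball 0 r) (\<lambda>p. inverse \<kappa> * A p)" using AC(1) \<kappa>(1) by (intro convex_on_cmul) auto
    then show "convex_on (ball 0 r) (\<lambda>p. H i p + inverse \<kappa> * C p)"
    proof (rule convex_on_cong)
      fix p :: "real^'d" assume "p \<in> ball 0 r"
      from AC(3)[OF this] have "A p = \<kappa> * H i p + C p" by simp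
      then show "inverse \<kappa> * A p = H i p + inverse \<kappa> * C p" using \<kappa>(1) by (simp add: distrib_left)
    qed
  qed
  then show ?thesis by blast
qed

theorem theorem6p1:
  fixes T :: real and H :: "'m::finite \<Rightarrow> real^'d::finite \<Rightarrow> real"
  assumes "T > 0" and "\<And>i. continuous_on UNIV (H i)"
  shows "has_unique_extension T H \<longleftrightarrow> (\<forall>i. difference_of_convex (H i))"
proof
  assume "has_unique_extension T H"
  then show "\<forall>i. difference_of_convex (H i)"
    using has_unique_extension_imp_convexifies[of T H, OF assms]
    by (intro allI difference_of_convex_if_on_balls)
next
  assume "\<forall>i. difference_of_convex (H i)"
  then show "has_unique_extension T H"
    using dc_imp_has_unique_extension[of T H, OF assms] by blast
qed

end
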